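(* Let $\mathbb{T}^2$ be a Finsler two-torus. There exist two closed curves of lengths $a$ and $b$ generating the first integral homology group of $\mathbb{T}^2$ such that $$ \mathrm{vol}_{HT}(\mathbb{T}^2)\geq\frac{2}{\pi}\, ab. $$ Equality holds if $\mathbb{T}^2$ is homothetic to the quotient of $\mathbb{R}^2$, endowed with a parallelogram norm $\|\cdot\|$ (a norm whose unit ball is a parallelogram), by a lattice generated by two vectors of lengths $a$ and $b$, parallel to the sides of the unit ball of $\|\cdot\|$.
   Context: A (reversible) Finsler metric on a smooth manifold $M$ is a continuous function $F: TM \to [0,+\infty)$, with restriction $F_x := F|_{T_xM}$, such that: (1) $F$ is smooth outside the zero section; (2) $F_x(tv)=|t|F_x(v)$ for all $v\in T_xM$, $t\in\mathbb{R}$; (3) for every $x$, $F_x^2$ has positive definite second derivatives on $T_xM\setminus\{0\}$. The length of a piecewise smooth curve $\gamma:[a,b]\to M$ is $\ell(\gamma)=\int_a^b F(\dot\gamma(t))\,dt$. A Finsler two-torus is a two-torus endowed with a Finsler metric. Holmes-Thompson volume of a Finsler surface $M$: $\mathrm{vol}_{HT}(M)=\int_M \frac{m^*(B_x^* )}{\pi}\,dx$, where $dx$ is any volume form on $M$, $m^*$ is the restriction to $T_x^*M$ of the volume form dual to $dx$, and $B_x^*=\{f\in T_x^*M \mid F_x^*(f)\leq 1\}$ is the unit ball of the dual norm $F_x^*$; the integral does not depend on the choice of $dx$. In the equality statement the norm is neither smooth nor quadratically convex; lengths and Holmes-Thompson volume are then defined by the same formulas. Homothetic means isometric up to multiplication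 of the metric by a positive constant. *)

theory Defs
  imports "HOL-Analysis.Analysis" "HOL-Homology.Homology"
begin

section \<open>Smooth maps between open subsets of normed spaces\<close>

text \<open>\<open>C\<^sup>k\<close> regularity through iterated directional derivatives. In finite dimension and on an
  open set this is the usual notion; it is only used in that situation.\<close>

primrec Ck_on :: "nat \<Rightarrow> ('a::real_normed_vector \<Rightarrow> 'b::real_normed_vector) \<Rightarrow> 'a set \<Rightarrow> bool" where
  "Ck_on 0 f S \<longleftrightarrow> continuous_on S f"
| "Ck_on (Suc k) f S \<longleftrightarrow>
     (\<forall>x\<in>S. f differentiable (at x)) \<and> (\<forall>w. Ck_on k (\<lambda>x. frechet_derivative f (at x) w) S)"

definition smooth_on :: "('a::real_normed_vector \<Rightarrow> 'b::real_normed_vector) \<Rightarrow> 'a set \<Rightarrow> bool" where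
  "smooth_on f S \<longleftrightarrow> (\<forall>k. Ck_on k f S)"

definition second_derivative ::
  "('a::real_normed_vector \<Rightarrow> real) \<Rightarrow> 'a \<Rightarrow> 'a \<Rightarrow> 'a \<Rightarrow> real" where
  "second_derivative f v w w' =
     frechet_derivative (\<lambda>y. frechet_derivative f (at y) w) (at v) w'"


section \<open>Quotients of the plane by lattices\<close>

definition lattice_gen :: "real^2 \<Rightarrow> real^2 \<Rightarrow> (real^2) set" where
  "lattice_gen u v = {of_int m *\<^sub>R u + of_int n *\<^sub>R v | m n. True}"

definition Z2 :: "(real^2) set" where
  "Z2 = {x. \<forall>i. x $ i \<in> \<int>}"

text \<open>For a lattice \<open>L\<close> the quotient of the plane by \<open>L\<close> is the set of cosets of \<open>L\<close>. Its smooth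
  structure is the one for which \<open>proj L\<close> is a local diffeomorphism. The differential of \<open>proj L\<close>
  at any representative of a point \<open>p\<close> identifies the tangent space at \<open>p\<close> with \<open>real^2\<close>, and the
  identification does not depend on the representative, because two of them differ by a
  translation. Hence the tangent bundle is \<open>plane_mod L \<times> UNIV\<close>. A smooth two-torus is, up to
  diffeomorphism, \<open>plane_mod Z2\<close>.\<close>

definition proj :: "(real^2) set \<Rightarrow> real^2 \<Rightarrow> (real^2) set" where
  "proj L x = (\<lambda>l. x + l) ` L"

definition plane_mod :: "(real^2) set \<Rightarrow> (real^2) set set" where
  "plane_mod L = range (proj L)"

definition quotient_top :: "(real^2) set \<Rightarrow> (real^2) set topology" where
  "quotient_top L = topology (\<lambda>U. U \<subseteq> plane_mod L \<and> open (proj L -` U))"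

lemma openin_quotient_top:
  "openin (quotient_top L) U \<longleftrightarrow> U \<subseteq> plane_mod L \<and> open (proj L -` U)"
proof -
  have "istopology (\<lambda>U. U \<subseteq> plane_mod L \<and> open (proj L -` U))"
    unfolding istopology_def by (auto simp: vimage_Union)
  then show ?thesis
    by (simp add: quotient_top_def)
qed

lemma topspace_quotient_top: "topspace (quotient_top L) = plane_mod L"
proof
  show "topspace (quotient_top L) \<subseteq> plane_mod L"
    using openin_quotient_top openin_topspace by blast
  have "proj L -` plane_mod L = UNIV"
    by (auto simp: plane_mod_def)
  then have "openin (quotient_top L) (plane_mod L)"
    by (simp add: openin_quotient_top)
  then show "plane_mod L \<subseteq> topspace (quotient_top L)"
    by (rule openin_subset)
qed

lemma quotient_map_proj: "quotient_map euclidean (quotient_top L) (proj L)"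
  unfolding quotient_map_def
  by (auto simp: topspace_quotient_top openin_quotient_top plane_mod_def vimage_def)

text \<open>Smoothness and differentials of maps between quotients are read off in local lifts, that is,
  in the charts given by the local inverses of \<open>proj\<close>.\<close>

definition smooth_map ::
  "(real^2) set \<Rightarrow> (real^2) set \<Rightarrow> ((real^2) set \<Rightarrow> (real^2) set) \<Rightarrow> bool" where
  "smooth_map L L' \<Phi> \<longleftrightarrow>
     (\<forall>x. \<exists>U h. open U \<and> x \<in> U \<and> smooth_on h U \<and> (\<forall>y\<in>U. \<Phi> (proj L y) = proj L' (h y)))"

definition diffeomorphism ::
  "(real^2) set \<Rightarrow> (real^2) set \<Rightarrow> ((real^2) set \<Rightarrow> (real^2) set) \<Rightarrow> bool" where
  "diffeomorphism L L' \<Phi> \<longleftrightarrow>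
     bij_betw \<Phi> (plane_mod L) (plane_mod L') \<and> smooth_map L L' \<Phi> \<and>
     smooth_map L' L (inv_into (plane_mod L) \<Phi>)"

definition has_differential ::
  "(real^2) set \<Rightarrow> (real^2) set \<Rightarrow> ((real^2) set \<Rightarrow> (real^2) set) \<Rightarrow>
    (real^2) set \<Rightarrow> (real^2 \<Rightarrow> real^2) \<Rightarrow> bool" where
  "has_differential L L' \<Phi> p D \<longleftrightarrow>
     (\<exists>x h. p = proj L x \<and> (h has_derivative D) (at x) \<and>
        (\<forall>\<^sub>F y in nhds x. \<Phi> (proj L y) = proj L' (h y)))"

text \<open>A metric assigns to a point \<open>p\<close> and a tangent vector at \<open>p\<close> a real number. The map \<open>\<Phi>\<close>
  is a homothety of ratio \<open>r\<close> if \<open>G\<close> is \<open>r\<close> times the pull-back of \<open>G'\<close> by the diffeomorphism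
  \<open>\<Phi>\<close>.\<close>

type_synonym metric_fun = "(real^2) set \<Rightarrow> real^2 \<Rightarrow> real"

definition homothety ::
  "(real^2) set \<Rightarrow> metric_fun \<Rightarrow> (real^2) set \<Rightarrow> metric_fun \<Rightarrow> real \<Rightarrow>
    ((real^2) set \<Rightarrow> (real^2) set) \<Rightarrow> bool" where
  "homothety L G L' G' r \<Phi> \<longleftrightarrow>
     r > 0 \<and> diffeomorphism L L' \<Phi> \<and>
     (\<forall>p\<in>plane_mod L. \<forall>D. has_differential L L' \<Phi> p D \<longrightarrow>
        (\<forall>v. G p v = r * G' (\<Phi> p) (D v)))"


section \<open>Finsler metrics on the two-torus\<close>

definition finsler_metric :: "metric_fun \<Rightarrow> bool" where
  "finsler_metric F \<longleftrightarrow>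
     (\<forall>p\<in>plane_mod Z2. \<forall>v. F p v \<ge> 0) \<and>
     continuous_on UNIV (\<lambda>(x, v). F (proj Z2 x) v) \<and>
     smooth_on (\<lambda>(x, v). F (proj Z2 x) v) {(x, v). v \<noteq> 0} \<and>
     (\<forall>p\<in>plane_mod Z2. \<forall>v t. F p (t *\<^sub>R v) = \<bar>t\<bar> * F p v) \<and>
     (\<forall>p\<in>plane_mod Z2. \<forall>v w. v \<noteq> 0 \<and> w \<noteq> 0 \<longrightarrow>
        second_derivative (\<lambda>y. (F p y)\<^sup>2) v w w > 0)"

text \<open>Covectors are represented by vectors through the standard inner product. For the volume form
  \<open>dx\<close> induced by Lebesgue measure on the plane, the dual volume on covectors is then Lebesgue
  measure too, and integration over the torus is integration over the unit square, which is a
  fundamental domain of \<open>Z2\<close> up to a null set.\<close>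

definition dual_norm :: "metric_fun \<Rightarrow> (real^2) set \<Rightarrow> real^2 \<Rightarrow> real" where
  "dual_norm F p \<xi> = (SUP v\<in>{v. F p v \<le> 1}. \<xi> \<bullet> v)"

definition dual_ball :: "metric_fun \<Rightarrow> (real^2) set \<Rightarrow> (real^2) set" where
  "dual_ball F p = {\<xi>. dual_norm F p \<xi> \<le> 1}"

definition vol_HT :: "metric_fun \<Rightarrow> real" where
  "vol_HT F = integral (cbox 0 1) (\<lambda>x. measure lebesgue (dual_ball F (proj Z2 x)) / pi)"


section \<open>Closed curves on the two-torus\<close>

text \<open>Smoothness on a compact interval, endpoints included, in the usual sense: near each point
  the curve extends to a smooth curve.\<close>

definition smooth_arc :: "real \<Rightarrow> real \<Rightarrow> (real \<Rightarrow> (real^2) set) \<Rightarrow> bool" where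
  "smooth_arc a b \<gamma> \<longleftrightarrow>
     (\<forall>s\<in>{a..b}. \<exists>U c. open U \<and> s \<in> U \<and> smooth_on c U \<and>
        (\<forall>t\<in>U \<inter> {a..b}. \<gamma> t = proj Z2 (c t)))"

text \<open>Continuity of the whole curve follows, since consecutive arcs share an endpoint.\<close>

definition piecewise_smooth_curve :: "real \<Rightarrow> real \<Rightarrow> (real \<Rightarrow> (real^2) set) \<Rightarrow> bool" where
  "piecewise_smooth_curve a b \<gamma> \<longleftrightarrow>
     (\<exists>ts. length ts \<ge> 2 \<and> sorted_wrt (<) ts \<and> hd ts = a \<and> last ts = b \<and>
        (\<forall>i. Suc i < length ts \<longrightarrow> smooth_arc (ts ! i) (ts ! Suc i) \<gamma>))"

definition closed_curve :: "real \<Rightarrow> real \<Rightarrow> (real \<Rightarrow> (real^2) set) \<Rightarrow> bool" where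
  "closed_curve a b \<gamma> \<longleftrightarrow> piecewise_smooth_curve a b \<gamma> \<and> \<gamma> a = \<gamma> b"

definition has_velocity :: "(real \<Rightarrow> (real^2) set) \<Rightarrow> real \<Rightarrow> real^2 \<Rightarrow> bool" where
  "has_velocity \<gamma> t v \<longleftrightarrow>
     (\<exists>c. (c has_vector_derivative v) (at t) \<and> (\<forall>\<^sub>F s in nhds t. \<gamma> s = proj Z2 (c s)))"

text \<open>Unspecified where the curve has no velocity; for a piecewise smooth curve this concerns only
  finitely many parameters. The next lemmas show that a velocity is unique.\<close>

definition velocity :: "(real \<Rightarrow> (real^2) set) \<Rightarrow> real \<Rightarrow> real^2" where
  "velocity \<gamma> t = (THE v. has_velocity \<gamma> t v)"

lemma proj_Z2_eq_iff: "proj Z2 x = proj Z2 y \<longleftrightarrow> x - y \<in> Z2"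
proof
  assume eq: "proj Z2 x = proj Z2 y"
  have "0 \<in> Z2" by (simp add: Z2_def)
  then have "x \<in> proj Z2 x" by (force simp: proj_def)
  then obtain l where "l \<in> Z2" "x = y + l" using eq by (auto simp: proj_def)
  then show "x - y \<in> Z2" by simp
next
  assume d: "x - y \<in> Z2"
  have *: "proj Z2 a \<subseteq> proj Z2 b" if "a - b \<in> Z2" for a b :: "real^2"
  proof
    fix z assume "z \<in> proj Z2 a"
    then obtain l where l: "l \<in> Z2" "z = a + l" by (auto simp: proj_def)
    then have "(a - b) + l \<in> Z2" using that by (simp add: Z2_def)
    moreover have "z = b + ((a - b) + l)" using l by simp
    ultimately show "z \<in> proj Z2 b" unfolding proj_def by blast
  qed
  have "- (x - y) \<in> Z2" using d by (simp only: Z2_def mem_Collect_eq vector_uminus_component Ints_minus) simp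
  then have "y - x \<in> Z2" by simp
  then show "proj Z2 x = proj Z2 y" using * d by blast
qed

lemma has_velocity_unique:
  assumes "has_velocity \<gamma> t v" "has_velocity \<gamma> t w"
  shows "v = w"
proof -
  obtain c d where c: "(c has_vector_derivative v) (at t)" "\<forall>\<^sub>F s in nhds t. \<gamma> s = proj Z2 (c s)"
    and d: "(d has_vector_derivative w) (at t)" "\<forall>\<^sub>F s in nhds t. \<gamma> s = proj Z2 (d s)"
    using assms unfolding has_velocity_def by blast
  define e where "e = (\<lambda>s. c s - d s)"
  have e': "(e has_vector_derivative (v - w)) (at t)"
    unfolding e_def by (intro derivative_intros c d)
  have "isCont e t"
    using e' has_vector_derivative_continuous by blast
  then have "e \<midarrow>t\<rightarrow> e t" by (simp add: isCont_def)
  then have "\<forall>\<^sub>F s in at t. dist (e s) (e t) < 1"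
    by (simp add: tendsto_iff)
  then have near: "\<forall>\<^sub>F s in nhds t. dist (e s) (e t) < 1"
    by (simp add: eventually_nhds_conv_at)
  have int: "\<forall>\<^sub>F s in nhds t. e s \<in> Z2"
    using c(2) d(2) by eventually_elim (simp add: e_def flip: proj_Z2_eq_iff)
  then have "e t \<in> Z2" by (rule eventually_nhds_x_imp_x)
  have const: "\<forall>\<^sub>F s in nhds t. e s = e t"
    using near int
  proof eventually_elim
    case (elim s)
    show ?case
    proof (simp add: vec_eq_iff, intro allI)
      fix i
      have "e s $ i - e t $ i \<in> \<int>"
        using elim \<open>e t \<in> Z2\<close> by (simp add: Z2_def)
      moreover have "\<bar>e s $ i - e t $ i\<bar> < 1"
        using elim component_le_norm_cart[of "e s - e t" i] by (simp add: dist_norm)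
      ultimately show "e s $ i = e t $ i"
        using Ints_nonzero_abs_less1 by fastforce
    qed
  qed
  then obtain S where S: "open S" "t \<in> S" "\<And>s. s \<in> S \<Longrightarrow> e s = e t"
    unfolding eventually_nhds by blast
  have "((\<lambda>_. e t) has_vector_derivative 0) (at t)" by (rule has_vector_derivative_const)
  then have "(e has_vector_derivative 0) (at t)"
    by (rule has_vector_derivative_transform_within_open[OF _ S(1,2)]) (simp add: S(3))
  then have "v - w = 0" using e' vector_derivative_unique_at by blast
  then show ?thesis by simp
qed

lemma velocity_eq: "has_velocity \<gamma> t v \<Longrightarrow> velocity \<gamma> t = v"
  unfolding velocity_def using has_velocity_unique by blast

definition curve_length :: "metric_fun \<Rightarrow> real \<Rightarrow> real \<Rightarrow> (real \<Rightarrow> (real^2) set) \<Rightarrow> real" where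
  "curve_length F a b \<gamma> = integral {a..b} (\<lambda>t. F (\<gamma> t) (velocity \<gamma> t))"

text \<open>The singular homology class of a loop parametrized by \<open>{0..1}\<close>. A point \<open>x\<close> of the standard
  1-simplex is the point with barycentric coordinates \<open>x 0\<close> and \<open>x 1 = 1 - x 0\<close>.\<close>

definition loop_class :: "(real \<Rightarrow> (real^2) set) \<Rightarrow> (real^2) set chain set" where
  "loop_class \<gamma> =
     homologous_rel_set 1 (quotient_top Z2) {} (frag_of (\<lambda>x\<in>standard_simplex 1. \<gamma> (x 1)))"

definition generate_H1 :: "(real \<Rightarrow> (real^2) set) \<Rightarrow> (real \<Rightarrow> (real^2) set) \<Rightarrow> bool" where
  "generate_H1 \<gamma>\<^sub>1 \<gamma>\<^sub>2 \<longleftrightarrow>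
     generate (homology_group 1 (quotient_top Z2)) {loop_class \<gamma>\<^sub>1, loop_class \<gamma>\<^sub>2} =
       carrier (homology_group 1 (quotient_top Z2))"


section \<open>Parallelogram norms\<close>

definition is_norm :: "(real^2 \<Rightarrow> real) \<Rightarrow> bool" where
  "is_norm N \<longleftrightarrow>
     (\<forall>x. N x \<ge> 0) \<and> (\<forall>x. N x = 0 \<longleftrightarrow> x = 0) \<and>
     (\<forall>t x. N (t *\<^sub>R x) = \<bar>t\<bar> * N x) \<and> (\<forall>x y. N (x + y) \<le> N x + N y)"

definition is_basis :: "real^2 \<Rightarrow> real^2 \<Rightarrow> bool" where
  "is_basis p q \<longleftrightarrow> p \<noteq> q \<and> independent {p, q}"

definition parallelogram :: "real^2 \<Rightarrow> real^2 \<Rightarrow> real^2 \<Rightarrow> (real^2) set" where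
  "parallelogram z p q = {z + s *\<^sub>R p + t *\<^sub>R q | s t. 0 \<le> s \<and> s \<le> 1 \<and> 0 \<le> t \<and> t \<le> 1}"

end

theory Submission
  imports Defs
begin

text \<open>
  A 1-form of comass at most 1 takes its values in the dual balls. Three such closed forms
  \<open>\<alpha>\<close>, \<open>\<beta>\<close>, \<open>\<delta>\<close> and their opposites span a hexagon in the dual ball at each point, whose area is
  \<open>\<bar>\<alpha> \<and> \<beta>\<bar> + \<bar>\<beta> \<and> \<delta>\<bar> + \<bar>\<alpha> \<and> \<delta>\<bar>\<close>; integrating, \<open>\<pi> vol\<close> is at least the same expression in the periods of the
  forms. Calibrating forms of this kind with norming periods exist for the stable norm \<open>N\<close> on the lattice. Choose
  a basis \<open>b\<^sub>1\<close>, \<open>b\<^sub>2\<close> with \<open>N b\<^sub>1 \<le> N b\<^sub>2 \<le> N (b\<^sub>2 \<plusminus> b\<^sub>1)\<close> and forms norming \<open>b\<^sub>1\<close>, \<open>b\<^sub>2\<close> and one of \<open>b\<^sub>2 \<plusminus> b\<^sub>1\<close>: their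
  periods span a hexagon of area at least \<open>2 N b\<^sub>1 N b\<^sub>2\<close>. On a two-torus the stable norm of a class is the infimum
  of the lengths of loops in that class, because a path from \<open>x\<close> to \<open>x + 2h\<close> contains a chord \<open>h\<close> and can be cut
  there. The infimum need not be realized by an explicit curve: quadratic convexity prevents the dual balls from
  being hexagons, so the inequality is strict for the stable norm, and almost minimizing polygonal loops suffice.

  In the equality case the dual ball at each point is a parallelogram whose area is a constant times the
  Jacobian of a lift of the homothety, and the Jacobian integrates to the determinant of its periods.
\<close>

section \<open>The degree formula on the unit square\<close>

text \<open>Two losses have to be absorbed. A function that is 1-Lipschitz for the lifted distance
  and has the required periods is in general not differentiable, and averaging it over small squares
  costs a factor \<open>1 + e\<close> in comass; moreover the loops only have lengths close to the
  stable norm. Both are paid from a gap \<open>c > 0\<close>, uniform over the torus by compactness,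
  between the area of a dual ball and that of any hexagon in it: \<open>c\<close> does not depend on
  \<open>e\<close>, so the volume bound stays strict as \<open>e\<close> tends to 0. Two forms do
  not suffice. If \<open>a1\<close> norms \<open>b1\<close> and \<open>a2\<close> norms
  \<open>b2\<close>, their wedge is, up to sign, \<open>N b1 * N b2 - s * t\<close> with
  \<open>s\<close>, \<open>t\<close> the values on the other basis vector, which is too small when
  \<open>s * t > 0\<close>; the form norming \<open>b2 - b1\<close> makes up for it. In the equality
  case the constant comes from two facts: the sides of the unit ball have norm 2, and the polar of
  the centred parallelogram with sides \<open>p\<close>, \<open>q\<close> has area
  \<open>8 / |cr p q|\<close>.\<close>

lemma mixed_partial_swap:
  fixes g g1 g2 m :: "real \<Rightarrow> real \<Rightarrow> real"
  assumes g1: "\<And>a b. ((\<lambda>a. g a b) has_real_derivative g1 a b) (at a)"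
    and g2: "\<And>a b. ((\<lambda>b. g a b) has_real_derivative g2 a b) (at b)"
    and m: "\<And>a b. ((\<lambda>a. g2 a b) has_real_derivative m a b) (at a)"
    and cg2: "continuous_on UNIV (\<lambda>(a, b). g2 a b)"
    and cm: "continuous_on UNIV (\<lambda>(a, b). m a b)"
  shows "((\<lambda>b. g1 a b) has_real_derivative m a b) (at b)"
proof -
  have cg2': "continuous_on S (\<lambda>t. g2 a t)" for a S
    using continuous_on_compose2[OF cg2, of S "\<lambda>t. (a, t)"] by (simp add: continuous_on_Pair)
  have cm': "continuous_on S (\<lambda>t. m a t)" for a S
    using continuous_on_compose2[OF cm, of S "\<lambda>t. (a, t)"] by (simp add: continuous_on_Pair)
  define c where "c = b - 1"
  \<comment> \<open>Symmetry of second derivatives with one mixed partial given: \<open>g\<close> is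
    an integral of \<open>g2\<close> in the second variable, so differentiating under the integral
    and then with respect to the upper limit produces \<open>m\<close>. Starting at
    \<open>b - 1\<close> puts \<open>b\<close> in the interior.\<close>
  have FTC: "integral {c..y} (\<lambda>t. g2 a t) = g a y - g a c" if "c \<le> y" for a y
    by (rule integral_unique[OF fundamental_theorem_of_calculus[OF that]])
      (metis has_field_derivative_at_within has_real_derivative_iff_has_vector_derivative g2)
  have *: "g1 a y = g1 a c + integral {c..y} (\<lambda>t. m a t)" if "c \<le> y" for y
  proof -
    have "((\<lambda>a. integral (cbox c y) (g2 a)) has_real_derivative integral (cbox c y) (m a)) (at a within UNIV)"
      by (rule leibniz_rule_field_derivative)
        (auto intro: m integrable_continuous_real cg2' continuous_on_subset[OF cm])
    moreover have "((\<lambda>a. g a y - g a c) has_real_derivative g1 a y - g1 a c) (at a)"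
      by (intro derivative_intros g1)
    ultimately have "integral {c..y} (m a) = g1 a y - g1 a c"
      by (simp add: FTC[OF that]) (rule DERIV_unique)
    then show ?thesis by simp
  qed
  have "((\<lambda>y. integral {c..y} (m a)) has_real_derivative m a b) (at b within {c..c+2})"
    by (rule integral_has_real_derivative[OF cm']) (auto simp: c_def)
  then have "((\<lambda>y. integral {c..y} (m a)) has_real_derivative m a b) (at b)"
    by (subst (asm) at_within_interior) (auto simp: c_def)
  then have "((\<lambda>y. g1 a c + integral {c..y} (m a)) has_real_derivative m a b) (at b)"
    by (auto intro!: derivative_eq_intros)
  then show ?thesis
    by (rule has_field_derivative_transform_within_open[of _ _ _ "{c<..}"]) (use *[symmetric] in \<open>auto simp: c_def less_imp_le\<close>)
qed

text \<open>Stokes' formula: the integrand is the \<open>a\<close>-derivative of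
  \<open>f * g2\<close> minus the \<open>b\<close>-derivative of \<open>f * g1\<close>, the terms
  with the mixed derivative cancelling. The partials of \<open>g\<close> are periodic, so only the
  jumps of \<open>f\<close> across opposite sides survive.\<close>

lemma degree_square:
  fixes f g f1 f2 g1 g2 m :: "real \<Rightarrow> real \<Rightarrow> real"
  assumes f1: "\<And>a b. ((\<lambda>a. f a b) has_real_derivative f1 a b) (at a)"
    and f2: "\<And>a b. ((\<lambda>b. f a b) has_real_derivative f2 a b) (at b)"
    and g1: "\<And>a b. ((\<lambda>a. g a b) has_real_derivative g1 a b) (at a)"
    and g2: "\<And>a b. ((\<lambda>b. g a b) has_real_derivative g2 a b) (at b)"
    and m: "\<And>a b. ((\<lambda>a. g2 a b) has_real_derivative m a b) (at a)"
    and cf: "continuous_on UNIV (\<lambda>(a, b). f a b)"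
    and cf1: "continuous_on UNIV (\<lambda>(a, b). f1 a b)"
    and cf2: "continuous_on UNIV (\<lambda>(a, b). f2 a b)"
    and cg1: "continuous_on UNIV (\<lambda>(a, b). g1 a b)"
    and cg2: "continuous_on UNIV (\<lambda>(a, b). g2 a b)"
    and cm: "continuous_on UNIV (\<lambda>(a, b). m a b)"
    and p1: "\<And>a b. f (a + 1) b = f a b + p1" and p2: "\<And>a b. f a (b + 1) = f a b + p2"
    and q1: "\<And>a b. g (a + 1) b = g a b + q1" and q2: "\<And>a b. g a (b + 1) = g a b + q2"
  shows "integral {0..1} (\<lambda>a. integral {0..1} (\<lambda>b. f1 a b * g2 a b - f2 a b * g1 a b)) = p1 * q2 - p2 * q1"
proof -
  note m' = mixed_partial_swap[OF g1 g2 m cg2 cm]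
  have cA: "continuous_on UNIV (\<lambda>(a, b). f1 a b * g2 a b + f a b * m a b)"
    using cf cf1 cg2 cm unfolding split_beta by (intro continuous_intros)
  have cB: "continuous_on UNIV (\<lambda>(a, b). f2 a b * g1 a b + f a b * m a b)"
    using cf cf2 cg1 cm unfolding split_beta by (intro continuous_intros)
  have sl: "continuous_on S (\<lambda>t. h a t)" "continuous_on S (\<lambda>t. h t a)"
    if "continuous_on UNIV (\<lambda>(a, b). h a b)" for h :: "real \<Rightarrow> real \<Rightarrow> real" and a S
    using continuous_on_compose2[OF that, of S "\<lambda>t. (a, t)"] continuous_on_compose2[OF that, of S "\<lambda>t. (t, a)"]
    by (simp_all add: continuous_on_Pair)
  have dq: "((\<lambda>t. h (t + 1)) has_real_derivative h' (t + 1)) (at t)"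
    if "\<And>t. (h has_real_derivative h' t) (at t)" for h h' :: "real \<Rightarrow> real" and t
    using DERIV_shift that by blast
  have g2p: "g2 (a + 1) b = g2 a b" for a b
  proof -
    have "((\<lambda>b. g (a + 1) b) has_real_derivative g2 a b) (at b)"
      unfolding q1 by (auto intro!: derivative_eq_intros g2)
    then show ?thesis using g2 DERIV_unique by blast
  qed
  have g1p: "g1 a (b + 1) = g1 a b" for a b
  proof -
    have "((\<lambda>a. g a (b + 1)) has_real_derivative g1 a b) (at a)"
      unfolding q2 by (auto intro!: derivative_eq_intros g1)
    then show ?thesis using g1 DERIV_unique by blast
  qed
  have iA: "integral {0..1} (\<lambda>a. f1 a b * g2 a b + f a b * m a b) = p1 * g2 0 b" for b
  proof -
    have "((\<lambda>a. f1 a b * g2 a b + f a b * m a b) has_integral f 1 b * g2 1 b - f 0 b * g2 0 b) {0..1}"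
      by (rule fundamental_theorem_of_calculus)
        (auto simp flip: has_real_derivative_iff_has_vector_derivative intro!: derivative_eq_intros
          has_field_derivative_at_within[OF f1] has_field_derivative_at_within[OF m])
    then show ?thesis
      using g2p[of 0 b] p1[of 0 b] by (simp add: integral_unique algebra_simps)
  qed
  have iB: "integral {0..1} (\<lambda>b. f2 a b * g1 a b + f a b * m a b) = p2 * g1 a 0" for a
  proof -
    have "((\<lambda>b. f2 a b * g1 a b + f a b * m a b) has_integral f a 1 * g1 a 1 - f a 0 * g1 a 0) {0..1}"
      by (rule fundamental_theorem_of_calculus)
        (auto simp flip: has_real_derivative_iff_has_vector_derivative intro!: derivative_eq_intros
          has_field_derivative_at_within[OF f2] has_field_derivative_at_within[OF m'])
    then show ?thesis
      using g1p[of a 0] p2[of a 0] by (simp add: integral_unique algebra_simps)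
  qed
  have i2: "integral {0..1} (\<lambda>b. g2 0 b) = q2"
    using integral_unique[OF fundamental_theorem_of_calculus[of 0 1 "g 0" "g2 0"]] q2[of 0 0]
    by (simp add: has_field_derivative_at_within[OF g2] flip: has_real_derivative_iff_has_vector_derivative)
  have i1: "integral {0..1} (\<lambda>a. g1 a 0) = q1"
    using integral_unique[OF fundamental_theorem_of_calculus[of 0 1 "\<lambda>a. g a 0" "\<lambda>a. g1 a 0"]] q1[of 0 0]
    by (simp add: has_field_derivative_at_within[OF g1] flip: has_real_derivative_iff_has_vector_derivative)
  have "integral {0..1} (\<lambda>a. integral {0..1} (\<lambda>b. f1 a b * g2 a b - f2 a b * g1 a b)) =
      integral {0..1} (\<lambda>a. integral {0..1} (\<lambda>b. f1 a b * g2 a b + f a b * m a b)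
         - integral {0..1} (\<lambda>b. f2 a b * g1 a b + f a b * m a b))"
    by (intro integral_cong, subst integral_diff[symmetric])
      (auto intro!: integrable_continuous_real sl[OF cA] sl[OF cB] integral_cong)
  also have "\<dots> = integral {0..1} (\<lambda>a. integral {0..1} (\<lambda>b. f1 a b * g2 a b + f a b * m a b))
         - integral {0..1} (\<lambda>a. integral {0..1} (\<lambda>b. f2 a b * g1 a b + f a b * m a b))"
    using integral_integrable_2dim[of 0 0 1 1, OF continuous_on_subset[OF cA]]
      integral_integrable_2dim[of 0 0 1 1, OF continuous_on_subset[OF cB]]
    by (intro integral_diff) auto
  also have "integral {0..1} (\<lambda>a. integral {0..1} (\<lambda>b. f1 a b * g2 a b + f a b * m a b)) =
      integral {0..1} (\<lambda>b. integral {0..1} (\<lambda>a. f1 a b * g2 a b + f a b * m a b))"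
    using integral_swap_continuous[of 0 0 1 1, OF continuous_on_subset[OF cA]] by simp
  also have "\<dots> = p1 * q2" by (simp add: iA i2)
  finally show ?thesis by (simp add: iB i1)
qed

section \<open>Integration over the unit square of \<open>real^2\<close>\<close>

lemma vector2_eq: "vector [a, b] = a *\<^sub>R axis 1 1 + b *\<^sub>R (axis 2 1 :: real^2)"
  by (simp add: vec_eq_iff forall_2 axis_def)

lemma continuous_on_vector2 [continuous_intros]:
  fixes f g :: "'a::topological_space \<Rightarrow> real"
  assumes "continuous_on S f" "continuous_on S g"
  shows "continuous_on S (\<lambda>x. vector [f x, g x] :: real^2)"
  unfolding vector2_eq using assms by (intro continuous_intros)

lemma cbox_eq_image_prod:
  fixes u v :: "real^2"
  shows "cbox u v = (\<lambda>(a, b). vector [a, b]) ` cbox (u $ 1, u $ 2) (v $ 1, v $ 2)" (is "_ = ?R")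
proof
  show "cbox u v \<subseteq> ?R"
  proof
    fix x assume "x \<in> cbox u v"
    moreover have "x = vector [x $ 1, x $ 2]" by (simp add: vec_eq_iff forall_2)
    ultimately show "x \<in> ?R"
      by (intro image_eqI[of _ _ "(x $ 1, x $ 2)"]) (auto simp: mem_box_cart cbox_Pair_eq)
  qed
qed (auto simp: mem_box_cart forall_2 cbox_Pair_eq)

lemma content_cbox_2:
  fixes u v :: "real^2"
  shows "measure lborel (cbox u v) = measure lborel (cbox (u $ 1, u $ 2) (v $ 1, v $ 2))"
proof (cases "cbox u v = {}")
  case True
  then show ?thesis by (simp add: cbox_eq_image_prod)
next
  case False
  then have "u $ 1 \<le> v $ 1" "u $ 2 \<le> v $ 2"
    by (auto simp: cbox_eq_image_prod[of u v] cbox_Pair_eq)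
  then show ?thesis
    using False by (simp add: content_cbox_cart prod_2 UNIV_2 content_Pair)
qed

text \<open>The coordinate bijection between \<open>real^2\<close> and pairs carries boxes to boxes
  of equal content, so the integral is transported with factor 1; Fubini does the rest.\<close>

lemma integral_unit_square:
  fixes \<phi> :: "real^2 \<Rightarrow> real"
  assumes c: "continuous_on UNIV \<phi>"
  shows "integral (cbox 0 1) \<phi> = integral {0..1} (\<lambda>a. integral {0..1} (\<lambda>b. \<phi> (vector [a, b])))"
proof -
  define h :: "real \<times> real \<Rightarrow> real^2" where "h = (\<lambda>(a, b). vector [a, b])"
  define g :: "real^2 \<Rightarrow> real \<times> real" where "g = (\<lambda>x. (x $ 1, x $ 2))"
  have hg: "h (g x) = x" for x by (simp add: h_def g_def vec_eq_iff forall_2)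
  have gh: "g (h x) = x" for x by (cases x) (simp add: h_def g_def)
  have ch: "continuous_on S h" for S
    unfolding h_def split_beta by (intro continuous_intros)
  have cont: "continuous_on S (\<lambda>z. \<phi> (h z))" for S
    by (rule continuous_on_compose2[OF c ch]) auto
  have him: "h ` cbox u v = cbox (h u) (h v)" for u v
    by (subst cbox_eq_image_prod[of "h u" "h v"], cases u, cases v) (simp add: h_def)
  have gim: "g ` cbox u v = cbox (g u) (g v)" for u v
  proof -
    have "g ` cbox u v = g ` h ` cbox (g u) (g v)" by (simp add: him hg)
    then show ?thesis by (simp add: image_image gh)
  qed
  have "((\<lambda>x. (\<lambda>z. \<phi> (h z)) (g x)) has_integral
      (1 / 1) *\<^sub>R integral (cbox (0, 0) (1, 1)) (\<lambda>z. \<phi> (h z))) (h ` cbox (0, 0) (1, 1))"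
  proof (rule has_integral_twiddle[OF zero_less_one hg gh])
    show "continuous (at x) g" for x
      unfolding g_def by (intro continuous_intros)
    show "measure lborel (g ` cbox u v) = 1 * measure lborel (cbox u v)" for u v
      unfolding gim content_cbox_2 by (simp add: g_def)
    show "((\<lambda>z. \<phi> (h z)) has_integral integral (cbox (0, 0) (1, 1)) (\<lambda>z. \<phi> (h z))) (cbox (0, 0) (1, 1))"
      by (intro integrable_integral integrable_continuous cont)
    show "\<exists>w z. g ` cbox u v = cbox w z" for u v
      unfolding gim by blast
    show "\<exists>w z. h ` cbox u v = cbox w z" for u v
      unfolding him by blast
  qed
  moreover have "h ` cbox (0, 0) (1, 1) = cbox 0 1"
    unfolding him by (rule arg_cong2[where f = cbox]) (simp_all add: h_def vec_eq_iff forall_2)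
  ultimately have "integral (cbox 0 1) \<phi> = integral (cbox (0, 0) (1, 1)) (\<lambda>z. \<phi> (h z))"
    by (simp add: hg integral_unique)
  then show ?thesis
    using integral_prod_continuous[OF cont] by (simp add: h_def)
qed

text \<open>The determinant of two plane vectors; for covectors it is the wedge product in the
  standard frame. Areas and degrees below are expressed by it.\<close>

definition cr :: "real^2 \<Rightarrow> real^2 \<Rightarrow> real" where
  "cr x y = x $ 1 * y $ 2 - x $ 2 * y $ 1"

text \<open>For closed 1-forms \<open>f'\<close> and \<open>g'\<close> with period vectors
  \<open>p\<close> and \<open>q\<close>, the integral of the wedge depends on the periods alone. The
  second-order regularity asked for is what box averages provide.\<close>

lemma degree_unit_square:
  fixes f g m :: "real^2 \<Rightarrow> real" and f' g' :: "real^2 \<Rightarrow> real^2"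
  assumes df: "\<And>x. (f has_derivative (\<lambda>v. f' x \<bullet> v)) (at x)"
    and dg: "\<And>x. (g has_derivative (\<lambda>v. g' x \<bullet> v)) (at x)"
    and cf: "continuous_on UNIV f'" and cg: "continuous_on UNIV g'" and cm: "continuous_on UNIV m"
    and m: "\<And>a b. ((\<lambda>s. g' (vector [s, b]) $ 2) has_real_derivative m (vector [a, b])) (at a)"
    and pf: "\<And>x i. f (x + axis i 1) = f x + p $ i"
    and pg: "\<And>x i. g (x + axis i 1) = g x + q $ i"
  shows "integral (cbox 0 1) (\<lambda>x. cr (f' x) (g' x)) = cr p q"
proof -
  have c2: "continuous_on UNIV (\<lambda>(a, b). h (vector [a, b]))"
    if "continuous_on UNIV h" for h :: "real^2 \<Rightarrow> real"
    unfolding split_beta by (rule continuous_on_compose2[OF that]) (auto intro!: continuous_intros)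
  have d1: "((\<lambda>a. h (vector [a, b])) has_real_derivative h' (vector [a, b]) $ 1) (at a)"
    and d2: "((\<lambda>b. h (vector [a, b])) has_real_derivative h' (vector [a, b]) $ 2) (at b)"
    if "\<And>x. (h has_derivative (\<lambda>v. h' x \<bullet> v)) (at x)" for h :: "real^2 \<Rightarrow> real" and h' :: "real^2 \<Rightarrow> real^2" and a b
  proof -
    have "((\<lambda>a. vector [a, b] :: real^2) has_derivative (\<lambda>t. t *\<^sub>R axis 1 1)) (at a)"
      unfolding vector2_eq by (auto intro!: derivative_eq_intros)
    from has_derivative_compose[OF this that]
    show "((\<lambda>a. h (vector [a, b])) has_real_derivative h' (vector [a, b]) $ 1) (at a)"
      by (simp add: has_field_derivative_def inner_axis mult_commute_abs)
    have "((\<lambda>b. vector [a, b] :: real^2) has_derivative (\<lambda>t. t *\<^sub>R axis 2 1)) (at b)"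
      unfolding vector2_eq by (auto intro!: derivative_eq_intros)
    from has_derivative_compose[OF this that]
    show "((\<lambda>b. h (vector [a, b])) has_real_derivative h' (vector [a, b]) $ 2) (at b)"
      by (simp add: has_field_derivative_def inner_axis mult_commute_abs)
  qed
  have cont: "continuous_on UNIV f" "continuous_on UNIV g"
    using df dg by (meson continuous_at_imp_continuous_on has_derivative_continuous)+
  have shift: "vector [a + 1, b] = vector [a, b] + (axis 1 1 :: real^2)"
    "vector [a, b + 1] = vector [a, b] + (axis 2 1 :: real^2)" for a b
    by (simp_all add: vector2_eq algebra_simps)
  have "integral (cbox 0 1) (\<lambda>x. cr (f' x) (g' x)) =
     integral {0..1} (\<lambda>a. integral {0..1} (\<lambda>b. cr (f' (vector [a, b])) (g' (vector [a, b]))))"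
    unfolding cr_def using cf cg by (intro integral_unit_square continuous_intros)
  also have "\<dots> = cr p q"
    unfolding cr_def
  proof (rule degree_square[where f = "\<lambda>a b. f (vector [a, b])" and g = "\<lambda>a b. g (vector [a, b])"
        and m = "\<lambda>a b. m (vector [a, b])"])
    have comp: "continuous_on UNIV (\<lambda>x. f' x $ i)" "continuous_on UNIV (\<lambda>x. g' x $ i)" for i
      by (intro continuous_intros cf cg)+
    show "continuous_on UNIV (\<lambda>(a, b). f (vector [a, b]))" "continuous_on UNIV (\<lambda>(a, b). m (vector [a, b]))"
      by (rule c2[OF cont(1)], rule c2[OF cm])
    show "continuous_on UNIV (\<lambda>(a, b). f' (vector [a, b]) $ 1)" "continuous_on UNIV (\<lambda>(a, b). f' (vector [a, b]) $ 2)"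
      "continuous_on UNIV (\<lambda>(a, b). g' (vector [a, b]) $ 1)" "continuous_on UNIV (\<lambda>(a, b). g' (vector [a, b]) $ 2)"
      by (rule c2[OF comp(1)], rule c2[OF comp(1)], rule c2[OF comp(2)], rule c2[OF comp(2)])
  qed (simp_all add: shift pf pg d1[OF df] d2[OF df] d1[OF dg] d2[OF dg] m)
  finally show ?thesis .
qed

section \<open>The first homology group of the torus\<close>

lemma Z2_add: "h \<in> Z2 \<Longrightarrow> k \<in> Z2 \<Longrightarrow> h + k \<in> Z2"
  and Z2_diff: "h \<in> Z2 \<Longrightarrow> k \<in> Z2 \<Longrightarrow> h - k \<in> Z2"
  and Z2_0: "0 \<in> Z2"
  by (auto simp: Z2_def)

lemma Z2_uminus: "h \<in> Z2 \<Longrightarrow> - h \<in> Z2"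
  using Z2_diff[OF Z2_0] by fastforce

lemma Z2_scale: "h \<in> Z2 \<Longrightarrow> n \<in> \<int> \<Longrightarrow> n *\<^sub>R h \<in> Z2"
  by (auto simp: Z2_def)

lemma Z2_axis: "axis i 1 \<in> Z2"
  by (auto simp: Z2_def axis_def)

lemma proj_Z2_add: "h \<in> Z2 \<Longrightarrow> proj Z2 (x + h) = proj Z2 x"
  by (simp add: proj_Z2_eq_iff)

section \<open>Lifting maps into the torus to the plane\<close>

definition rep :: "(real^2) set \<Rightarrow> real^2" where
  "rep p = (SOME x. proj Z2 x = p)"

lemma proj_rep: "p \<in> plane_mod Z2 \<Longrightarrow> proj Z2 (rep p) = p"
  unfolding rep_def plane_mod_def by (metis (mono_tags, lifting) imageE someI)

lemma continuous_map_proj: "continuous_map euclidean (quotient_top Z2) (proj Z2)"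
  by (simp add: quotient_imp_continuous_map quotient_map_proj)


text \<open>The torus as a product of two circles. Continuity of maps into the torus becomes
  continuity of two unit complex functions, which have continuous logarithms on contractible
  sets.\<close>

definition circle_coord :: "2 \<Rightarrow> (real^2) set \<Rightarrow> complex" where
  "circle_coord j p = exp (of_real (2 * pi * (rep p $ j)) * \<i>)"

lemma exp_2pi_eq_iff:
  "exp (of_real (2 * pi * a) * \<i>) = exp (of_real (2 * pi * b) * \<i>) \<longleftrightarrow> a - b \<in> \<int>" for a b :: real
proof -
  have "exp (of_real (2 * pi * a) * \<i>) = exp (of_real (2 * pi * b) * \<i>) \<longleftrightarrow>
      (\<exists>n::int. of_real (2 * pi * a) * \<i> = of_real (2 * pi * b) * \<i> + (of_int (2 * n) * pi) * \<i>)"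
    by (rule exp_eq)
  also have "\<dots> \<longleftrightarrow> (\<exists>n::int. a - b = of_int n)"
  proof (intro ex_cong1)
    fix n :: int
    have "2 * pi * a = 2 * pi * b + 2 * of_int n * pi \<longleftrightarrow> 2 * pi * (a - b - of_int n) = 0"
      by (simp add: algebra_simps)
    then show "of_real (2 * pi * a) * \<i> = of_real (2 * pi * b) * \<i> + (of_int (2 * n) * pi) * \<i> \<longleftrightarrow> a - b = of_int n"
      by (auto simp: complex_eq_iff)
  qed
  also have "\<dots> \<longleftrightarrow> a - b \<in> \<int>" by (auto simp: Ints_def)
  finally show ?thesis .
qed

lemma circle_coord_proj: "circle_coord j (proj Z2 y) = exp (of_real (2 * pi * (y $ j)) * \<i>)"
proof -
  have "rep (proj Z2 y) - y \<in> Z2" by (simp add: proj_rep plane_mod_def flip: proj_Z2_eq_iff)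
  then show ?thesis
    unfolding circle_coord_def exp_2pi_eq_iff by (simp add: Z2_def)
qed

lemma continuous_map_circle_coord: "continuous_map (quotient_top Z2) euclidean (circle_coord j)"
proof (rule continuous_compose_quotient_map[OF quotient_map_proj])
  show "continuous_map euclidean euclidean (circle_coord j \<circ> proj Z2)"
    by (auto simp: comp_def circle_coord_proj intro!: continuous_intros)
qed

text \<open>The imaginary parts of logarithms of the two circle coordinates, divided by
  \<open>2 * pi\<close>, form a lift: modulus 1 makes the logarithms purely imaginary, and equal
  exponentials mean coordinates that agree modulo integers.\<close>

lemma lift_exists:
  fixes f :: "'a::real_normed_vector \<Rightarrow> (real^2) set"
  assumes S: "contractible S" and f: "f ` S \<subseteq> plane_mod Z2"
    and c: "\<And>j. continuous_on S (\<lambda>x. circle_coord j (f x))"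
  obtains g where "continuous_on S g" "\<And>x. x \<in> S \<Longrightarrow> proj Z2 (g x) = f x"
proof -
  have "\<exists>L. continuous_on S L \<and> (\<forall>x\<in>S. circle_coord j (f x) = exp (L x))" for j
    by (rule continuous_logarithm_on_contractible[OF c S]) (auto simp: circle_coord_def)
  then obtain L where L: "\<And>j. continuous_on S (L j)" "\<And>j x. x \<in> S \<Longrightarrow> circle_coord j (f x) = exp (L j x)"
    by metis
  define g :: "'a \<Rightarrow> real^2" where "g = (\<lambda>x. \<chi> j. Im (L j x) / (2 * pi))"
  show ?thesis
  proof
    show "continuous_on S g"
      unfolding g_def by (intro continuous_intros L) auto
  next
    fix x assume x: "x \<in> S"
    have "g x $ j - rep (f x) $ j \<in> \<int>" for j
    proof -
      have "norm (exp (L j x)) = 1"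
        by (simp add: L(2)[OF x, symmetric] circle_coord_def)
      then have "Re (L j x) = 0" by simp
      then have "L j x = of_real (2 * pi * (g x $ j)) * \<i>"
        by (simp add: complex_eq_iff g_def)
      then show ?thesis
        using L(2)[OF x, of j] by (simp add: circle_coord_def flip: exp_2pi_eq_iff)
    qed
    then have "g x - rep (f x) \<in> Z2" by (simp add: Z2_def)
    then have "proj Z2 (g x) = proj Z2 (rep (f x))"
      by (simp only: proj_Z2_eq_iff)
    then show "proj Z2 (g x) = f x" using f x by (simp add: proj_rep image_subset_iff)
  qed
qed


declare One_nat_def [simp del]

section \<open>Homology relations between path chains\<close>

lemma homologous_rel_trans' [trans]:
  "homologous_rel p X S a b \<Longrightarrow> homologous_rel p X S b c \<Longrightarrow> homologous_rel p X S a c"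
  using homologous_rel_trans by blast

text \<open>The path runs from vertex 0 to vertex 1 of the simplex, as in \<open>loop_class\<close>,
  so that \<open>loop_class \<gamma>\<close> is the class of
  \<open>path_chain \<gamma>\<close>.\<close>

definition path_chain :: "(real \<Rightarrow> 'a) \<Rightarrow> 'a chain" where
  "path_chain \<gamma> = frag_of (\<lambda>x\<in>standard_simplex 1. \<gamma> (x 1))"

lemma standard_simplex_1: "x \<in> standard_simplex 1 \<longleftrightarrow>
    0 \<le> x 0 \<and> 0 \<le> x 1 \<and> x 0 = 1 - x 1 \<and> (\<forall>i>1. x i = 0)"
proof -
  have "{..1::nat} = {0, 1}" by auto
  moreover have "0 \<le> x i \<and> x i \<le> 1"
    if "0 \<le> x 0" "0 \<le> x 1" "x 0 = 1 - x 1" "\<forall>i>1. x i = 0" for i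
  proof -
    consider "i = 0" | "i = 1" | "i > 1" by linarith
    then show ?thesis using that by cases auto
  qed
  ultimately show ?thesis
    unfolding standard_simplex_def by (auto simp: algebra_simps)
qed

lemma path_chain_cong: "(\<And>t. 0 \<le> t \<Longrightarrow> t \<le> 1 \<Longrightarrow> \<gamma> t = \<delta> t) \<Longrightarrow> path_chain \<gamma> = path_chain \<delta>"
  unfolding path_chain_def by (intro arg_cong[where f = frag_of] restrict_ext) (auto simp: standard_simplex_1)

lemma continuous_map_coordinate:
  "continuous_map (subtopology (powertop_real UNIV) S) euclideanreal (\<lambda>x. x i)"
  by (intro continuous_map_from_subtopology continuous_map_product_projection) auto

lemma singular_simplex_path:
  assumes "continuous_map euclidean X \<gamma>"
  shows "singular_simplex 1 X (\<lambda>x\<in>standard_simplex 1. \<gamma> (x 1))"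
proof -
  have "continuous_map (subtopology (powertop_real UNIV) (standard_simplex 1)) X (\<gamma> \<circ> (\<lambda>x. x 1))"
    by (rule continuous_map_compose[OF continuous_map_coordinate assms])
  then show ?thesis
    by (auto simp: singular_simplex_def comp_def elim: continuous_map_eq)
qed

text \<open>The three paths are the faces of the singular 2-simplex taking \<open>x\<close> to
  \<open>k (x 1, x 2)\<close>: face 0 is the hypotenuse, face 1 the leg on the second axis, face 2
  the leg on the first. Defining \<open>k\<close> on the whole plane makes continuity a matter of
  composition.\<close>

lemma triangle_homologous:
  fixes k :: "real \<times> real \<Rightarrow> 'a"
  assumes k: "continuous_map euclidean X k"
  shows "homologous_rel 1 X {} (path_chain (\<lambda>t. k (1 - t, t)) + path_chain (\<lambda>t. k (t, 0)))
           (path_chain (\<lambda>t. k (0, t)))"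
proof -
  define \<kappa> where "\<kappa> = (\<lambda>x\<in>standard_simplex 2. k (x 1, x 2))"
  have "continuous_map (subtopology (powertop_real UNIV) (standard_simplex 2)) euclidean (\<lambda>x. (x 1, x 2))"
    using continuous_map_coordinate[of "standard_simplex 2"]
    by (simp add: continuous_map_pairwise comp_def flip: prod_topology_euclidean)
  from continuous_map_compose[OF this k]
  have sing: "singular_simplex 2 X \<kappa>"
    unfolding \<kappa>_def by (auto simp: singular_simplex_def comp_def elim: continuous_map_eq)
  have face: "frag_of (singular_face 2 i \<kappa>) = path_chain \<gamma>"
    if "i \<le> 2" "\<And>x. x \<in> standard_simplex 1 \<Longrightarrow> k (simplical_face i x 1, simplical_face i x 2) = \<gamma> (x 1)" for i \<gamma>
  proof -
    have "simplical_face i x \<in> standard_simplex 2" if "x \<in> standard_simplex 1" for x :: "nat \<Rightarrow> real"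
      by (rule simplical_face_in_standard_simplex) (use that \<open>i \<le> 2\<close> in \<open>auto simp: One_nat_def\<close>)
    moreover have "2 - Suc 0 = 1" by simp
    ultimately show ?thesis
      unfolding path_chain_def singular_face_def \<kappa>_def
      using that(2) by (intro arg_cong[where f = frag_of]) (auto simp: fun_eq_iff restrict_def)
  qed
  have sf: "simplical_face i x 1 = (if i = 0 then x 0 else if i = 1 then 0 else x 1)"
    "simplical_face i x 2 = (if i < 2 then x 1 else 0)" if "i \<le> 2" for i and x :: "nat \<Rightarrow> real"
    using that by (auto simp: simplical_face_def One_nat_def)
  have "chain_boundary 2 (frag_of \<kappa>) =
      path_chain (\<lambda>t. k (1 - t, t)) - path_chain (\<lambda>t. k (0, t)) + path_chain (\<lambda>t. k (t, 0))"
  proof -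
    have "chain_boundary 2 (frag_of \<kappa>) = frag_of (singular_face 2 0 \<kappa>) - frag_of (singular_face 2 1 \<kappa>)
        + frag_of (singular_face 2 2 \<kappa>)"
    proof -
      have "{..2::nat} = {0, 1, 2}" by auto
      then show ?thesis by (simp add: chain_boundary_of)
    qed
    also have "frag_of (singular_face 2 0 \<kappa>) = path_chain (\<lambda>t. k (1 - t, t))"
      by (rule face) (auto simp: sf standard_simplex_1)
    also have "frag_of (singular_face 2 1 \<kappa>) = path_chain (\<lambda>t. k (0, t))"
      by (rule face) (auto simp: sf standard_simplex_1)
    also have "frag_of (singular_face 2 2 \<kappa>) = path_chain (\<lambda>t. k (t, 0))"
      by (rule face) (auto simp: sf standard_simplex_1)
    finally show ?thesis .
  qed
  moreover have "singular_chain (Suc 1) X (frag_of \<kappa>)"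
    using sing by (simp add: singular_chain_of numeral_2_eq_2)
  ultimately show ?thesis
    unfolding homologous_rel_def singular_boundary
    by (intro exI[of _ "frag_of \<kappa>"]) (simp add: numeral_2_eq_2 algebra_simps)
qed

text \<open>The diagonal cuts the square into two triangles; the path \<open>H (t, t)\<close> is
  homologous to both sides.\<close>

lemma square_homologous:
  fixes H :: "real \<times> real \<Rightarrow> 'a"
  assumes H: "continuous_map euclidean X H"
  shows "homologous_rel 1 X {} (path_chain (\<lambda>t. H (1, t)) + path_chain (\<lambda>t. H (t, 0)))
           (path_chain (\<lambda>t. H (t, 1)) + path_chain (\<lambda>t. H (0, t)))"
proof -
  have c: "continuous_map euclidean euclidean (\<lambda>(x, y). (x + y, y) :: real \<times> real)"
    "continuous_map euclidean euclidean (\<lambda>(x, y). (y, x + y) :: real \<times> real)"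
    by (auto simp: split_beta intro!: continuous_intros)
  from triangle_homologous[OF continuous_map_compose[OF c(1) H]]
    triangle_homologous[OF continuous_map_compose[OF c(2) H]]
  have "homologous_rel 1 X {} (path_chain (\<lambda>t. H (1, t)) + path_chain (\<lambda>t. H (t, 0))) (path_chain (\<lambda>t. H (t, t)))"
    "homologous_rel 1 X {} (path_chain (\<lambda>t. H (t, 1)) + path_chain (\<lambda>t. H (0, t))) (path_chain (\<lambda>t. H (t, t)))"
    by (simp_all add: comp_def)
  then show ?thesis
    using homologous_rel_sym homologous_rel_trans by blast
qed

text \<open>A constant triangle has three equal faces, so twice the chain is homologous to the chain
  itself.\<close>

lemma path_chain_const:
  assumes "x \<in> topspace X"
  shows "homologous_rel 1 X {} (path_chain (\<lambda>_. x)) 0"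
proof -
  have "homologous_rel 1 X {} (path_chain (\<lambda>_. x) + path_chain (\<lambda>_. x)) (path_chain (\<lambda>_. x))"
    using triangle_homologous[of X "\<lambda>_. x"] assms by simp
  then show ?thesis by (simp add: homologous_rel_def)
qed

abbreviation tor_hom :: "(real^2) set chain \<Rightarrow> (real^2) set chain \<Rightarrow> bool" (infix "\<approx>\<^sub>1" 50) where
  "c \<approx>\<^sub>1 c' \<equiv> homologous_rel 1 (quotient_top Z2) {} c c'"

definition seg :: "real^2 \<Rightarrow> real^2 \<Rightarrow> (real^2) set chain" where
  "seg x y = path_chain (\<lambda>t. proj Z2 (x + t *\<^sub>R (y - x)))"

lemma continuous_map_proj_comp:
  fixes f :: "'a::topological_space \<Rightarrow> real^2"
  shows "continuous_on UNIV f \<Longrightarrow> continuous_map euclidean (quotient_top Z2) (\<lambda>x. proj Z2 (f x))"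
  using continuous_map_compose[OF _ continuous_map_proj, of euclidean f] by (simp add: comp_def)

lemma seg_add: "seg x y + seg y z \<approx>\<^sub>1 seg x z"
proof -
  have "continuous_on UNIV (\<lambda>(s, t). x + s *\<^sub>R (y - x) + t *\<^sub>R (z - x))"
    unfolding split_beta by (intro continuous_intros)
  from triangle_homologous[OF continuous_map_proj_comp[OF this]]
  have "path_chain (\<lambda>t. proj Z2 (x + (1 - t) *\<^sub>R (y - x) + t *\<^sub>R (z - x))) + seg x y \<approx>\<^sub>1 seg x z"
    by (simp add: seg_def)
  moreover have "x + (1 - t) *\<^sub>R (y - x) + t *\<^sub>R (z - x) = y + t *\<^sub>R (z - y)" for t
    by (simp add: algebra_simps)
  ultimately show ?thesis by (simp add: seg_def add.commute)
qed

lemma seg_refl: "seg x x \<approx>\<^sub>1 0"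
  unfolding seg_def using path_chain_const[of "proj Z2 x" "quotient_top Z2"]
  by (simp add: topspace_quotient_top plane_mod_def)

lemma seg_shift: "h \<in> Z2 \<Longrightarrow> seg (x + h) (y + h) = seg x y"
proof -
  assume h: "h \<in> Z2"
  have "x + h + t *\<^sub>R (y + h - (x + h)) = (x + t *\<^sub>R (y - x)) + h" for t by simp
  then show ?thesis unfolding seg_def by (simp only: proj_Z2_add[OF h])
qed

text \<open>The straight-line homotopy between the lift and its chord fixes the end points, so the
  sides of the square traced by them are constant paths, which are null-homologous.\<close>

lemma path_chain_seg:
  fixes c :: "real \<Rightarrow> real^2"
  assumes c: "continuous_on {0..1} c"
  shows "path_chain (\<lambda>t. proj Z2 (c t)) \<approx>\<^sub>1 seg (c 0) (c 1)"
proof -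
  \<comment> \<open>Clamping the parameter extends \<open>c\<close> to the whole line, since the
    homotopy is to be defined on the whole plane.\<close>
  define c' where "c' t = c (max 0 (min 1 t))" for t
  have c': "continuous_on UNIV c'"
    unfolding c'_def by (rule continuous_on_compose2[OF c]) (auto intro!: continuous_intros)
  have c'01: "c' t = c t" if "0 \<le> t" "t \<le> 1" for t using that by (simp add: c'_def)
  have c2: "continuous_on UNIV (\<lambda>z::real\<times>real. c' (snd z))"
    by (rule continuous_on_compose2[OF c']) (auto intro!: continuous_intros)
  have "continuous_on UNIV (\<lambda>(s, t). (1 - s) *\<^sub>R (c 0 + t *\<^sub>R (c 1 - c 0)) + s *\<^sub>R c' t)"
    unfolding split_beta by (intro continuous_intros c2)
  from square_homologous[OF continuous_map_proj_comp[OF this]]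
  have "path_chain (\<lambda>t. proj Z2 (c' t)) + path_chain (\<lambda>t. proj Z2 ((1 - t) *\<^sub>R c 0 + t *\<^sub>R c' 0)) \<approx>\<^sub>1
     path_chain (\<lambda>t. proj Z2 ((1 - t) *\<^sub>R c 1 + t *\<^sub>R c' 1)) + seg (c 0) (c 1)"
    by (simp add: seg_def)
  then have "path_chain (\<lambda>t. proj Z2 (c' t)) + path_chain (\<lambda>t. proj Z2 (c 0)) \<approx>\<^sub>1
     path_chain (\<lambda>t. proj Z2 (c 1)) + seg (c 0) (c 1)"
    by (simp add: c'01 flip: scaleR_add_left)
  moreover have const: "path_chain (\<lambda>t. proj Z2 x) \<approx>\<^sub>1 0" for x
    by (rule path_chain_const) (simp add: topspace_quotient_top plane_mod_def)
  ultimately have "path_chain (\<lambda>t. proj Z2 (c' t)) + path_chain (\<lambda>t. proj Z2 (c 0)) - path_chain (\<lambda>t. proj Z2 (c 0)) \<approx>\<^sub>1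
     path_chain (\<lambda>t. proj Z2 (c 1)) + seg (c 0) (c 1) - 0"
    by (intro homologous_rel_diff) auto
  then have "path_chain (\<lambda>t. proj Z2 (c' t)) \<approx>\<^sub>1 path_chain (\<lambda>t. proj Z2 (c 1)) + seg (c 0) (c 1)"
    by simp
  also have "\<dots> \<approx>\<^sub>1 0 + seg (c 0) (c 1)"
    by (intro homologous_rel_add const homologous_rel_refl)
  finally show ?thesis
    using path_chain_cong[of "\<lambda>t. proj Z2 (c' t)" "\<lambda>t. proj Z2 (c t)"] by (simp add: c'01)
qed

lemma seg_from_0: "seg x y \<approx>\<^sub>1 seg 0 y - seg 0 x"
  using homologous_rel_diff[OF seg_add[of 0 x y] homologous_rel_refl[of _ _ _ "seg 0 x"]]
  by simp

lemma seg_0_shift: "h \<in> Z2 \<Longrightarrow> seg 0 (x + h) \<approx>\<^sub>1 seg 0 h + seg 0 x"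
  using seg_add[of 0 h "x + h"] seg_shift[of h 0 x] by (subst homologous_rel_sym) simp

text \<open>The loop is homologous to the segment from \<open>c 0\<close> to \<open>c 0 + h\<close>;
  a lattice translation leaves projected segments unchanged, so the base point cancels.\<close>

lemma loop_seg:
  fixes c :: "real \<Rightarrow> real^2"
  assumes c: "continuous_on {0..1} c" and h: "h \<in> Z2" "c 1 = c 0 + h"
  shows "path_chain (\<lambda>t. proj Z2 (c t)) \<approx>\<^sub>1 seg 0 h"
proof -
  have "path_chain (\<lambda>t. proj Z2 (c t)) \<approx>\<^sub>1 seg (c 0) (c 0 + h)"
    using path_chain_seg[OF c] h by simp
  also have "\<dots> \<approx>\<^sub>1 seg 0 (c 0 + h) - seg 0 (c 0)"
    by (rule seg_from_0)
  also have "\<dots> \<approx>\<^sub>1 (seg 0 h + seg 0 (c 0)) - seg 0 (c 0)"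
    by (intro homologous_rel_diff seg_0_shift h) auto
  finally show ?thesis by simp
qed

lemma singular_1_simplex_lift:
  assumes "singular_simplex 1 (quotient_top Z2) \<sigma>"
  obtains c where "continuous_on {0..1} c" "\<sigma> = (\<lambda>x\<in>standard_simplex 1. proj Z2 (c (x 1)))"
proof -
  \<comment> \<open>The inverse of the coordinate \<open>x 1\<close> on the standard 1-simplex; it
    turns the simplex into a path on the unit interval.\<close>
  define e :: "real \<Rightarrow> nat \<Rightarrow> real" where "e t = (\<lambda>i. if i = 0 then 1 - t else if i = 1 then t else 0)" for t
  have e01: "e t \<in> standard_simplex 1" if "t \<in> {0..1}" for t
    using that by (auto simp: standard_simplex_1 e_def)
  have ee: "e (x 1) = x" if "x \<in> standard_simplex 1" for x
    using that unfolding standard_simplex_1 e_def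
    by (auto simp: fun_eq_iff)
  have "continuous_map (top_of_set {0..1}) (subtopology (powertop_real UNIV) (standard_simplex 1)) e"
  proof -
    have "continuous_on {0..1} (\<lambda>t. e t k)" for k
      unfolding e_def by (cases "k = 0"; cases "k = 1") (auto intro!: continuous_intros)
    then show ?thesis
      using e01 by (auto simp: continuous_map_in_subtopology continuous_map_componentwise_UNIV)
  qed
  moreover have \<sigma>: "continuous_map (subtopology (powertop_real UNIV) (standard_simplex 1)) (quotient_top Z2) \<sigma>"
    "\<sigma> \<in> extensional (standard_simplex 1)"
    using assms by (auto simp: singular_simplex_def)
  ultimately have p: "continuous_map (top_of_set {0..1}) (quotient_top Z2) (\<lambda>t. \<sigma> (e t))"
    using continuous_map_compose by (fastforce simp: comp_def)
  have ce: "continuous_on {0..1} (\<lambda>t. circle_coord j (\<sigma> (e t)))" for j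
    using continuous_map_compose[OF p continuous_map_circle_coord[of j]] by (simp add: comp_def)
  have im: "(\<lambda>t. \<sigma> (e t)) ` {0..1} \<subseteq> plane_mod Z2"
    using p by (auto simp: continuous_map_def topspace_quotient_top)
  obtain c where c: "continuous_on {0..1} c" "\<And>t. t \<in> {0..1} \<Longrightarrow> proj Z2 (c t) = \<sigma> (e t)"
    using lift_exists[OF convex_imp_contractible[OF convex_real_interval(5)] im ce] by metis
  have "\<sigma> = (\<lambda>x\<in>standard_simplex 1. proj Z2 (c (x 1)))"
  proof (rule extensionalityI[OF \<sigma>(2)])
    fix x assume "x \<in> standard_simplex 1"
    then show "\<sigma> x = (\<lambda>x\<in>standard_simplex 1. proj Z2 (c (x 1))) x"
      using c(2)[of "x 1"] ee[of x] by (auto simp: standard_simplex_1)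
  qed auto
  with c(1) show ?thesis by (rule that)
qed

lemma chain_boundary_path:
  "chain_boundary 1 (path_chain \<gamma>) =
     frag_of (\<lambda>x\<in>standard_simplex 0. \<gamma> 1) - frag_of (\<lambda>x\<in>standard_simplex 0. \<gamma> 0)"
proof -
  have "simplical_face i x \<in> standard_simplex 1" if "i \<le> 1" "x \<in> standard_simplex 0" for i and x :: "nat \<Rightarrow> real"
    by (rule simplical_face_in_standard_simplex) (use that in \<open>auto simp: One_nat_def\<close>)
  moreover have "simplical_face i x 1 = (if i = 0 then 1 else 0)"
    if "i \<le> 1" "x \<in> standard_simplex 0" for i and x :: "nat \<Rightarrow> real"
    using that by (auto simp: simplical_face_def standard_simplex_0)
  moreover have "1 - Suc 0 = 0" by simp
  ultimately have "frag_of (singular_face 1 i (\<lambda>x\<in>standard_simplex 1. \<gamma> (x 1))) =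
      frag_of (\<lambda>x\<in>standard_simplex 0. \<gamma> (if i = 0 then 1 else 0))" if "i \<le> 1" for i
    unfolding singular_face_def
    using that by (intro arg_cong[where f = frag_of])
      (auto simp: fun_eq_iff restrict_def)
  from this[of 0] this[of 1]
  have "frag_of (singular_face 1 0 (\<lambda>x\<in>standard_simplex 1. \<gamma> (x 1))) = frag_of (\<lambda>x\<in>standard_simplex 0. \<gamma> 1)"
    "frag_of (singular_face 1 1 (\<lambda>x\<in>standard_simplex 1. \<gamma> (x 1))) = frag_of (\<lambda>x\<in>standard_simplex 0. \<gamma> 0)"
    by simp_all
  moreover have "{..1::nat} = {0, 1}" by auto
  ultimately show ?thesis
    unfolding path_chain_def by (subst chain_boundary_of) simp
qed

text \<open>For a cycle the second summand vanishes, so every homology class is that of a lattice segment.\<close>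

lemma chain_decomposition:
  assumes "singular_chain 1 (quotient_top Z2) c"
  shows "\<exists>h\<in>Z2. c \<approx>\<^sub>1 seg 0 h + frag_extend (\<lambda>f. seg 0 (rep (f (\<lambda>j. if j = 0 then 1 else 0)))) (chain_boundary 1 c)"
proof -
  \<comment> \<open>\<open>R\<close> replaces each 0-simplex by the segment from the origin to the
    chosen representative of its point; the argument of \<open>f\<close> is the only point of the
    standard 0-simplex.\<close>
  define R where "R = frag_extend (\<lambda>f. seg 0 (rep (f (\<lambda>j::nat. if j = 0 then 1 else (0::real)))))"
  have "Poly_Mapping.keys c \<subseteq> singular_simplex_set 1 (quotient_top Z2)"
    using assms by (simp add: singular_chain_def)
  then have "\<exists>h\<in>Z2. c \<approx>\<^sub>1 seg 0 h + R (chain_boundary 1 c)"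
  proof (induction c rule: frag_induction)
    case zero
    show ?case
      using seg_refl[of 0] Z2_0 by (intro bexI[of _ 0]) (subst homologous_rel_sym, auto simp: R_def)
  next
    case (one \<sigma>)
    then obtain \<gamma> where \<gamma>: "continuous_on {0..1} \<gamma>" "\<sigma> = (\<lambda>x\<in>standard_simplex 1. proj Z2 (\<gamma> (x 1)))"
      using singular_1_simplex_lift by blast
    have \<sigma>: "frag_of \<sigma> = path_chain (\<lambda>t. proj Z2 (\<gamma> t))" by (simp add: path_chain_def \<gamma>)
    have Rb: "R (chain_boundary 1 (frag_of \<sigma>)) = seg 0 (rep (proj Z2 (\<gamma> 1))) - seg 0 (rep (proj Z2 (\<gamma> 0)))"
      by (simp add: \<sigma> chain_boundary_path R_def frag_extend_diff standard_simplex_0)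
    \<comment> \<open>The lattice vector by which a point of the plane differs from the chosen
      representative of its class.\<close>
    define k where "k x = x - rep (proj Z2 x)" for x
    have k: "k x \<in> Z2" for x
      unfolding k_def by (simp add: proj_rep plane_mod_def flip: proj_Z2_eq_iff)
    have 0: "seg 0 x \<approx>\<^sub>1 seg 0 (k x) + seg 0 (rep (proj Z2 x))" for x
      using seg_0_shift[OF k, of "rep (proj Z2 x)" x] by (simp add: k_def)
    have "seg (\<gamma> 0) (\<gamma> 1) \<approx>\<^sub>1 seg 0 (\<gamma> 1) - seg 0 (\<gamma> 0)" by (rule seg_from_0)
    also have "\<dots> \<approx>\<^sub>1 (seg 0 (k (\<gamma> 1)) + seg 0 (rep (proj Z2 (\<gamma> 1)))) -
        (seg 0 (k (\<gamma> 0)) + seg 0 (rep (proj Z2 (\<gamma> 0))))"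
      by (intro homologous_rel_diff 0)
    also have "\<dots> = (seg 0 (k (\<gamma> 1)) - seg 0 (k (\<gamma> 0))) + R (chain_boundary 1 (frag_of \<sigma>))"
      by (simp add: Rb)
    also have "\<dots> \<approx>\<^sub>1 seg 0 (k (\<gamma> 1) - k (\<gamma> 0)) + R (chain_boundary 1 (frag_of \<sigma>))"
    proof (intro homologous_rel_add homologous_rel_refl)
      have "seg (k (\<gamma> 0)) (k (\<gamma> 1)) = seg 0 (k (\<gamma> 1) - k (\<gamma> 0))"
        using seg_shift[OF k[of "\<gamma> 0"], of 0 "k (\<gamma> 1) - k (\<gamma> 0)"] by simp
      then show "seg 0 (k (\<gamma> 1)) - seg 0 (k (\<gamma> 0)) \<approx>\<^sub>1 seg 0 (k (\<gamma> 1) - k (\<gamma> 0))"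
        using seg_from_0 homologous_rel_sym by metis
    qed
    finally have "seg (\<gamma> 0) (\<gamma> 1) \<approx>\<^sub>1 seg 0 (k (\<gamma> 1) - k (\<gamma> 0)) + R (chain_boundary 1 (frag_of \<sigma>))" .
    then have "frag_of \<sigma> \<approx>\<^sub>1 seg 0 (k (\<gamma> 1) - k (\<gamma> 0)) + R (chain_boundary 1 (frag_of \<sigma>))"
      using path_chain_seg[OF \<gamma>(1)] homologous_rel_trans unfolding \<sigma> by blast
    then show ?case using Z2_diff[OF k k] by blast
  next
    case (diff a b)
    then obtain h k where hk: "h \<in> Z2" "k \<in> Z2" "a \<approx>\<^sub>1 seg 0 h + R (chain_boundary 1 a)"
      "b \<approx>\<^sub>1 seg 0 k + R (chain_boundary 1 b)" by blast
    have "seg k h = seg 0 (h - k)"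
      using seg_shift[OF hk(2), of 0 "h - k"] by simp
    then have s: "seg 0 h - seg 0 k \<approx>\<^sub>1 seg 0 (h - k)"
      using seg_from_0 homologous_rel_sym by metis
    have "a - b \<approx>\<^sub>1 (seg 0 h + R (chain_boundary 1 a)) - (seg 0 k + R (chain_boundary 1 b))"
      by (intro homologous_rel_diff hk)
    also have "\<dots> = (seg 0 h - seg 0 k) + R (chain_boundary 1 (a - b))"
      by (simp add: R_def frag_extend_diff chain_boundary_diff)
    also have "\<dots> \<approx>\<^sub>1 seg 0 (h - k) + R (chain_boundary 1 (a - b))"
      by (intro homologous_rel_add s homologous_rel_refl)
    finally show ?case using Z2_diff[OF hk(1,2)] by blast
  qed
  then show ?thesis unfolding R_def .
qed

lemma cycle_homologous_seg:
  assumes "singular_relcycle 1 (quotient_top Z2) {} c"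
  obtains h where "h \<in> Z2" "c \<approx>\<^sub>1 seg 0 h"
  using chain_decomposition[of c] assms by (auto simp: singular_cycle)

lemma relcycle_loop:
  fixes c :: "real \<Rightarrow> real^2"
  assumes c: "continuous_on UNIV c" and h: "proj Z2 (c 1) = proj Z2 (c 0)"
  shows "singular_relcycle 1 (quotient_top Z2) {} (path_chain (\<lambda>t. proj Z2 (c t)))"
  unfolding singular_cycle chain_boundary_path h
  unfolding path_chain_def singular_chain_of
  using singular_simplex_path[OF continuous_map_proj_comp[OF c]] by simp

section \<open>Lattice bases and generators of the first homology group\<close>

definition zbasis :: "real^2 \<Rightarrow> real^2 \<Rightarrow> bool" where
  "zbasis b1 b2 \<longleftrightarrow> b1 \<in> Z2 \<and> b2 \<in> Z2 \<and> \<bar>cr b1 b2\<bar> = 1"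

text \<open>Cramer's rule with the denominator cleared. For a lattice basis the determinant is its
  own inverse, so the coefficients of a lattice vector are integers.\<close>

lemma cr_expand: "cr b1 b2 *\<^sub>R h = cr h b2 *\<^sub>R b1 + cr b1 h *\<^sub>R b2"
  by (simp add: cr_def vec_eq_iff forall_2 algebra_simps)

lemma cr_Ints: "h \<in> Z2 \<Longrightarrow> k \<in> Z2 \<Longrightarrow> cr h k \<in> \<int>"
  by (simp add: cr_def Z2_def)

lemma zbasis_expand:
  assumes b: "zbasis b1 b2" and h: "h \<in> Z2"
  obtains m n :: int where "h = of_int m *\<^sub>R b1 + of_int n *\<^sub>R b2"
proof -
  have sq: "cr b1 b2 * cr b1 b2 = 1"
    using b unfolding zbasis_def by (metis abs_mult_self_eq mult_1)
  have "h = (cr b1 b2 * cr h b2) *\<^sub>R b1 + (cr b1 b2 * cr b1 h) *\<^sub>R b2"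
    using arg_cong[OF cr_expand[of b1 b2 h], of "\<lambda>v. cr b1 b2 *\<^sub>R v"] sq by (simp add: algebra_simps)
  moreover have "cr b1 b2 * cr h b2 \<in> \<int>" "cr b1 b2 * cr b1 h \<in> \<int>"
    using b h by (auto simp: zbasis_def cr_Ints)
  ultimately show ?thesis using that by (metis Ints_cases)
qed

lemma homology_class_mult:
  "homologous_rel_set 1 X {} a \<otimes>\<^bsub>homology_group 1 X\<^esub> homologous_rel_set 1 X {} b = homologous_rel_set 1 X {} (a + b)"
proof -
  have "homologous_rel_set 1 X {} a \<otimes>\<^bsub>homology_group 1 X\<^esub> homologous_rel_set 1 X {} b =
    (\<Union>r\<in>homologous_rel_set 1 X {} a. \<Union>s\<in>homologous_rel_set 1 X {} b. {r + s})"
    using mult_relative_homology_group[of 1 X "{}"] by simp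
  also have "\<dots> = homologous_rel_set 1 X {} (a + b)"
  proof safe
    fix x assume "homologous_rel 1 X {} (a + b) x"
    then have "homologous_rel 1 X {} (a + b - b) (x - b)"
      by (intro homologous_rel_diff) auto
    then have "x - b \<in> homologous_rel_set 1 X {} a" "b \<in> homologous_rel_set 1 X {} b" by auto
    then show "x \<in> (\<Union>r\<in>homologous_rel_set 1 X {} a. \<Union>s\<in>homologous_rel_set 1 X {} b. {r + s})"
      by (metis (no_types, lifting) UN_I diff_add_cancel singletonI)
  qed (auto intro: homologous_rel_add)
  finally show ?thesis .
qed

text \<open>Sending a lattice vector \<open>h\<close> to the class of \<open>seg 0 h\<close> is
  additive, and it is onto because every cycle is homologous to such a segment. Hence the image of a
  lattice basis generates the group.\<close>

lemma generate_H1_if_zbasis: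
  fixes c1 c2 :: "real \<Rightarrow> real^2"
  assumes c: "continuous_on {0..1} c1" "continuous_on {0..1} c2"
    and b: "zbasis (c1 1 - c1 0) (c2 1 - c2 0)"
    and \<gamma>: "\<And>t. t \<in> {0..1} \<Longrightarrow> \<gamma>1 t = proj Z2 (c1 t)" "\<And>t. t \<in> {0..1} \<Longrightarrow> \<gamma>2 t = proj Z2 (c2 t)"
  shows "generate_H1 \<gamma>1 \<gamma>2"
proof -
  define cl where "cl = homologous_rel_set 1 (quotient_top Z2) {}"
  define G where "G = homology_group 1 (quotient_top Z2)"
  define b1 b2 where "b1 = c1 1 - c1 0" and "b2 = c2 1 - c2 0"
  have bZ: "b1 \<in> Z2" "b2 \<in> Z2" "zbasis b1 b2" using b by (auto simp: zbasis_def b1_def b2_def)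
  interpret G: group G unfolding G_def by simp
  have cl_eq: "cl a = cl a'" if "a \<approx>\<^sub>1 a'" for a a'
    using that unfolding cl_def homologous_rel_set_eq .
  have carrier: "carrier G = cl ` singular_relcycle_set 1 (quotient_top Z2) {}"
    using carrier_relative_homology_group[of 1 "quotient_top Z2" "{}"] by (simp add: G_def cl_def)
  have mult: "cl a \<otimes>\<^bsub>G\<^esub> cl a' = cl (a + a')" for a a'
    unfolding cl_def G_def by (rule homology_class_mult)
  have cyc: "singular_relcycle 1 (quotient_top Z2) {} (seg 0 h)" if "h \<in> Z2" for h
    unfolding seg_def using that
    by (intro relcycle_loop) (auto simp: proj_Z2_eq_iff intro!: continuous_intros)
  have carr: "cl (seg 0 h) \<in> carrier G" if "h \<in> Z2" for h
    using cyc[OF that] by (auto simp: carrier)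
  have addh: "cl (seg 0 h) \<otimes>\<^bsub>G\<^esub> cl (seg 0 k) = cl (seg 0 (h + k))" if "h \<in> Z2" "k \<in> Z2" for h k
    unfolding mult using seg_0_shift[OF that(1), of k]
    by (intro cl_eq) (subst homologous_rel_sym, simp add: add.commute)
  have one: "cl (seg 0 0) = \<one>\<^bsub>G\<^esub>"
    using addh[OF Z2_0 Z2_0] carr[OF Z2_0] by (simp add: G.l_cancel_one)
  have neg: "cl (seg 0 (- h)) = inv\<^bsub>G\<^esub> cl (seg 0 h)" if "h \<in> Z2" for h
    using addh[OF Z2_uminus[OF that] that] one carr[OF that] carr[OF Z2_uminus[OF that]]
    by (intro G.inv_equality[symmetric]) auto
  define Gen where "Gen = generate G {cl (seg 0 b1), cl (seg 0 b2)}"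
  have sub: "{cl (seg 0 b1), cl (seg 0 b2)} \<subseteq> carrier G" using carr bZ by auto
  have Gen: "subgroup Gen G" unfolding Gen_def by (rule G.generate_is_subgroup[OF sub])
  have mem: "cl (seg 0 (of_int m *\<^sub>R k)) \<in> Gen" if k: "k \<in> Z2" "cl (seg 0 k) \<in> Gen" for m k
  proof (induction m rule: int_induct[where k = 0])
    case base
    then show ?case using subgroup.one_closed[OF Gen] by (simp add: one)
  next
    case (step1 i)
    have "cl (seg 0 (of_int i *\<^sub>R k)) \<otimes>\<^bsub>G\<^esub> cl (seg 0 k) \<in> Gen"
      using step1 k subgroup.m_closed[OF Gen] by blast
    then show ?case by (subst (asm) addh) (auto simp: k Z2_scale algebra_simps)
  next
    case (step2 i)
    have "cl (seg 0 (of_int i *\<^sub>R k)) \<otimes>\<^bsub>G\<^esub> cl (seg 0 (- k)) \<in> Gen"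
      using step2 k subgroup.m_closed[OF Gen] subgroup.m_inv_closed[OF Gen] by (simp add: neg)
    then show ?case by (subst (asm) addh) (auto simp: k Z2_scale Z2_uminus algebra_simps)
  qed
  have "carrier G \<subseteq> Gen"
  proof
    fix x assume "x \<in> carrier G"
    then obtain a where a: "x = cl a" "singular_relcycle 1 (quotient_top Z2) {} a"
      by (auto simp: carrier)
    then obtain h where h: "h \<in> Z2" "a \<approx>\<^sub>1 seg 0 h" using cycle_homologous_seg by blast
    obtain m n :: int where mn: "h = of_int m *\<^sub>R b1 + of_int n *\<^sub>R b2"
      using zbasis_expand[OF bZ(3) h(1)] by blast
    have "cl (seg 0 b1) \<in> Gen" "cl (seg 0 b2) \<in> Gen"
      unfolding Gen_def by (auto intro: generate.incl)
    then have "cl (seg 0 (of_int m *\<^sub>R b1)) \<otimes>\<^bsub>G\<^esub> cl (seg 0 (of_int n *\<^sub>R b2)) \<in> Gen"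
      using mem bZ subgroup.m_closed[OF Gen] by blast
    then have "cl (seg 0 h) \<in> Gen"
      unfolding mn by (subst (asm) addh) (auto simp: bZ Z2_scale)
    then show "x \<in> Gen" using a h cl_eq by simp
  qed
  then have GG: "Gen = carrier G" using subgroup.subset[OF Gen] by auto
  have "loop_class \<gamma>1 = cl (seg 0 b1)" "loop_class \<gamma>2 = cl (seg 0 b2)"
  proof -
    have "path_chain \<gamma>1 = path_chain (\<lambda>t. proj Z2 (c1 t))" "path_chain \<gamma>2 = path_chain (\<lambda>t. proj Z2 (c2 t))"
      using \<gamma> by (auto intro!: path_chain_cong)
    then show "loop_class \<gamma>1 = cl (seg 0 b1)" "loop_class \<gamma>2 = cl (seg 0 b2)"
      using cl_eq[OF loop_seg[OF c(1) bZ(1)]] cl_eq[OF loop_seg[OF c(2) bZ(2)]]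
      by (simp_all add: b1_def b2_def loop_class_def cl_def flip: path_chain_def)
  qed
  then show ?thesis
    using GG unfolding generate_H1_def Gen_def G_def by simp
qed

declare One_nat_def [simp]

section \<open>Areas of hexagons\<close>

lemma cr_add_left: "cr (x + y) z = cr x z + cr y z"
  and cr_add_right: "cr z (x + y) = cr z x + cr z y"
  and cr_diff_left: "cr (x - y) z = cr x z - cr y z"
  and cr_diff_right: "cr z (x - y) = cr z x - cr z y"
  and cr_scaleR_left [simp]: "cr (c *\<^sub>R x) z = c * cr x z"
  and cr_scaleR_right [simp]: "cr z (c *\<^sub>R x) = c * cr z x"
  and cr_minus_left [simp]: "cr (- x) z = - cr x z"
  and cr_minus_right [simp]: "cr z (- x) = - cr z x"
  and cr_0 [simp]: "cr 0 z = 0" "cr z 0 = 0" "cr x x = 0"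
  and cr_swap: "cr x y = - cr y x"
  by (simp_all add: cr_def algebra_simps)

lemma negligible_cr_line: "a \<noteq> 0 \<Longrightarrow> negligible {u. cr a u = 0}"
proof -
  assume "a \<noteq> 0"
  define r :: "real^2" where "r = vector [- (a $ 2), a $ 1]"
  have "r \<noteq> 0" using \<open>a \<noteq> 0\<close> by (auto simp: r_def vec_eq_iff forall_2)
  then have "negligible {u. r \<bullet> u = 0}" using negligible_hyperplane by blast
  moreover have "r \<bullet> u = cr a u" for u
    by (simp add: inner_vec_def sum_2 cr_def r_def)
  ultimately show ?thesis by (simp only:)
qed

lemma compact_triangle: "compact (convex hull {0, a, b :: real^2})"
  by (intro finite_imp_compact_convex_hull) auto

lemma measure_triangle: "measure lebesgue (convex hull {0, a, b}) = \<bar>cr a b\<bar> / 2"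
proof -
  have "measure lebesgue (convex hull {0, a, b}) = measure lborel (convex hull {0, a, b})"
    using compact_triangle[of a b] by (intro measure_completion) (auto dest: compact_imp_closed)
  then show ?thesis by (simp add: content_triangle cr_def abs_minus_commute mult.commute)
qed

lemma triangle_cases:
  assumes "u \<in> convex hull {0, a, b :: real^2}"
  obtains s t where "0 \<le> s" "0 \<le> t" "u = s *\<^sub>R a + t *\<^sub>R b"
  using assms by (auto simp: convex_hull_3)

lemma negligible_triangle:
  fixes a b :: "real^2"
  assumes "a = 0 \<or> b = 0"
  shows "negligible (convex hull {0, a, b})"
proof -
  have "measure lebesgue (convex hull {0, a, b}) = 0"
    using assms measure_triangle[of a b] by auto
  then show ?thesis
    using negligible_iff_measure0 lmeasurable_compact[OF compact_triangle] by blast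
qed

text \<open>Up to signs, three vectors are in cyclic order within a half-plane. The triangles spanned by
  consecutive vectors and their opposites then do not overlap.\<close>

lemma measure_hexagon_ordered:
  assumes X: "cr p1 p2 \<ge> 0" and Y: "cr p2 p3 \<ge> 0" and Z: "cr p1 p3 \<ge> 0" and p1: "p1 \<noteq> 0"
    and K: "K \<in> lmeasurable" "convex K" "0 \<in> K" "\<And>x. x \<in> K \<Longrightarrow> - x \<in> K"
    and p: "p1 \<in> K" "p2 \<in> K" "p3 \<in> K"
  shows "cr p1 p2 + cr p2 p3 + cr p1 p3 \<le> measure lebesgue K"
proof -
  define T1 T2 T3 where "T1 = convex hull {0, p1, p2}" and "T2 = convex hull {0, p2, p3}"
    and "T3 = convex hull {0, p3, - p1}"
  note T_def = T1_def T2_def T3_def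
  have meas: "T1 \<in> lmeasurable" "T2 \<in> lmeasurable" "T3 \<in> lmeasurable"
    unfolding T_def by (auto intro: lmeasurable_compact compact_triangle)
  \<comment> \<open>For a common point \<open>u\<close>, the first triangle gives
    \<open>cr p2 u \<le> 0\<close> and the second \<open>cr p2 u \<ge> 0\<close>, so the overlap
    lies on a line. The other two pairs are separated likewise by the line through
    \<open>p3\<close>.\<close>
  have n12: "negligible (T1 \<inter> T2)"
  proof (cases "p2 = 0")
    case True
    then show ?thesis using negligible_triangle[of p1 p2] negligible_subset T1_def by blast
  next
    case False
    have "T1 \<inter> T2 \<subseteq> {u. cr p2 u = 0}"
    proof
      fix u assume "u \<in> T1 \<inter> T2"
      then obtain s t s' t' where st: "0 \<le> s" "0 \<le> t" "u = s *\<^sub>R p1 + t *\<^sub>R p2"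
        "0 \<le> s'" "0 \<le> t'" "u = s' *\<^sub>R p2 + t' *\<^sub>R p3"
        unfolding T_def by (metis IntE triangle_cases)
      have "cr p2 u = - (s * cr p1 p2)" unfolding st(3) using cr_swap[of p2 p1] by (simp add: cr_add_right)
      moreover have "cr p2 u = t' * cr p2 p3" unfolding st(6) by (simp add: cr_add_right cr_diff_right)
      moreover have "0 \<le> s * cr p1 p2" "0 \<le> t' * cr p2 p3" using st X Y by auto
      ultimately have "cr p2 u = 0" by linarith
      then show "u \<in> {u. cr p2 u = 0}" by simp
    qed
    then show ?thesis using negligible_cr_line[OF False] negligible_subset by blast
  qed
  have n23: "negligible (T2 \<inter> T3)"
  proof (cases "p3 = 0")
    case True
    then show ?thesis using negligible_triangle[of p2 p3] negligible_subset T2_def by blast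
  next
    case False
    have "T2 \<inter> T3 \<subseteq> {u. cr p3 u = 0}"
    proof
      fix u assume "u \<in> T2 \<inter> T3"
      then obtain s t s' t' where st: "0 \<le> s" "0 \<le> t" "u = s *\<^sub>R p2 + t *\<^sub>R p3"
        "0 \<le> s'" "0 \<le> t'" "u = s' *\<^sub>R p3 + t' *\<^sub>R (- p1)"
        unfolding T_def by (metis IntE triangle_cases)
      have "cr p3 u = - (s * cr p2 p3)" unfolding st(3) using cr_swap[of p3 p2] by (simp add: cr_add_right)
      moreover have "cr p3 u = t' * cr p1 p3" unfolding st(6) using cr_swap[of p3 p1] by (simp add: cr_add_right cr_diff_right)
      moreover have "0 \<le> s * cr p2 p3" "0 \<le> t' * cr p1 p3" using st Y Z by auto
      ultimately have "cr p3 u = 0" by linarith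
      then show "u \<in> {u. cr p3 u = 0}" by simp
    qed
    then show ?thesis using negligible_cr_line[OF False] negligible_subset by blast
  qed
  have n13: "negligible (T1 \<inter> T3)"
  proof (cases "p3 = 0")
    case True
    then show ?thesis using negligible_triangle[of p3 "- p1"] negligible_subset T3_def by blast
  next
    case False
    have "T1 \<inter> T3 \<subseteq> {u. cr p3 u = 0}"
    proof
      fix u assume "u \<in> T1 \<inter> T3"
      then obtain s t s' t' where st: "0 \<le> s" "0 \<le> t" "u = s *\<^sub>R p1 + t *\<^sub>R p2"
        "0 \<le> s'" "0 \<le> t'" "u = s' *\<^sub>R p3 + t' *\<^sub>R (- p1)"
        unfolding T_def by (metis IntE triangle_cases)
      have "cr p3 u = - (s * cr p1 p3) - t * cr p2 p3" unfolding st(3)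
        using cr_swap[of p3 p2] cr_swap[of p3 p1] by (simp add: cr_add_right)
      moreover have "cr p3 u = t' * cr p1 p3" unfolding st(6) using cr_swap[of p3 p1] by (simp add: cr_add_right cr_diff_right)
      moreover have "0 \<le> s * cr p1 p3" "0 \<le> t * cr p2 p3" "0 \<le> t' * cr p1 p3" using st Z Y by auto
      ultimately have "cr p3 u = 0" by linarith
      then show "u \<in> {u. cr p3 u = 0}" by simp
    qed
    then show ?thesis using negligible_cr_line[OF False] negligible_subset by blast
  qed
  define A where "A = T1 \<union> T2 \<union> T3"
  have mA: "measure lebesgue A = (cr p1 p2 + cr p2 p3 + cr p1 p3) / 2"
    unfolding measure_Un3_negligible[OF meas n12 n13 n23 A_def[symmetric]]
    using X Y Z cr_swap[of p3 p1] by (simp add: T_def measure_triangle)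
  have Am: "A \<in> lmeasurable" unfolding A_def using meas by (intro fmeasurable.Un)
  have mA': "measure lebesgue (uminus ` A) = measure lebesgue A"
    using measure_lebesgue_affine[of "-1" 0 A] by simp
  have "compact A" unfolding A_def T_def by (intro compact_Un compact_triangle)
  then have Am': "uminus ` A \<in> lmeasurable"
    by (intro lmeasurable_compact compact_negations[of A, simplified])
  \<comment> \<open>The three triangles lie in one half-plane bounded by the line through
    \<open>p1\<close>, so they meet their opposites only on that line.\<close>
  have pos: "cr p1 u \<ge> 0" if "u \<in> A" for u
  proof -
    have *: "cr p1 u \<ge> 0" if "u \<in> convex hull {0, a, b}" "cr p1 a \<ge> 0" "cr p1 b \<ge> 0" for a b
      using that(1) by (rule triangle_cases) (simp add: cr_add_right that)
    have "cr p1 p1 \<ge> 0" "cr p1 (- p1) \<ge> 0" by simp_all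
    then have "u \<in> T1 \<Longrightarrow> ?thesis" "u \<in> T2 \<Longrightarrow> ?thesis" "u \<in> T3 \<Longrightarrow> ?thesis"
      unfolding T_def using * X Y Z by blast+
    then show ?thesis using \<open>u \<in> A\<close> unfolding A_def by blast
  qed
  have "A \<inter> uminus ` A \<subseteq> {u. cr p1 u = 0}"
  proof
    fix u assume "u \<in> A \<inter> uminus ` A"
    then obtain w where "u \<in> A" "w \<in> A" "u = - w" by blast
    then show "u \<in> {u. cr p1 u = 0}" using pos[of u] pos[of w] by simp
  qed
  then have "negligible (A \<inter> uminus ` A)"
    using negligible_cr_line[OF p1] negligible_subset by blast
  then have "measure lebesgue (A \<union> uminus ` A) = cr p1 p2 + cr p2 p3 + cr p1 p3"
    using measure_Un3[OF Am Am'] mA mA' by (simp add: negligible_imp_measure0)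
  moreover have "A \<union> uminus ` A \<subseteq> K"
  proof -
    have "convex hull {0, a, b} \<subseteq> K" if "a \<in> K" "b \<in> K" for a b
      using that K by (intro hull_minimal) auto
    then have "A \<subseteq> K" using p K unfolding A_def T_def by blast
    then show ?thesis using K by auto
  qed
  ultimately show ?thesis
    using measure_mono_fmeasurable[of "A \<union> uminus ` A" K lebesgue] K Am Am'
    by (auto simp: fmeasurableD)
qed

text \<open>Replacing a vector by its opposite changes no absolute value and stays in
  \<open>K\<close>, so \<open>p2\<close> and \<open>p3\<close> may be moved to the half-plane to the
  left of \<open>p1\<close> and then sorted by the sign of their determinant. If \<open>p1\<close>
  vanishes, \<open>p2\<close> takes its place; if both vanish, the sum is 0.\<close>

lemma measure_hexagon:
  assumes K: "K \<in> lmeasurable" "convex K" "0 \<in> K" "\<And>x. x \<in> K \<Longrightarrow> - x \<in> K"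
    and p: "p1 \<in> K" "p2 \<in> K" "p3 \<in> K"
  shows "\<bar>cr p1 p2\<bar> + \<bar>cr p2 p3\<bar> + \<bar>cr p1 p3\<bar> \<le> measure lebesgue K"
proof -
  have nz: "\<bar>cr p1 p2\<bar> + \<bar>cr p2 p3\<bar> + \<bar>cr p1 p3\<bar> \<le> measure lebesgue K"
    if p1: "p1 \<noteq> 0" and p: "p1 \<in> K" "p2 \<in> K" "p3 \<in> K" for p1 p2 p3
  proof -
    define q2 q3 where "q2 = (if cr p1 p2 \<ge> 0 then p2 else - p2)" and "q3 = (if cr p1 p3 \<ge> 0 then p3 else - p3)"
    have q: "cr p1 q2 \<ge> 0" "cr p1 q3 \<ge> 0" "q2 \<in> K" "q3 \<in> K"
      and eq: "cr p1 q2 = \<bar>cr p1 p2\<bar>" "cr p1 q3 = \<bar>cr p1 p3\<bar>" "\<bar>cr q2 q3\<bar> = \<bar>cr p2 p3\<bar>"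
      using p K by (auto simp: q2_def q3_def)
    show ?thesis
    proof (cases "cr q2 q3 \<ge> 0")
      case True
      from measure_hexagon_ordered[OF q(1) True q(2) p1 K p(1) q(3,4)] True eq show ?thesis by simp
    next
      case False
      then have F: "cr q3 q2 \<ge> 0" using cr_swap[of q3 q2] by simp
      from measure_hexagon_ordered[OF q(2) F q(1) p1 K p(1) q(4,3)] F eq cr_swap[of q3 q2] show ?thesis by simp
    qed
  qed
  have sw: "\<bar>cr x y\<bar> = \<bar>cr y x\<bar>" for x y using cr_swap[of x y] by simp
  show ?thesis
  proof (cases "p1 = 0")
    case False
    then show ?thesis using nz p by blast
  next
    case True
    show ?thesis
    proof (cases "p2 = 0")
      case False
      from nz[OF False p(2,3,1)] True show ?thesis by simp
    qed (use True in simp)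
  qed
qed

text \<open>The interior of a convex body is dense in it, so near a point of \<open>K\<close>
  outside the closed set \<open>H\<close> there is an open subset of \<open>K\<close> disjoint from
  \<open>H\<close>, and it has positive measure.\<close>

lemma convex_eq_if_measure_le:
  fixes H K :: "'a::euclidean_space set"
  assumes H: "compact H" and K: "compact K" "convex K" "interior K \<noteq> {}" and sub: "H \<subseteq> K"
    and le: "measure lebesgue K \<le> measure lebesgue H"
  shows "K = H"
proof (rule ccontr)
  assume "K \<noteq> H"
  then obtain x where x: "x \<in> K" "x \<notin> H" using sub by auto
  define U where "U = interior K - H"
  have oU: "open U" unfolding U_def using H by (intro open_Diff compact_imp_closed) auto
  have "x \<in> closure (interior K)"
    using convex_closure_interior[OF K(2,3)] x closure_subset by blast
  moreover have "open (- H)" using H by (simp add: compact_imp_closed open_closed)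
  ultimately have "U \<noteq> {}"
    using x open_Int_closure_eq_empty[of "- H" "interior K"] unfolding U_def by blast
  with oU have nn: "\<not> negligible U" by (rule open_not_negligible)
  have UK: "U \<subseteq> K" unfolding U_def using interior_subset by blast
  have Um: "U \<in> lmeasurable"
    using oU UK bounded_subset[OF compact_imp_bounded[OF K(1)]] by (intro lmeasurable_open) auto
  have Hm: "H \<in> lmeasurable" using H by (rule lmeasurable_compact)
  have "measure lebesgue (H \<union> U) = measure lebesgue H + measure lebesgue U"
    using measure_Un3[OF Hm Um] by (simp add: U_def Diff_Int_distrib)
  moreover have "measure lebesgue U > 0"
    using nn Um negligible_iff_measure0 by (metis measure_nonneg order_le_less)
  moreover have "measure lebesgue (H \<union> U) \<le> measure lebesgue K"
    using sub UK Hm Um lmeasurable_compact[OF K(1)] by (intro measure_mono_fmeasurable) (auto simp: fmeasurableD)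
  ultimately show False using le by linarith
qed

lemma inner_2: "x \<bullet> y = x $ 1 * y $ 1 + x $ 2 * y $ 2" for x y :: "real^2"
  by (simp add: inner_vec_def sum_2)

text \<open>\<open>|x| + |y| \<le> 2\<close> holds if and only if both \<open>x + y\<close> and
  \<open>x - y\<close> lie between -2 and 2. Hence pairing with \<open>p + q\<close> and
  \<open>p - q\<close> maps the set linearly onto a square of area 16, with determinant
  \<open>-2 * cr p q\<close>.\<close>

lemma measure_dual_parallelogram:
  assumes cr: "cr p q \<noteq> 0"
  shows "measure lebesgue {\<xi>. \<bar>\<xi> \<bullet> p\<bar> + \<bar>\<xi> \<bullet> q\<bar> \<le> 2} = 8 / \<bar>cr p q\<bar>"
proof -
  define S where "S = {\<xi>. \<bar>\<xi> \<bullet> p\<bar> + \<bar>\<xi> \<bullet> q\<bar> \<le> 2}"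
  define f :: "real^2 \<Rightarrow> real^2" where "f \<xi> = vector [\<xi> \<bullet> (p + q), \<xi> \<bullet> (p - q)]" for \<xi>
  \<comment> \<open>Cramer's rule for the inverse of \<open>f\<close>.\<close>
  define g :: "real^2 \<Rightarrow> real^2" where "g \<eta> = (1 / cr (p + q) (p - q)) *\<^sub>R
      vector [\<eta> $ 1 * (p - q) $ 2 - \<eta> $ 2 * (p + q) $ 2, (p + q) $ 1 * \<eta> $ 2 - (p - q) $ 1 * \<eta> $ 1]" for \<eta>
  have D: "cr (p + q) (p - q) = - 2 * cr p q"
    using cr_swap[of q p] by (simp add: cr_add_left cr_diff_right)
  have D0: "(p + q) $ 1 * (p - q) $ 2 - (p + q) $ 2 * (p - q) $ 1 \<noteq> 0"
    using D cr by (simp add: cr_def)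
  have lin: "linear f" "linear g"
    unfolding f_def g_def
    by (intro linearI; simp add: vec_eq_iff forall_2 inner_add_left algebra_simps add_divide_distrib diff_divide_distrib)+
  have fg: "f (g \<eta>) = \<eta>" for \<eta>
  proof -
    define a b c d where "a = (p + q) $ 1" and "b = (p + q) $ 2" and "c = (p - q) $ 1" and "d = (p - q) $ 2"
    define E where "E = a * d - b * c"
    have E: "E \<noteq> 0" using D0 unfolding E_def a_def b_def c_def d_def .
    have g12: "g \<eta> $ 1 = (\<eta> $ 1 * d - \<eta> $ 2 * b) / E" "g \<eta> $ 2 = (a * \<eta> $ 2 - c * \<eta> $ 1) / E"
      unfolding g_def cr_def a_def b_def c_def d_def E_def by simp_all
    have f12: "f x $ 1 = x $ 1 * a + x $ 2 * b" "f x $ 2 = x $ 1 * c + x $ 2 * d" for x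
      unfolding f_def a_def b_def c_def d_def inner_2 by simp_all
    have "(\<eta> $ 1 * d - \<eta> $ 2 * b) * a + (a * \<eta> $ 2 - c * \<eta> $ 1) * b = \<eta> $ 1 * E"
      "(\<eta> $ 1 * d - \<eta> $ 2 * b) * c + (a * \<eta> $ 2 - c * \<eta> $ 1) * d = \<eta> $ 2 * E"
      unfolding E_def by (simp_all add: algebra_simps)
    then show ?thesis
      using E by (simp add: vec_eq_iff forall_2 f12 g12 flip: add_divide_distrib)
  qed
  have mem: "\<xi> \<in> S \<longleftrightarrow> f \<xi> \<in> cbox (vector [-2, -2]) (vector [2, 2])" for \<xi>
    unfolding S_def f_def mem_box_cart forall_2 by (auto simp: inner_add_right inner_diff_right)
  have img: "f ` S = cbox (vector [-2, -2]) (vector [2, 2])"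
    using mem fg by (auto simp: image_iff) (metis fg)
  have inj: "S = (\<lambda>\<eta>. g \<eta>) ` cbox (vector [-2, -2]) (vector [2, 2])"
  proof -
    have "inj f" using lin(1) fg by (metis linear_surj_imp_inj surjI)
    then have "g (f \<xi>) = \<xi>" for \<xi> using fg by (metis injD)
    then show ?thesis using img by (metis (no_types, lifting) image_cong image_ident image_image)
  qed
  have "S \<in> lmeasurable"
    unfolding inj by (intro lmeasurable_compact compact_continuous_image linear_continuous_on)
      (use lin in \<open>auto simp: linear_conv_bounded_linear\<close>)
  then have "measure lebesgue (f ` S) = \<bar>det (matrix f)\<bar> * measure lebesgue S"
    by (rule measure_linear_image[OF lin(1)])
  moreover have "measure lebesgue (f ` S) = 16"
  proof -
    have "measure lebesgue (f ` S) = measure lborel (cbox (vector [-2, -2]) (vector [2, 2] :: real^2))"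
      unfolding img by (intro measure_completion) auto
    also have "\<dots> = 16" unfolding content_cbox_2 by (simp add: content_Pair)
    finally show ?thesis .
  qed
  moreover have "det (matrix f) = cr (p + q) (p - q)"
    unfolding det_2 matrix_def f_def cr_def by (simp add: inner_axis' mult.commute)
  ultimately have "16 = 2 * \<bar>cr p q\<bar> * measure lebesgue S" by (simp add: D abs_mult)
  then show ?thesis using cr by (simp add: S_def field_simps)
qed

section \<open>Finsler norms and their dual balls\<close>

lemma Ck_on_2D:
  assumes "Ck_on (Suc (Suc 0)) f S" "x \<in> S"
  shows "f differentiable (at x)" "(\<lambda>x. frechet_derivative f (at x) w) differentiable (at x)"
  using assms by auto

section \<open>The lifted metric and its convexity\<close>

locale finsler_torus =
  fixes F :: metric_fun
  assumes F: "finsler_metric F"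
begin

definition E :: "real^2 \<Rightarrow> real^2 \<Rightarrow> real" where
  "E x v = F (proj Z2 x) v"

lemma E_periodic: "h \<in> Z2 \<Longrightarrow> E (x + h) v = E x v"
  by (simp add: E_def proj_Z2_add)

lemma E_nonneg: "E x v \<ge> 0"
  using F by (auto simp: finsler_metric_def E_def plane_mod_def)

lemma E_scale: "E x (t *\<^sub>R v) = \<bar>t\<bar> * E x v"
  using F by (auto simp: finsler_metric_def E_def plane_mod_def)

lemma E_uminus [simp]: "E x (- v) = E x v"
  using E_scale[of x "-1" v] by simp

lemma E_0 [simp]: "E x 0 = 0"
  using E_scale[of x 0 0] by simp

lemma E_cont: "continuous_on UNIV (\<lambda>(x, v). E x v)"
  using F by (auto simp: finsler_metric_def E_def)

lemma E_continuous_on [continuous_intros]: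
  "continuous_on S f \<Longrightarrow> continuous_on S g \<Longrightarrow> continuous_on S (\<lambda>x. E (f x) (g x))"
  using continuous_on_compose2[OF E_cont, of S "\<lambda>x. (f x, g x)"] by (simp add: continuous_on_Pair)

text \<open>Smoothness is assumed on the total space; restricting to one fibre is composing with the
  affine map \<open>Pair x\<close>, so fibre derivatives are derivatives in the directions
  \<open>(0, w)\<close>.\<close>

lemma E_C2:
  shows E_differentiable: "v \<noteq> 0 \<Longrightarrow> E x differentiable (at v)"
    and E_differentiable2: "v \<noteq> 0 \<Longrightarrow> (\<lambda>y. frechet_derivative (E x) (at y) w) differentiable (at v)"
proof -
  define G where "G = (\<lambda>(x, v). F (proj Z2 x) v)"
  have "Ck_on (Suc (Suc 0)) G {(x, v). v \<noteq> 0}"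
    using F unfolding finsler_metric_def smooth_on_def G_def by blast
  from Ck_on_2D[OF this]
  have G: "\<And>v. v \<noteq> 0 \<Longrightarrow> G differentiable (at (x, v))"
    "\<And>v. v \<noteq> 0 \<Longrightarrow> (\<lambda>z. frechet_derivative G (at z) (0, w)) differentiable (at (x, v))" by auto
  have EG: "E x = G \<circ> Pair x" by (auto simp: E_def G_def)
  have P: "(Pair x has_derivative Pair 0) (at v)" for v :: "real^2"
    by (rule has_derivative_Pair[OF has_derivative_const has_derivative_ident, simplified])
  have d: "(E x has_derivative (\<lambda>w. frechet_derivative G (at (x, v)) (0, w))) (at v)" if "v \<noteq> 0" for v
    using diff_chain_at[OF P, of G] G(1)[OF that] frechet_derivative_works unfolding EG by (auto simp: comp_def)
  then show "v \<noteq> 0 \<Longrightarrow> E x differentiable (at v)" unfolding differentiable_def by blast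
  have fd: "frechet_derivative (E x) (at v) w = frechet_derivative G (at (x, v)) (0, w)" if "v \<noteq> 0" for v
    using frechet_derivative_at[OF d[OF that]] by metis
  assume v: "v \<noteq> 0"
  have "((\<lambda>z. frechet_derivative G (at z) (0, w)) \<circ> Pair x) differentiable (at v)"
    using differentiable_chain_at[OF differentiableI[OF P] G(2)[OF v]] .
  then obtain D where "(((\<lambda>z. frechet_derivative G (at z) (0, w)) \<circ> Pair x) has_derivative D) (at v)"
    unfolding differentiable_def by blast
  then have "((\<lambda>y. frechet_derivative (E x) (at y) w) has_derivative D) (at v)"
    by (rule has_derivative_transform_within_open[of _ _ _ _ "- {0}"]) (auto simp: fd v)
  then show "(\<lambda>y. frechet_derivative (E x) (at y) w) differentiable (at v)"
    unfolding differentiable_def by blast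
qed

definition q :: "real^2 \<Rightarrow> real^2 \<Rightarrow> real" where
  "q x v = (E x v)\<^sup>2"

lemma q_has_derivative: "v \<noteq> 0 \<Longrightarrow> (q x has_derivative frechet_derivative (q x) (at v)) (at v)"
  and q_derivative: "v \<noteq> 0 \<Longrightarrow> frechet_derivative (q x) (at v) w = 2 * E x v * frechet_derivative (E x) (at v) w"
proof -
  assume "v \<noteq> 0"
  then have "(E x has_derivative frechet_derivative (E x) (at v)) (at v)"
    using E_differentiable frechet_derivative_works by blast
  then have d: "(q x has_derivative (\<lambda>w. 2 * E x v * frechet_derivative (E x) (at v) w)) (at v)"
    unfolding q_def[abs_def] by (auto intro!: derivative_eq_intros)
  then show "(q x has_derivative frechet_derivative (q x) (at v)) (at v)"
    using frechet_derivative_works differentiableI by blast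
  show "frechet_derivative (q x) (at v) w = 2 * E x v * frechet_derivative (E x) (at v) w"
    using frechet_derivative_at[OF d] by metis
qed

lemma q_differentiable2:
  assumes v: "v \<noteq> 0"
  shows "((\<lambda>y. frechet_derivative (q x) (at y) w) has_derivative second_derivative (q x) v w) (at v)"
proof -
  obtain D where D: "((\<lambda>y. frechet_derivative (E x) (at y) w) has_derivative D) (at v)"
    using E_differentiable2[OF v] unfolding differentiable_def by blast
  obtain D' where D': "(E x has_derivative D') (at v)"
    using E_differentiable[OF v] unfolding differentiable_def by blast
  have "\<exists>D. ((\<lambda>y. 2 * E x y * frechet_derivative (E x) (at y) w) has_derivative D) (at v)"
    by (rule exI, (rule derivative_eq_intros D D' refl)+)
  then obtain D'' where "((\<lambda>y. 2 * E x y * frechet_derivative (E x) (at y) w) has_derivative D'') (at v)"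
    by blast
  then have "((\<lambda>y. frechet_derivative (q x) (at y) w) has_derivative D'') (at v)"
    by (rule has_derivative_transform_within_open[of _ _ _ _ "- {0}"]) (auto simp: q_derivative v)
  then have "(\<lambda>y. frechet_derivative (q x) (at y) w) differentiable (at v)"
    by (rule differentiableI)
  then show ?thesis
    unfolding frechet_derivative_works second_derivative_def[abs_def] .
qed

lemma second_pos: "v \<noteq> 0 \<Longrightarrow> w \<noteq> 0 \<Longrightarrow> second_derivative (q x) v w w > 0"
  using F unfolding finsler_metric_def q_def[abs_def] E_def[abs_def] plane_mod_def by blast

lemma line_derivatives:
  assumes "v + t *\<^sub>R w \<noteq> 0"
  shows "((\<lambda>t. q x (v + t *\<^sub>R w)) has_real_derivative frechet_derivative (q x) (at (v + t *\<^sub>R w)) w) (at t)"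
    and "((\<lambda>t. frechet_derivative (q x) (at (v + t *\<^sub>R w)) w) has_real_derivative
           second_derivative (q x) (v + t *\<^sub>R w) w w) (at t)"
proof -
  have L: "((\<lambda>t. v + t *\<^sub>R w) has_derivative (\<lambda>h. h *\<^sub>R w)) (at t)"
    by (auto intro!: derivative_eq_intros)
  have *: "((\<lambda>t. g (v + t *\<^sub>R w)) has_real_derivative D w) (at t)"
    if "(g has_derivative D) (at (v + t *\<^sub>R w))" for g D
  proof -
    have "linear D" using that by (rule has_derivative_linear)
    then have "(\<lambda>h. D (h *\<^sub>R w)) = (*) (D w)" by (auto simp: linear_scale mult.commute)
    then show ?thesis
      using has_derivative_compose[OF L that] by (simp add: has_field_derivative_def)
  qed
  show "((\<lambda>t. q x (v + t *\<^sub>R w)) has_real_derivative frechet_derivative (q x) (at (v + t *\<^sub>R w)) w) (at t)"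
    by (rule *[OF q_has_derivative[OF assms]])
  show "((\<lambda>t. frechet_derivative (q x) (at (v + t *\<^sub>R w)) w) has_real_derivative
           second_derivative (q x) (v + t *\<^sub>R w) w w) (at t)"
    by (rule *[OF q_differentiable2[OF assms]])
qed

text \<open>A Finsler metric is only required to be nonnegative. A zero at \<open>v\<close> would by
  homogeneity make \<open>q\<close> vanish on the whole line through \<open>v\<close>, against the
  positivity of its second derivative at \<open>v\<close> in the direction \<open>v\<close>.\<close>

lemma E_pos: assumes v: "v \<noteq> 0" shows "E x v > 0"
proof (rule ccontr)
  assume "\<not> ?thesis"
  then have "E x v = 0" using E_nonneg[of x v] by simp
  then have z: "q x (v + t *\<^sub>R v) = 0" for t
    using E_scale[of x "1 + t" v] by (simp add: q_def scaleR_add_left)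
  \<comment> \<open>Parameters in this range keep the point off the origin, where no derivative is
    assumed.\<close>
  have nz: "v + t *\<^sub>R v \<noteq> 0" if "t \<in> {-1<..<1}" for t
  proof -
    have "v + t *\<^sub>R v = (1 + t) *\<^sub>R v" by (simp add: scaleR_add_left)
    then show ?thesis using v that by auto
  qed
  have d0: "frechet_derivative (q x) (at (v + t *\<^sub>R v)) v = 0" if "t \<in> {-1<..<1}" for t
    using line_derivatives(1)[OF nz[OF that], of x] unfolding z
    by (metis DERIV_const DERIV_unique)
  have "((\<lambda>t. frechet_derivative (q x) (at (v + t *\<^sub>R v)) v) has_real_derivative 0) (at 0)"
    by (rule has_field_derivative_transform_within_open[of "\<lambda>_. 0" _ _ "{-1<..<1}"]) (auto simp: d0)
  moreover have "((\<lambda>t. frechet_derivative (q x) (at (v + t *\<^sub>R v)) v) has_real_derivative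
      second_derivative (q x) v v v) (at 0)"
    using line_derivatives(2)[OF nz[of 0], of x] by simp
  ultimately have "second_derivative (q x) v v v = 0" using DERIV_unique by blast
  then show False using second_pos[OF v v, of x] by simp
qed

text \<open>For independent vectors, \<open>q\<close> is convex along the line through the two
  normalized vectors, because that line misses the origin and the second derivative is positive on
  it. Dependent vectors are handled by homogeneity.\<close>

lemma E_triangle: "E x (v + w) \<le> E x v + E x w"
proof (cases "cr v w = 0")
  case True
  have "\<exists>c. w = c *\<^sub>R v" if "v \<noteq> 0"
  proof -
    have "(v \<bullet> v) *\<^sub>R w = (w \<bullet> v) *\<^sub>R v"
    proof -
      have e: "v $ 1 * w $ 2 = v $ 2 * w $ 1" using True by (simp add: cr_def)
      have "(v $ 1 * v $ 1 + v $ 2 * v $ 2) * w $ 1 = v $ 1 * v $ 1 * w $ 1 + v $ 2 * (v $ 2 * w $ 1)"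
        "(v $ 1 * v $ 1 + v $ 2 * v $ 2) * w $ 2 = v $ 1 * (v $ 1 * w $ 2) + v $ 2 * v $ 2 * w $ 2"
        by (simp_all add: algebra_simps)
      then have "(v $ 1 * v $ 1 + v $ 2 * v $ 2) * w $ 1 = (w $ 1 * v $ 1 + w $ 2 * v $ 2) * v $ 1"
        "(v $ 1 * v $ 1 + v $ 2 * v $ 2) * w $ 2 = (w $ 1 * v $ 1 + w $ 2 * v $ 2) * v $ 2"
        unfolding e[symmetric] by (simp_all add: algebra_simps e)
      then show ?thesis by (simp add: vec_eq_iff forall_2 inner_2)
    qed
    then have "(1 / (v \<bullet> v)) *\<^sub>R ((v \<bullet> v) *\<^sub>R w) = (1 / (v \<bullet> v)) *\<^sub>R ((w \<bullet> v) *\<^sub>R v)"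
      by (rule arg_cong)
    then have "w = ((w \<bullet> v) / (v \<bullet> v)) *\<^sub>R v" using that by simp
    then show ?thesis by blast
  qed
  then consider "v = 0" | c where "w = c *\<^sub>R v" by blast
  then show ?thesis
  proof cases
    case 2
    have "E x (v + w) = \<bar>1 + c\<bar> * E x v" using E_scale[of x "1 + c" v] 2 by (simp add: scaleR_add_left)
    also have "\<dots> \<le> (1 + \<bar>c\<bar>) * E x v" using E_nonneg[of x v] by (intro mult_right_mono) auto
    finally show ?thesis using 2 E_scale[of x c v] by (simp add: algebra_simps)
  qed simp
next
  case False
  then have vw: "v \<noteq> 0" "w \<noteq> 0" by auto
  define a b where "a = E x v" and "b = E x w"
  have ab: "a > 0" "b > 0" using E_pos vw by (auto simp: a_def b_def)
  define v' w' where "v' = (1 / a) *\<^sub>R v" and "w' = (1 / b) *\<^sub>R w"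
  have cr': "cr v' w' \<noteq> 0" using False ab by (simp add: v'_def w'_def)
  have nz: "v' + t *\<^sub>R (w' - v') \<noteq> 0" for t
  proof
    assume "v' + t *\<^sub>R (w' - v') = 0"
    then have "cr v' (v' + t *\<^sub>R (w' - v')) = 0" "cr (v' + t *\<^sub>R (w' - v')) w' = 0" by simp_all
    then show False using cr' by (simp add: cr_add_left cr_add_right cr_diff_left cr_diff_right algebra_simps)
  qed
  have d0: "w' - v' \<noteq> 0" using cr' by auto
  have q1: "q x v' = 1" "q x w' = 1"
    using ab by (simp_all add: q_def v'_def w'_def E_scale flip: a_def b_def)
  have "convex_on UNIV (\<lambda>t. q x (v' + t *\<^sub>R (w' - v')))"
    by (rule f''_ge0_imp_convex[OF _ line_derivatives(1)[OF nz] line_derivatives(2)[OF nz]])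
      (use second_pos[OF nz d0] in \<open>auto intro: less_imp_le\<close>)
  \<comment> \<open>At this parameter the point of the line is \<open>v + w\<close> divided by
    \<open>a + b\<close>.\<close>
  moreover have t01: "0 \<le> b / (a + b)" "b / (a + b) \<le> 1" using ab by simp_all
  ultimately have "q x (v' + (b / (a + b)) *\<^sub>R (w' - v')) \<le> 1"
    using convex_onD[OF _ t01, of UNIV _ 0 1] q1 by fastforce
  moreover have "v' + (b / (a + b)) *\<^sub>R (w' - v') = (1 / (a + b)) *\<^sub>R (v + w)"
  proof -
    have "r / a + b / (a + b) * (s / b - r / a) = (r + s) / (a + b)" for r s
    proof -
      have "b / (a + b) * (s / b - r / a) = s / (a + b) - b / (a + b) * (r / a)"
        using ab by (simp add: right_diff_distrib)
      moreover have "r / a - b / (a + b) * (r / a) = r / (a + b)"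
      proof -
        have "1 - b / (a + b) = a / (a + b)" using ab by (simp add: field_simps)
        then have "(1 - b / (a + b)) * (r / a) = r / (a + b)" using ab by simp
        then show ?thesis unfolding left_diff_distrib by simp
      qed
      ultimately show ?thesis by (simp add: add_divide_distrib)
    qed
    then show ?thesis unfolding v'_def w'_def vec_eq_iff by simp
  qed
  ultimately have "(E x (v + w) / (a + b))\<^sup>2 \<le> 1"
    using ab by (simp add: q_def E_scale)
  then have "E x (v + w) / (a + b) \<le> 1"
    using ab E_nonneg[of x "v + w"] by (simp add: abs_square_le_1)
  then show ?thesis using ab by (simp add: a_def b_def field_simps)
qed

lemma Z2_floor: obtains h where "h \<in> Z2" "x - h \<in> cbox 0 (1 :: real^2)"
proof
  show "(\<chi> i. of_int \<lfloor>x $ i\<rfloor>) \<in> Z2" by (simp add: Z2_def)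
  show "x - (\<chi> i. of_int \<lfloor>x $ i\<rfloor>) \<in> cbox 0 1"
    by (simp add: mem_box_cart) linarith
qed

text \<open>Periodicity reduces to base points in the unit square and homogeneity to unit vectors;
  together these form a compact set.\<close>

lemma E_bounds: obtains m M where "0 < m" "0 < M" "\<And>x v. m * norm v \<le> E x v" "\<And>x v. E x v \<le> M * norm v"
proof -
  define K where "K = cbox (0 :: real^2) 1 \<times> sphere (0 :: real^2) 1"
  have K: "compact K" "K \<noteq> {}"
  proof -
    have "(0 :: real^2) \<in> cbox 0 1" by (simp add: mem_box_cart)
    then show "compact K" "K \<noteq> {}" unfolding K_def by (auto intro!: compact_Times)
  qed
  have cont: "continuous_on K (\<lambda>(x, v). E x v)" using E_cont continuous_on_subset by blast
  obtain z1 where z1: "z1 \<in> K" "\<And>z. z \<in> K \<Longrightarrow> (\<lambda>(x, v). E x v) z1 \<le> (\<lambda>(x, v). E x v) z"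
    using continuous_attains_inf[OF K cont] by blast
  obtain z2 where z2: "z2 \<in> K" "\<And>z. z \<in> K \<Longrightarrow> (\<lambda>(x, v). E x v) z \<le> (\<lambda>(x, v). E x v) z2"
    using continuous_attains_sup[OF K cont] by blast
  define m M where "m = E (fst z1) (snd z1)" and "M = E (fst z2) (snd z2)"
  have "m > 0" unfolding m_def using z1(1) by (intro E_pos) (auto simp: K_def)
  have b: "m \<le> E x v \<and> E x v \<le> M" if "norm v = 1" for x v
  proof -
    obtain h where h: "h \<in> Z2" "x - h \<in> cbox 0 1" by (rule Z2_floor)
    have "E x v = E (x - h) v" using E_periodic[OF h(1), of "x - h" v] by simp
    then show ?thesis
      using z1(2)[of "(x - h, v)"] z2(2)[of "(x - h, v)"] h that by (auto simp: K_def m_def M_def split_beta)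
  qed
  have "m * norm v \<le> E x v \<and> E x v \<le> M * norm v" for x v
  proof (cases "v = 0")
    case False
    have "v = norm v *\<^sub>R ((1 / norm v) *\<^sub>R v)" using False by simp
    then have "E x v = norm v * E x ((1 / norm v) *\<^sub>R v)" using E_scale by (metis abs_norm_cancel)
    moreover have "norm ((1 / norm v) *\<^sub>R v) = 1" using False by simp
    ultimately show ?thesis using b[of "(1 / norm v) *\<^sub>R v" x] False by (simp add: mult.commute mult_left_mono)
  qed simp
  moreover have "M > 0"
    using b[of "axis 1 1" 0] \<open>m > 0\<close> by (simp add: norm_axis_1)
  ultimately show ?thesis using that \<open>m > 0\<close> by blast
qed

text \<open>The functional is the differential of \<open>E x\<close> at \<open>v\<close>: the
  triangle inequality bounds its difference quotients by \<open>E x w\<close>, and Euler's relation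
  for homogeneous functions gives the value at \<open>v\<close>.\<close>

lemma support_functional:
  assumes v: "v \<noteq> 0"
  obtains \<xi> where "\<And>w. \<xi> \<bullet> w \<le> E x w" "\<xi> \<bullet> v = E x v"
proof -
  obtain D where D: "(E x has_derivative D) (at v)"
    using E_differentiable[OF v] unfolding differentiable_def by blast
  have lin: "linear D" using D by (rule has_derivative_linear)
  define \<xi> :: "real^2" where "\<xi> = (\<chi> i. D (axis i 1))"
  have \<xi>: "\<xi> \<bullet> w = D w" for w
  proof -
    have "D w = D (\<Sum>i\<in>UNIV. w $ i *\<^sub>R axis i 1)" by (simp add: basis_expansion flip: scalar_mult_eq_scaleR)
    also have "\<dots> = \<xi> \<bullet> w" by (simp add: linear_sum[OF lin] linear_scale[OF lin] \<xi>_def inner_vec_def mult.commute)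
    finally show ?thesis by simp
  qed
  have line: "((\<lambda>t. E x (v + t *\<^sub>R w)) has_real_derivative D w) (at 0)" for w
  proof -
    have "((\<lambda>t. v + t *\<^sub>R w) has_derivative (\<lambda>h. h *\<^sub>R w)) (at (0::real))"
      by (auto intro!: derivative_eq_intros)
    moreover have "(E x has_derivative D) (at (v + 0 *\<^sub>R w))" using D by simp
    ultimately have "((\<lambda>t. E x (v + t *\<^sub>R w)) has_derivative (\<lambda>h. D (h *\<^sub>R w))) (at 0)"
      by (rule has_derivative_compose)
    moreover have "(\<lambda>h. D (h *\<^sub>R w)) = (*) (D w)" by (auto simp: linear_scale[OF lin] mult.commute)
    ultimately show ?thesis by (simp add: has_field_derivative_def)
  qed
  have "D w \<le> E x w" for w
  proof -
    have "((\<lambda>t. (E x (v + t *\<^sub>R w) - E x v) / t) \<longlongrightarrow> D w) (at_right 0)"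
      using line[of w] by (simp add: has_field_derivative_iff filterlim_at_split)
    then show ?thesis
    proof (rule tendsto_upperbound)
      show "\<forall>\<^sub>F t in at_right 0. (E x (v + t *\<^sub>R w) - E x v) / t \<le> E x w"
        unfolding eventually_at_filter
      proof (rule always_eventually, intro allI impI)
        fix t :: real assume "t \<noteq> 0" "t \<in> {0<..}"
        then show "(E x (v + t *\<^sub>R w) - E x v) / t \<le> E x w"
          using E_triangle[of x v "t *\<^sub>R w"] E_scale[of x t w] by (simp add: field_simps)
      qed
    qed simp
  qed
  moreover have "D v = E x v"
  proof -
    have "((\<lambda>t. (1 + t) * E x v) has_real_derivative E x v) (at 0)"
      by (auto intro!: derivative_eq_intros)
    then have "((\<lambda>t. E x (v + t *\<^sub>R v)) has_real_derivative E x v) (at 0)"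
    proof (rule has_field_derivative_transform_within_open[of _ _ _ "{-1<..}"])
      show "(1 + t) * E x v = E x (v + t *\<^sub>R v)" if "t \<in> {-1<..}" for t
        using E_scale[of x "1 + t" v] that by (simp add: scaleR_add_left)
    qed auto
    then show ?thesis using line[of v] DERIV_unique by blast
  qed
  ultimately show ?thesis using that \<xi> by metis
qed

text \<open>On \<open>U\<close> the square of the metric would be that of a linear functional, whose
  derivative in a direction orthogonal to \<open>a\<close> vanishes identically; so would the second
  derivative in that direction.\<close>

lemma not_locally_linear:
  assumes U: "open U" "U \<noteq> {}" and eq: "\<And>v. v \<in> U \<Longrightarrow> E x v = \<bar>a \<bullet> v\<bar>"
  shows False
proof -
  define w :: "real^2" where "w = vector [- (a $ 2), a $ 1]"
  have aw: "a \<bullet> w = 0" by (simp add: inner_2 w_def)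
  have oU: "open (U - {0})" using U by (intro open_Diff) auto
  have "U \<noteq> {0}" using U(1) not_open_singleton by metis
  then obtain v where v: "v \<in> U - {0}" using U by blast
  have "a \<noteq> 0" using E_pos[of v x] eq[of v] v by auto
  then have w: "w \<noteq> 0" by (auto simp: w_def vec_eq_iff forall_2)
  have "frechet_derivative (q x) (at y) w = 0" if y: "y \<in> U - {0}" for y
  proof -
    have "((\<lambda>y. (a \<bullet> y)\<^sup>2) has_derivative (\<lambda>h. 2 * (a \<bullet> y) * (a \<bullet> h))) (at y)"
      by (auto intro!: derivative_eq_intros)
    then have "(q x has_derivative (\<lambda>h. 2 * (a \<bullet> y) * (a \<bullet> h))) (at y)"
      by (rule has_derivative_transform_within_open[OF _ oU y]) (auto simp: q_def eq)
    from frechet_derivative_at[OF this] have "(\<lambda>h. 2 * (a \<bullet> y) * (a \<bullet> h)) w = frechet_derivative (q x) (at y) w"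
      by (rule fun_cong)
    then show ?thesis using aw by simp
  qed
  then have "((\<lambda>y. frechet_derivative (q x) (at y) w) has_derivative (\<lambda>_. 0)) (at v)"
    by (intro has_derivative_transform_within_open[OF has_derivative_const oU v]) auto
  moreover have "((\<lambda>y. frechet_derivative (q x) (at y) w) has_derivative second_derivative (q x) v w) (at v)"
    using v by (intro q_differentiable2) auto
  ultimately have "second_derivative (q x) v w = (\<lambda>_. 0)"
    using has_derivative_unique by blast
  then show False using second_pos[of v w x] v w by simp
qed

section \<open>Dual balls\<close>

definition B :: "real^2 \<Rightarrow> (real^2) set" where
  "B x = {\<xi>. \<forall>v. \<xi> \<bullet> v \<le> E x v}"

text \<open>By homogeneity, a bound by 1 on the unit ball is the same as a bound by
  \<open>E x\<close> everywhere. In the second form the dual ball is an intersection of half-spaces,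
  so convexity and closedness are immediate. The lower bound \<open>m\<close> keeps the supremum
  finite.\<close>

lemma dual_ball_eq: "dual_ball F (proj Z2 x) = B x"
proof -
  obtain m M where m: "0 < m" "\<And>x v. m * norm v \<le> E x v" using E_bounds by metis
  have bdd: "bdd_above ((\<lambda>v. \<xi> \<bullet> v) ` {v. E x v \<le> 1})" for \<xi>
  proof (rule bdd_aboveI2)
    fix v assume "v \<in> {v. E x v \<le> 1}"
    then have "norm v \<le> 1 / m" using m(2)[of v x] m(1) by (simp add: field_simps)
    then have "norm \<xi> * norm v \<le> norm \<xi> * (1 / m)" by (intro mult_left_mono) auto
    then show "\<xi> \<bullet> v \<le> norm \<xi> * (1 / m)" using norm_cauchy_schwarz[of \<xi> v] by linarith
  qed
  have ne: "{v. E x v \<le> 1} \<noteq> {}" using E_0[of x] by (auto intro!: exI[of _ 0])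
  have "dual_norm F (proj Z2 x) \<xi> \<le> 1 \<longleftrightarrow> \<xi> \<in> B x" for \<xi>
  proof
    assume le: "dual_norm F (proj Z2 x) \<xi> \<le> 1"
    have "\<xi> \<bullet> v \<le> E x v" for v
    proof (cases "v = 0")
      case False
      have p: "E x v > 0" using E_pos[OF False] .
      have "E x ((1 / E x v) *\<^sub>R v) \<le> 1" using p by (simp add: E_scale)
      then have "\<xi> \<bullet> ((1 / E x v) *\<^sub>R v) \<le> dual_norm F (proj Z2 x) \<xi>"
        unfolding dual_norm_def E_def[symmetric] by (intro cSUP_upper bdd) auto
      then have "\<xi> \<bullet> v \<le> E x v * dual_norm F (proj Z2 x) \<xi>" using p by (simp add: field_simps)
      also have "\<dots> \<le> E x v * 1" using le p by (intro mult_left_mono) auto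
      finally show ?thesis by simp
    qed simp
    then show "\<xi> \<in> B x" by (simp add: B_def)
  next
    assume "\<xi> \<in> B x"
    then have "\<xi> \<bullet> v \<le> 1" if "E x v \<le> 1" for v using that by (auto simp: B_def intro: order_trans)
    then show "dual_norm F (proj Z2 x) \<xi> \<le> 1"
      unfolding dual_norm_def E_def[symmetric] using ne by (intro cSUP_least) auto
  qed
  then show ?thesis by (auto simp: dual_ball_def)
qed

lemma B_convex: "convex (B x)"
proof -
  have "B x = (\<Inter>v. {\<xi>. v \<bullet> \<xi> \<le> E x v})" by (auto simp: B_def inner_commute)
  then show ?thesis by (auto intro: convex_INT convex_halfspace_le)
qed

lemma B_uminus: "\<xi> \<in> B x \<Longrightarrow> - \<xi> \<in> B x"
proof -
  assume "\<xi> \<in> B x"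
  then have "\<xi> \<bullet> (- v) \<le> E x (- v)" for v unfolding B_def by blast
  then show ?thesis by (simp add: B_def)
qed

lemma B_0: "0 \<in> B x" by (simp add: B_def E_nonneg)

lemma B_abs: "\<xi> \<in> B x \<Longrightarrow> \<bar>\<xi> \<bullet> v\<bar> \<le> E x v"
  using B_uminus[of \<xi> x] by (auto simp: B_def abs_le_iff)

lemma B_bounded: obtains R where "R > 0" "\<And>x. B x \<subseteq> cball 0 R"
proof -
  obtain m M where M: "0 < M" "\<And>x v. E x v \<le> M * norm v" using E_bounds by metis
  have "B x \<subseteq> cball 0 M" for x
  proof
    fix \<xi> assume "\<xi> \<in> B x"
    then have "\<xi> \<bullet> \<xi> \<le> M * norm \<xi>" using M(2)[of x \<xi>] by (auto simp: B_def intro: order_trans)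
    then have "norm \<xi> * norm \<xi> \<le> M * norm \<xi>" by (simp add: dot_square_norm power2_eq_square)
    then show "\<xi> \<in> cball 0 M" using M(1) by (cases "\<xi> = 0") auto
  qed
  then show ?thesis using that M by blast
qed

lemma B_compact: "compact (B x)"
proof -
  have "B x = (\<Inter>v. {\<xi>. v \<bullet> \<xi> \<le> E x v})" by (auto simp: B_def inner_commute)
  then have "closed (B x)" by (auto intro: closed_INT closed_halfspace_le)
  moreover have "bounded (B x)" using B_bounded bounded_subset bounded_cball by metis
  ultimately show ?thesis by (simp add: compact_eq_bounded_closed)
qed

lemma B_lmeasurable: "B x \<in> lmeasurable"
  by (rule lmeasurable_compact[OF B_compact])

lemma B_interior: "interior (B x) \<noteq> {}"
proof -
  obtain m M where m: "0 < m" "\<And>x v. m * norm v \<le> E x v" using E_bounds by metis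
  have "ball 0 m \<subseteq> B x"
  proof
    fix \<xi> :: "real^2" assume "\<xi> \<in> ball 0 m"
    then have "norm \<xi> * norm v \<le> m * norm v" for v :: "real^2" by (intro mult_right_mono) auto
    then have "\<xi> \<bullet> v \<le> E x v" for v
      using norm_cauchy_schwarz[of \<xi> v] m(2)[of v x] by (meson order_trans)
    then show "\<xi> \<in> B x" by (simp add: B_def)
  qed
  then have "0 \<in> interior (B x)" using m(1) by (intro interiorI[of "ball 0 m"]) auto
  then show ?thesis by blast
qed

definition hex :: "real^2 \<Rightarrow> real^2 \<Rightarrow> real^2 \<Rightarrow> real" where
  "hex a b d = \<bar>cr a b\<bar> + \<bar>cr b d\<bar> + \<bar>cr a d\<bar>"

text \<open>Equality would make the dual ball the convex hull of the six points, hence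
  \<open>E x v\<close> the largest of the absolute values of \<open>a\<close>, \<open>b\<close>,
  \<open>d\<close> at \<open>v\<close>. Three closed sets then cover the plane, one of them has
  interior, and there the metric is the absolute value of a linear functional, against quadratic
  convexity.\<close>

lemma hex_less_measure:
  assumes p: "a \<in> B x" "b \<in> B x" "d \<in> B x"
  shows "hex a b d < measure lebesgue (B x)"
proof (rule ccontr)
  define H where "H = convex hull {a, b, d, - a, - b, - d}"
  assume "\<not> ?thesis"
  then have le: "measure lebesgue (B x) \<le> hex a b d" by simp
  have H: "compact H" "convex H" unfolding H_def by (auto intro!: finite_imp_compact_convex_hull)
  have pH: "a \<in> H" "b \<in> H" "d \<in> H" "- a \<in> H" "- b \<in> H" "- d \<in> H"
    unfolding H_def by (auto intro: hull_inc)
  have sym: "- u \<in> H" if "u \<in> H" for u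
  proof -
    have "H \<subseteq> uminus ` H"
    proof -
      have "convex (uminus ` H)" using H(2) by (rule convex_negations)
      moreover have "{a, b, d, - a, - b, - d} \<subseteq> uminus ` H" using pH by (auto simp: image_iff) (metis minus_minus)+
      ultimately show ?thesis unfolding H_def by (intro hull_minimal) auto
    qed
    then show ?thesis using that by auto
  qed
  have "0 \<in> H" using convexD[OF H(2) pH(1,4), of "1/2" "1/2"] by simp
  then have "hex a b d \<le> measure lebesgue H"
    unfolding hex_def using measure_hexagon[OF lmeasurable_compact[OF H(1)] H(2) _ sym pH(1-3)] by simp
  moreover have "H \<subseteq> B x"
    unfolding H_def using p B_uminus by (intro hull_minimal B_convex) auto
  ultimately have BH: "B x = H"
    using le by (intro convex_eq_if_measure_le[OF H(1) B_compact B_convex B_interior]) auto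
  define C where "C p = {v. E x v = \<bar>p \<bullet> v\<bar>}" for p
  have clC: "closed (C p)" for p
    unfolding C_def by (intro closed_Collect_eq continuous_intros)
  have "v \<in> C a \<union> (C b \<union> C d)" for v
  proof (cases "v = 0")
    case False
    \<comment> \<open>The support functional lies in the hull, so its value at \<open>v\<close> is
      at most the largest value at a generator.\<close>
    then obtain \<xi> where \<xi>: "\<And>w. \<xi> \<bullet> w \<le> E x w" "\<xi> \<bullet> v = E x v" using support_functional by blast
    define c where "c = max \<bar>a \<bullet> v\<bar> (max \<bar>b \<bullet> v\<bar> \<bar>d \<bullet> v\<bar>)"
    have "H \<subseteq> {\<xi>. v \<bullet> \<xi> \<le> c}"
      unfolding H_def by (intro hull_minimal convex_halfspace_le) (auto simp: c_def inner_commute)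
    moreover have "\<xi> \<in> H" using \<xi>(1) unfolding BH[symmetric] B_def by simp
    ultimately have "E x v \<le> c" using \<xi>(2) by (auto simp: inner_commute)
    moreover have "\<bar>a \<bullet> v\<bar> \<le> E x v" "\<bar>b \<bullet> v\<bar> \<le> E x v" "\<bar>d \<bullet> v\<bar> \<le> E x v" using p B_abs by auto
    ultimately show ?thesis unfolding C_def c_def by (auto simp: max_def split: if_splits)
  qed (simp add: C_def)
  then have UN: "C a \<union> (C b \<union> C d) = UNIV" by blast
  have "interior (C a) \<noteq> {} \<or> interior (C b) \<noteq> {} \<or> interior (C d) \<noteq> {}"
  proof (rule ccontr)
    assume "\<not> ?thesis"
    then have "interior (C a \<union> (C b \<union> C d)) = {}"
      using interior_closed_Un_empty_interior[OF clC] by metis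
    then show False using UN by simp
  qed
  then obtain p where "interior (C p) \<noteq> {}" by blast
  moreover have "\<And>v. v \<in> interior (C p) \<Longrightarrow> E x v = \<bar>p \<bullet> v\<bar>"
    using interior_subset by (auto simp: C_def)
  ultimately show False using not_locally_linear[OF open_interior] by metis
qed

text \<open>A relative modulus of continuity, uniform in \<open>v\<close>: on unit vectors the
  additive error is at most \<open>e * m\<close>, and \<open>m\<close> bounds the metric from below
  there.\<close>

lemma E_uniform:
  assumes "e > 0"
  obtains \<rho> where "\<rho> > 0" "\<And>x y v. dist x y < \<rho> \<Longrightarrow> E y v \<le> (1 + e) * E x v"
proof -
  obtain m M where m: "0 < m" "\<And>x v. m * norm v \<le> E x v" using E_bounds by metis
  \<comment> \<open>After a lattice translation \<open>x\<close> has norm at most 2 and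
    \<open>y\<close> is within distance 1 of it, so radius 4 leaves room.\<close>
  define K where "K = cball (0 :: real^2) 4 \<times> sphere (0 :: real^2) 1"
  have "compact K" unfolding K_def by (intro compact_Times) auto
  moreover have "continuous_on K (\<lambda>(x, v). E x v)" using E_cont continuous_on_subset by blast
  ultimately have "uniformly_continuous_on K (\<lambda>(x, v). E x v)" using compact_uniformly_continuous by blast
  moreover have "e * m > 0" using assms m by simp
  ultimately obtain \<rho> where \<rho>: "\<rho> > 0"
    "\<And>z z'. z \<in> K \<Longrightarrow> z' \<in> K \<Longrightarrow> dist z' z < \<rho> \<Longrightarrow> dist ((\<lambda>(x, v). E x v) z') ((\<lambda>(x, v). E x v) z) < e * m"
    unfolding uniformly_continuous_on_def by metis
  show ?thesis
  proof
    show "min \<rho> 1 > 0" using \<rho> by simp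
    fix x y v :: "real^2" assume d: "dist x y < min \<rho> 1"
    show "E y v \<le> (1 + e) * E x v"
    proof (cases "v = 0")
      case False
      define u where "u = (1 / norm v) *\<^sub>R v"
      have u: "norm u = 1" "v = norm v *\<^sub>R u" using False by (auto simp: u_def)
      obtain h where h: "h \<in> Z2" "x - h \<in> cbox 0 1" by (rule Z2_floor)
      have nx: "norm (x - h) \<le> 2"
        using norm_le_l1_cart[of "x - h"] h(2) by (simp add: sum_2 mem_box_cart forall_2)
      have "norm (y - h) \<le> norm (x - h) + dist x y"
        using norm_triangle_ineq[of "x - h" "y - x"] by (simp add: dist_norm norm_minus_commute)
      then have K: "(x - h, u) \<in> K" "(y - h, u) \<in> K" using nx d u by (auto simp: K_def)
      have "dist (y - h, u) (x - h, u) = dist x y" by (simp add: dist_Pair_Pair dist_norm norm_minus_commute)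
      then have "\<bar>E (y - h) u - E (x - h) u\<bar> < e * m" using \<rho>(2)[OF K] d by (simp add: dist_real_def)
      moreover have "E (x - h) u = E x u" "E (y - h) u = E y u"
        using E_periodic[OF h(1), of "x - h" u] E_periodic[OF h(1), of "y - h" u] by simp_all
      moreover have "e * m \<le> e * E x u" using m(2)[of u x] u assms by (intro mult_left_mono) auto
      ultimately have "E y u \<le> (1 + e) * E x u" by (simp add: algebra_simps)
      then have "norm v * E y u \<le> norm v * ((1 + e) * E x u)" by (intro mult_left_mono) auto
      moreover have "E y v = norm v * E y u" "E x v = norm v * E x u"
        using E_scale[of y "norm v" u] E_scale[of x "norm v" u] u(2) by simp_all
      ultimately show ?thesis by (simp add: mult.left_commute)
    qed simp
  qed
qed

lemma B_scale_mono:
  assumes "c > 0" and le: "\<And>v. E y v \<le> c * E x v"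
  shows "measure lebesgue (B y) \<le> c\<^sup>2 * measure lebesgue (B x)"
proof -
  have "B y \<subseteq> (\<lambda>\<xi>. c *\<^sub>R \<xi>) ` B x"
  proof
    fix \<xi> assume "\<xi> \<in> B y"
    then have "\<xi> \<bullet> v \<le> c * E x v" for v using le[of v] by (auto simp: B_def intro: order_trans)
    then have "(1 / c) *\<^sub>R \<xi> \<in> B x" using assms(1) by (simp add: B_def field_simps)
    moreover have "\<xi> = c *\<^sub>R ((1 / c) *\<^sub>R \<xi>)" using assms(1) by simp
    ultimately show "\<xi> \<in> (\<lambda>\<xi>. c *\<^sub>R \<xi>) ` B x" by (rule rev_image_eqI)
  qed
  then have "measure lebesgue (B y) \<le> measure lebesgue ((\<lambda>\<xi>. c *\<^sub>R \<xi>) ` B x)"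
    using B_lmeasurable lmeasurable_compact[OF compact_scaling[OF B_compact]]
    by (intro measure_mono_fmeasurable) (auto simp: fmeasurableD)
  also have "\<dots> = c\<^sup>2 * measure lebesgue (B x)"
    using measure_lebesgue_affine[of c 0 "B x"] assms(1) by simp
  finally show ?thesis .
qed

text \<open>By \<open>E_uniform\<close>, dual balls at nearby points contain each other up to
  dilation by \<open>1 + d\<close>, so their areas differ by a factor of at most the square of
  \<open>1 + d\<close>.\<close>

lemma B_measure_continuous: "continuous_on UNIV (\<lambda>x. measure lebesgue (B x))"
proof -
  obtain R where R: "R > 0" "\<And>x. B x \<subseteq> cball 0 R" using B_bounded by metis
  define c where "c = measure lebesgue (cball (0 :: real^2) R)"
  have c: "measure lebesgue (B x) \<le> c" for x
    unfolding c_def using R B_lmeasurable by (intro measure_mono_fmeasurable) (auto simp: fmeasurableD)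
  show ?thesis
    unfolding continuous_on_iff
  proof (intro ballI allI impI)
    fix x :: "real^2" and e :: real assume e: "e > 0"
    \<comment> \<open>Areas are bounded by \<open>c\<close>, and for \<open>d \<le> 1\<close> the
      square of \<open>1 + d\<close> exceeds 1 by at most \<open>3 * d\<close>; so the change is at
      most \<open>3 * d * c\<close>, which is below \<open>e\<close>.\<close>
    define d where "d = min 1 (e / (4 * (c + 1)))"
    have c0: "c \<ge> 0" unfolding c_def by simp
    have "d \<le> e / (4 * (c + 1))" by (simp add: d_def)
    then have "d * (4 * (c + 1)) \<le> e"
      using c0 by (subst (asm) pos_le_divide_eq) auto
    then have d: "0 < d" "d \<le> 1" "d * (4 * (c + 1)) \<le> e"
      using e c0 by (auto simp: d_def)
    have dd: "((1 + d)\<^sup>2 - 1) * c < e"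
    proof -
      have "(1 + d)\<^sup>2 - 1 = d * (2 + d)" by (simp add: power2_eq_square algebra_simps)
      also have "\<dots> \<le> d * 3" using d by (intro mult_left_mono) auto
      finally have "((1 + d)\<^sup>2 - 1) * c \<le> d * 3 * c" using c0 by (rule mult_right_mono)
      also have "\<dots> < d * (4 * (c + 1))" using d c0 by (simp add: algebra_simps add_nonneg_pos)
      finally show ?thesis using d by linarith
    qed
    obtain \<rho> where \<rho>: "\<rho> > 0" "\<And>x y v. dist x y < \<rho> \<Longrightarrow> E y v \<le> (1 + d) * E x v"
      using E_uniform[OF d(1)] by blast
    show "\<exists>\<delta>>0. \<forall>x'\<in>UNIV. dist x' x < \<delta> \<longrightarrow> dist (measure lebesgue (B x')) (measure lebesgue (B x)) < e"
    proof (intro exI[of _ \<rho>] conjI ballI impI \<rho>(1))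
      fix y :: "real^2" assume "dist y x < \<rho>"
      then have "measure lebesgue (B y) \<le> (1 + d)\<^sup>2 * measure lebesgue (B x)"
        "measure lebesgue (B x) \<le> (1 + d)\<^sup>2 * measure lebesgue (B y)"
        using \<rho>(2) d by (auto intro!: B_scale_mono simp: dist_commute)
      moreover have "((1 + d)\<^sup>2 - 1) * measure lebesgue (B z) \<le> ((1 + d)\<^sup>2 - 1) * c" for z
        using c d by (intro mult_left_mono) auto
      ultimately show "dist (measure lebesgue (B y)) (measure lebesgue (B x)) < e"
        using dd by (simp add: dist_real_def algebra_simps abs_less_iff) (smt (verit))
    qed
  qed
qed

text \<open>Area minus \<open>hex\<close> is a continuous function on the compact set of triples in
  the dual balls over the unit square. Its minimum is attained, and it is positive by
  \<open>hex_less_measure\<close>.\<close>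

lemma hex_slack:
  obtains c where "c > 0"
    "\<And>x a b d. x \<in> cbox 0 1 \<Longrightarrow> a \<in> B x \<Longrightarrow> b \<in> B x \<Longrightarrow> d \<in> B x \<Longrightarrow> hex a b d + c \<le> measure lebesgue (B x)"
proof -
  obtain R where R: "R > 0" "\<And>x. B x \<subseteq> cball 0 R" using B_bounded by metis
  define S where "S = {(x, a, b, d). x \<in> cbox 0 1 \<and> a \<in> B x \<and> b \<in> B x \<and> d \<in> B x}"
  have "closed S"
  proof -
    have cl: "closed {z :: (real^2) \<times> (real^2) \<times> (real^2) \<times> (real^2). f z \<in> B (fst z)}" if "continuous_on UNIV f" for f
    proof -
      have "{z. f z \<in> B (fst z)} = (\<Inter>v. {z. f z \<bullet> v \<le> E (fst z) v})" by (auto simp: B_def)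
      then show ?thesis using that
        by (auto intro!: closed_INT closed_Collect_le continuous_intros)
    qed
    have "closed {z :: (real^2) \<times> (real^2) \<times> (real^2) \<times> (real^2). fst (snd z) \<in> B (fst z)}"
      "closed {z :: (real^2) \<times> (real^2) \<times> (real^2) \<times> (real^2). fst (snd (snd z)) \<in> B (fst z)}"
      "closed {z :: (real^2) \<times> (real^2) \<times> (real^2) \<times> (real^2). snd (snd (snd z)) \<in> B (fst z)}"
      by (rule cl, intro continuous_intros)+
    moreover have "closed {z :: (real^2) \<times> (real^2) \<times> (real^2) \<times> (real^2). fst z \<in> cbox 0 1}"
      using closed_vimage_fst[OF closed_cbox, of 0 1] by (simp add: vimage_def)
    ultimately have "closed ({z :: (real^2) \<times> (real^2) \<times> (real^2) \<times> (real^2). fst z \<in> cbox 0 1} \<inter>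
       {z. fst (snd z) \<in> B (fst z)} \<inter> {z. fst (snd (snd z)) \<in> B (fst z)} \<inter> {z. snd (snd (snd z)) \<in> B (fst z)})"
      by (intro closed_Int)
    also have "\<dots> = S" by (auto simp: S_def)
    finally show ?thesis .
  qed
  moreover have "S \<subseteq> cbox 0 1 \<times> cball 0 R \<times> cball 0 R \<times> cball 0 R" using R(2) by (auto simp: S_def)
  then have "bounded S" by (rule bounded_subset[rotated]) (intro bounded_Times bounded_cbox bounded_cball)
  ultimately have cS: "compact S" by (simp add: compact_eq_bounded_closed)
  have "(0, 0, 0, 0) \<in> S" by (simp add: S_def B_0 mem_box_cart)
  then have neS: "S \<noteq> {}" by blast
  define \<psi> where "\<psi> = (\<lambda>z :: (real^2) \<times> (real^2) \<times> (real^2) \<times> (real^2).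
    measure lebesgue (B (fst z)) - hex (fst (snd z)) (fst (snd (snd z))) (snd (snd (snd z))))"
  have "continuous_on S (\<lambda>z. measure lebesgue (B (fst z)))"
    by (rule continuous_on_compose2[OF B_measure_continuous]) (auto intro!: continuous_intros)
  then have "continuous_on S \<psi>"
    unfolding \<psi>_def hex_def cr_def by (intro continuous_intros)
  then obtain z0 where z0: "z0 \<in> S" "\<And>z. z \<in> S \<Longrightarrow> \<psi> z0 \<le> \<psi> z"
    using continuous_attains_inf[OF cS neS] by blast
  show ?thesis
  proof
    show "\<psi> z0 > 0" using z0(1) hex_less_measure by (auto simp: S_def \<psi>_def)
    fix x a b d assume "x \<in> cbox (0::real^2) 1" "a \<in> B x" "b \<in> B x" "d \<in> B x"
    then have "(x, a, b, d) \<in> S" by (simp add: S_def)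
    from z0(2)[OF this] show "hex a b d + \<psi> z0 \<le> measure lebesgue (B x)" by (simp add: \<psi>_def)
  qed
qed

end

section \<open>Piecewise linear paths and the stable norm\<close>

text \<open>On the triangle \<open>0 \<le> s \<le> t \<le> 1\<close> the map \<open>c t - c s - h\<close> would have a continuous logarithm.
  The two legs of the triangle differ by a point reflection, so they contribute the same odd multiple
  of \<open>\<i> \<pi>\<close>, while the hypotenuse, where the map is constant, forces their sum to vanish.\<close>

lemma half_chord:
  fixes c :: "real \<Rightarrow> real^2"
  assumes c: "continuous_on {0..1} c" and c1: "c 1 = c 0 + 2 *\<^sub>R h"
  obtains s t where "0 \<le> s" "s \<le> t" "t \<le> 1" "c t = c s + h"
proof -
  define z :: "real^2 \<Rightarrow> complex" where "z v = Complex (v $ 1) (v $ 2)" for v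
  have z0: "z v = 0 \<longleftrightarrow> v = 0" for v by (simp add: z_def complex_eq_iff vec_eq_iff forall_2)
  have zneg: "z (- v) = - z v" for v by (simp add: z_def complex_eq_iff)
  have zcont: "continuous_on S (\<lambda>x. z (f x))" if "continuous_on S f" for S and f :: "real \<times> real \<Rightarrow> real^2"
    unfolding z_def Complex_eq using that by (intro continuous_intros)
  define T where "T = {p :: real \<times> real. 0 \<le> fst p \<and> fst p \<le> snd p \<and> snd p \<le> 1}"
  \<comment> \<open>A zero of \<open>D\<close> is a chord equal to \<open>h\<close>; the plane is
    read as the complex numbers so that a zero-free \<open>D\<close> has a logarithm on the
    triangle.\<close>
  define D where "D p = z (c (snd p) - c (fst p) - h)" for p
  have "\<exists>p\<in>T. D p = 0"
  proof (rule ccontr)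
    assume "\<not> ?thesis"
    then have nz: "\<And>p. p \<in> T \<Longrightarrow> D p \<noteq> 0" by blast
    have cT: "continuous_on T (\<lambda>p. c (snd p))" "continuous_on T (\<lambda>p. c (fst p))"
      by (rule continuous_on_compose2[OF c]; auto simp: T_def intro!: continuous_intros)+
    have Dc: "continuous_on T D"
      unfolding D_def by (intro zcont continuous_intros cT)
    have "convex T"
    proof (rule convexI)
      fix p p' :: "real \<times> real" and u v :: real
      assume *: "p \<in> T" "p' \<in> T" "0 \<le> u" "0 \<le> v" "u + v = 1"
      have "0 \<le> u * fst p + v * fst p'" using * by (simp add: T_def)
      moreover have "u * fst p + v * fst p' \<le> u * snd p + v * snd p'"
        using * by (intro add_mono mult_left_mono) (auto simp: T_def)
      moreover have "u * snd p + v * snd p' \<le> u * 1 + v * 1"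
        using * by (intro add_mono mult_left_mono) (auto simp: T_def)
      ultimately show "u *\<^sub>R p + v *\<^sub>R p' \<in> T" using * by (simp add: T_def)
    qed
    then obtain g where g: "continuous_on T g" "\<And>p. p \<in> T \<Longrightarrow> D p = exp (g p)"
      using continuous_logarithm_on_contractible[OF Dc convex_imp_contractible nz] by metis
    have gc: "continuous_on {0..1} (\<lambda>x. g (f x))"
      if "continuous_on {0..1} f" "f ` {0..1} \<subseteq> T" for f :: "real \<Rightarrow> real \<times> real"
      using continuous_on_compose2[OF g(1) that] .
    \<comment> \<open>Logarithms of one number differ by integer multiples of
      \<open>2 * pi * \<i>\<close>, so a continuous choice along an interval cannot jump.\<close>
    have const: "f x = f y"
      if f: "continuous_on {0..1} f" and e: "\<And>x. x \<in> {0..1} \<Longrightarrow> exp (f x) = w" and xy: "x \<in> {0..1}" "y \<in> {0..1}"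
      for f :: "real \<Rightarrow> complex" and w x y
    proof -
      have "f constant_on {0..1}"
      proof (rule continuous_discrete_range_constant[OF _ f])
        show "\<exists>e>0. \<forall>y. y \<in> {0..1} \<and> f y \<noteq> f x \<longrightarrow> e \<le> cmod (f y - f x)" if x: "x \<in> {0..1}" for x
        proof (intro exI[of _ "2 * pi"] conjI allI impI)
          fix y assume y: "y \<in> {0..1} \<and> f y \<noteq> f x"
          then have "exp (f y) = exp (f x)" using e x by simp
          then obtain n :: int where n: "f y = f x + (of_int (2 * n) * pi) * \<i>" unfolding exp_eq by blast
          then have "n \<noteq> 0" using y by auto
          then have "1 \<le> \<bar>real_of_int n\<bar>" by linarith
          then have "2 * pi * 1 \<le> 2 * pi * \<bar>real_of_int n\<bar>" by (intro mult_left_mono) auto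
          moreover have "cmod (f y - f x) = 2 * pi * \<bar>real_of_int n\<bar>"
            unfolding n by (simp add: norm_mult)
          ultimately show "2 * pi \<le> cmod (f y - f x)" by simp
        qed simp
      qed (simp add: is_interval_connected_1 is_interval_cc)
      then show ?thesis using xy by (auto simp: constant_on_def)
    qed
    have diag: "g (1, 1) = g (0, 0)"
    proof (rule const[of "\<lambda>t. g (t, t)" "z (- h)" 1 0])
      show "continuous_on {0..1} (\<lambda>t. g (t, t))"
        by (rule gc) (auto simp: T_def intro!: continuous_intros)
      show "exp (g (x, x)) = z (- h)" if "x \<in> {0..1}" for x
        using g(2)[of "(x, x)"] that by (simp add: T_def D_def)
    qed auto
    have eleg: "exp (g (s, 1) - g (0, s)) = - 1" if "s \<in> {0..1}" for s
    proof -
      have "exp (g (s, 1)) = D (s, 1)" "exp (g (0, s)) = D (0, s)"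
        using g(2)[of "(s, 1)"] g(2)[of "(0, s)"] that by (auto simp: T_def)
      moreover have "D (s, 1) = - D (0, s)"
        unfolding D_def zneg[symmetric] by (simp add: c1 scaleR_2 algebra_simps)
      moreover have "D (0, s) \<noteq> 0" using nz[of "(0, s)"] that by (auto simp: T_def)
      ultimately show ?thesis by (simp add: exp_diff)
    qed
    have legs: "g (1, 1) - g (0, 1) = g (0, 1) - g (0, 0)"
    proof (rule const[of "\<lambda>s. g (s, 1) - g (0, s)" "- 1" 1 0])
      show "continuous_on {0..1} (\<lambda>s. g (s, 1) - g (0, s))"
        by (intro continuous_on_diff gc) (auto simp: T_def intro!: continuous_intros)
    qed (use eleg in auto)
    \<comment> \<open>The two equal increments along the legs add up to the zero increment along the
      diagonal, so each vanishes, although its exponential is -1.\<close>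
    then have "g (0, 1) = g (0, 0)" using diag by (simp add: algebra_simps)
    then show False using eleg[of 0] by simp
  qed
  then obtain p where p: "p \<in> T" "D p = 0" by blast
  then have "c (snd p) - c (fst p) - h = 0" using z0 unfolding D_def by blast
  then show ?thesis using p that[of "fst p" "snd p"] by (simp add: T_def algebra_simps)
qed

context finsler_torus
begin

text \<open>Polygonal paths together with their length, each segment run at constant velocity. The
  class is closed under cutting, joining, reversal and lattice translation and consists of piecewise
  smooth curves, so it serves both for the distance and for the final loops. Only the values of
  \<open>g\<close> on the interval matter.\<close>

inductive pwl :: "real \<Rightarrow> real \<Rightarrow> (real \<Rightarrow> real^2) \<Rightarrow> real \<Rightarrow> bool" where
  base: "a < b \<Longrightarrow> (\<And>t. t \<in> {a..b} \<Longrightarrow> g t = x + (t - a) *\<^sub>R v) \<Longrightarrow>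
    ((\<lambda>t. E (x + (t - a) *\<^sub>R v) v) has_integral L) {a..b} \<Longrightarrow> pwl a b g L"
| join: "pwl a b g L1 \<Longrightarrow> pwl b c g L2 \<Longrightarrow> pwl a c g (L1 + L2)"

lemma E_line_integrable: "(\<lambda>t. E (x + (t - a) *\<^sub>R v) v) integrable_on {c..d}"
  by (intro integrable_continuous_real continuous_intros)

lemma pwl_less: "pwl a b g L \<Longrightarrow> a < b"
  by (induction rule: pwl.induct) auto

lemma pwl_cong: "pwl a b g L \<Longrightarrow> (\<And>t. t \<in> {a..b} \<Longrightarrow> g' t = g t) \<Longrightarrow> pwl a b g' L"
proof (induction rule: pwl.induct)
  case (base a b g x v L)
  show ?case by (rule pwl.base[OF base.hyps(1) _ base.hyps(3)]) (simp add: base)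
next
  case (join a b g L1 c L2)
  then show ?case using pwl_less[OF join.hyps(1)] pwl_less[OF join.hyps(2)] by (intro pwl.join) auto
qed

lemma pwl_affine:
  "pwl a b g L \<Longrightarrow> k > 0 \<Longrightarrow> pwl ((a - c) / k) ((b - c) / k) (\<lambda>t. g (k * t + c)) L"
proof (induction rule: pwl.induct)
  case (base a b g x v L)
  show ?case
  proof (rule pwl.base[where x = x and v = "k *\<^sub>R v"])
    show "(a - c) / k < (b - c) / k" using base by (simp add: divide_strict_right_mono)
    show "g (k * t + c) = x + (t - (a - c) / k) *\<^sub>R k *\<^sub>R v" if "t \<in> {(a - c) / k..(b - c) / k}" for t
    proof -
      have "k * t + c \<in> {a..b}" using that base(4) by (simp add: field_simps)
      moreover have "(t - (a - c) / k) * k = k * t + c - a" using base(4) by (simp add: field_simps)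
      ultimately show ?thesis using base(2) by simp
    qed
    have "((\<lambda>t. E (x + (k * t + c - a) *\<^sub>R v) v) has_integral (L /\<^sub>R k)) {(a - c) / k..(b - c) / k}"
      using has_integral_affinity'[of "\<lambda>t. E (x + (t - a) *\<^sub>R v) v" L a b k c] base
      by (simp add: divide_inverse mult.commute)
    then have "((\<lambda>t. k * E (x + (k * t + c - a) *\<^sub>R v) v) has_integral (k * (L /\<^sub>R k))) {(a - c) / k..(b - c) / k}"
      by (rule has_integral_mult_right)
    moreover have "k * (L /\<^sub>R k) = L" using base(4) by simp
    moreover have "E (x + (t - (a - c) / k) *\<^sub>R k *\<^sub>R v) (k *\<^sub>R v) = k * E (x + (k * t + c - a) *\<^sub>R v) v" for t
    proof -
      have "(t - (a - c) / k) * k = k * t + c - a" using base(4) by (simp add: field_simps)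
      then have "(t - (a - c) / k) *\<^sub>R k *\<^sub>R v = (k * t + c - a) *\<^sub>R v" by (simp only: scaleR_scaleR)
      then show ?thesis using base(4) by (simp only: E_scale abs_of_pos)
    qed
    ultimately show "((\<lambda>t. E (x + (t - (a - c) / k) *\<^sub>R k *\<^sub>R v) (k *\<^sub>R v)) has_integral L) {(a - c) / k..(b - c) / k}"
      by (simp only:)
  qed
qed (blast intro: pwl.join)

lemma pwl_reverse: "pwl a b g L \<Longrightarrow> pwl (- b) (- a) (\<lambda>t. g (- t)) L"
proof (induction rule: pwl.induct)
  case (base a b g x v L)
  have eq: "x + (b - a) *\<^sub>R v + (t - - b) *\<^sub>R (- v) = x + (- t - a) *\<^sub>R v" for t
    by (simp add: algebra_simps)
  show ?case
  proof (rule pwl.base[where x = "x + (b - a) *\<^sub>R v" and v = "- v"])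
    show "g (- t) = x + (b - a) *\<^sub>R v + (t - - b) *\<^sub>R (- v)" if "t \<in> {- b..- a}" for t
      unfolding eq using that by (intro base(2)) auto
    have "((\<lambda>t. (\<lambda>t. E (x + (t - a) *\<^sub>R v) v) (- t)) has_integral L) {- b..- a}"
      by (rule has_integral_reflect_real[THEN iffD2, OF base(3)])
    then show "((\<lambda>t. E (x + (b - a) *\<^sub>R v + (t - - b) *\<^sub>R (- v)) (- v)) has_integral L) {- b..- a}"
      unfolding eq by simp
  qed (use base in simp)
next
  case (join a b g L1 c L2)
  then show ?case using pwl.join[of "- c" "- b" "\<lambda>t. g (- t)" L2 "- a" L1] by (simp add: add.commute)
qed

lemma pwl_translate: "pwl a b g L \<Longrightarrow> h \<in> Z2 \<Longrightarrow> pwl a b (\<lambda>t. g t + h) L"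
proof (induction rule: pwl.induct)
  case (base a b g x v L)
  have "E (x + h + (t - a) *\<^sub>R v) v = E (x + (t - a) *\<^sub>R v) v" for t
    using E_periodic[OF base(4), of "x + (t - a) *\<^sub>R v" v] by (simp add: add_ac)
  then show ?case using base by (intro pwl.base[where x = "x + h" and v = v]) (auto simp: add_ac)
qed (blast intro: pwl.join)

lemma pwl_continuous: "pwl a b g L \<Longrightarrow> continuous_on {a..b} g"
proof (induction rule: pwl.induct)
  case (base a b g x v L)
  have "continuous_on {a..b} (\<lambda>t. x + (t - a) *\<^sub>R v)" by (intro continuous_intros)
  then show ?case by (rule continuous_on_eq) (simp add: base)
next
  case (join a b g L1 c L2)
  have "{a..c} = {a..b} \<union> {b..c}" using pwl_less[OF join(1)] pwl_less[OF join(2)] by auto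
  then show ?case using join by (simp add: continuous_on_closed_Un)
qed

lemma pwl_lower:
  assumes "pwl a b g L" and m: "\<And>x v. m * norm v \<le> E x v" "m \<ge> 0"
  shows "m * norm (g b - g a) \<le> L"
  using assms(1)
proof (induction rule: pwl.induct)
  case (base a b g x v L)
  have "((\<lambda>t. m * norm v) has_integral (b - a) * (m * norm v)) {a..b}"
    using has_integral_const_real[of "m * norm v" a b] base(1) by simp
  from has_integral_le[OF this base(3)] have "(b - a) * (m * norm v) \<le> L" using m by simp
  then show ?case using base(1) base(2)[of a] base(2)[of b] by (simp add: mult.left_commute)
next
  case (join a b g L1 c L2)
  have "m * norm (g c - g a) \<le> m * (norm (g c - g b) + norm (g b - g a))"
    using norm_triangle_ineq[of "g c - g b" "g b - g a"] m(2) by (intro mult_left_mono) auto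
  then show ?case using join by (simp add: algebra_simps)
qed

lemma pwl_nonneg: "pwl a b g L \<Longrightarrow> 0 \<le> L"
proof (induction rule: pwl.induct)
  case (base a b g x v L)
  then show ?case using has_integral_nonneg E_nonneg by blast
qed auto

lemma pwl_split:
  "pwl a b g L \<Longrightarrow> a < s \<Longrightarrow> s < b \<Longrightarrow> \<exists>L1 L2. pwl a s g L1 \<and> pwl s b g L2 \<and> L = L1 + L2"
proof (induction rule: pwl.induct)
  case (base a b g x v L)
  obtain L1 where L1: "((\<lambda>t. E (x + (t - a) *\<^sub>R v) v) has_integral L1) {a..s}"
    using E_line_integrable by blast
  obtain L2 where L2: "((\<lambda>t. E (x + (t - a) *\<^sub>R v) v) has_integral L2) {s..b}"
    using E_line_integrable by blast
  have eq: "x + (s - a) *\<^sub>R v + (t - s) *\<^sub>R v = x + (t - a) *\<^sub>R v" for t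
    by (simp add: algebra_simps)
  have "((\<lambda>t. E (x + (t - a) *\<^sub>R v) v) has_integral L1 + L2) {a..b}"
    using base L1 L2 by (intro has_integral_combine[of a s b]) auto
  then have "L = L1 + L2" using base(3) has_integral_unique by blast
  moreover have "pwl a s g L1" using base L1 by (intro pwl.base[where x = x and v = v]) auto
  moreover have "pwl s b g L2"
    using base L2 by (intro pwl.base[where x = "x + (s - a) *\<^sub>R v" and v = v]) (auto simp: eq)
  ultimately show ?case by blast
next
  case (join a b g L1 c L2)
  consider "s < b" | "s = b" | "b < s" by linarith
  then show ?case
  proof cases
    case 1
    then obtain A B where "pwl a s g A" "pwl s b g B" "L1 = A + B" using join by blast
    then show ?thesis using pwl.join[OF _ join(2)] by (metis add.assoc)
  next
    case 2
    then show ?thesis using join by blast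
  next
    case 3
    then obtain A B where "pwl b s g A" "pwl s c g B" "L2 = A + B" using join by blast
    then show ?thesis using pwl.join[OF join(1)] by (metis add.assoc)
  qed
qed

section \<open>The distance of the lifted metric on the plane\<close>

definition conn :: "real^2 \<Rightarrow> real^2 \<Rightarrow> real \<Rightarrow> bool" where
  "conn x y L \<longleftrightarrow> (\<exists>g. pwl 0 1 g L \<and> g 0 = x \<and> g 1 = y)"

definition d :: "real^2 \<Rightarrow> real^2 \<Rightarrow> real" where
  "d x y = Inf {L. conn x y L}"

lemma pwl_conn: "pwl a b g L \<Longrightarrow> conn (g a) (g b) L"
proof -
  assume p: "pwl a b g L"
  have "pwl ((a - a) / (b - a)) ((b - a) / (b - a)) (\<lambda>t. g ((b - a) * t + a)) L"
    using pwl_less[OF p] by (intro pwl_affine p) auto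
  then have "pwl 0 1 (\<lambda>t. g ((b - a) * t + a)) L" using pwl_less[OF p] by simp
  then show ?thesis unfolding conn_def by (intro exI[of _ "\<lambda>t. g ((b - a) * t + a)"]) simp
qed

lemma conn_join:
  assumes "conn x y L" "conn y z L'"
  shows "conn x z (L + L')"
proof -
  obtain g where g: "pwl 0 1 g L" "g 0 = x" "g 1 = y" using assms(1) by (auto simp: conn_def)
  obtain g' where g': "pwl 0 1 g' L'" "g' 0 = y" "g' 1 = z" using assms(2) by (auto simp: conn_def)
  define k where "k t = (if t \<le> 1 then g t else g' (t - 1))" for t
  have "pwl 0 1 k L" by (rule pwl_cong[OF g(1)]) (simp add: k_def)
  moreover have "pwl 1 2 k L'"
  proof (rule pwl_cong)
    show "pwl 1 2 (\<lambda>t. g' (t - 1)) L'" using pwl_affine[OF g'(1), of 1 "-1"] by simp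
    show "k t = g' (t - 1)" if "t \<in> {1..2}" for t
      using that g(3) g'(2) by (cases "t = 1") (simp_all add: k_def)
  qed
  ultimately have "pwl 0 2 k (L + L')" by (rule pwl.join)
  from pwl_conn[OF this] show ?thesis using g g' by (simp add: k_def)
qed

lemma conn_segment: "conn x y (integral {0..1} (\<lambda>t. E (x + t *\<^sub>R (y - x)) (y - x)))"
proof -
  have "pwl 0 1 (\<lambda>t. x + t *\<^sub>R (y - x)) (integral {0..1} (\<lambda>t. E (x + t *\<^sub>R (y - x)) (y - x)))"
    using E_line_integrable[of x 0 "y - x" 0 1]
    by (intro pwl.base[where x = x and v = "y - x"]) (auto simp: integrable_integral)
  from pwl_conn[OF this] show ?thesis by simp
qed

lemma conn_refl: "conn x x 0"
  using conn_segment[of x x] by simp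

lemma conn_nonneg: "conn x y L \<Longrightarrow> 0 \<le> L"
  using pwl_nonneg by (auto simp: conn_def)

lemma conn_bdd: "bdd_below {L. conn x y L}"
  using conn_nonneg by (intro bdd_belowI[of _ 0]) auto

lemma d_le: "conn x y L \<Longrightarrow> d x y \<le> L"
  unfolding d_def by (intro cInf_lower conn_bdd) auto

lemma d_greatest: "(\<And>L. conn x y L \<Longrightarrow> c \<le> L) \<Longrightarrow> c \<le> d x y"
  unfolding d_def using conn_segment[of x y] by (intro cInf_greatest) auto

lemma d_approx: "d x y < c \<Longrightarrow> \<exists>L<c. conn x y L"
  using d_greatest[of x y c] by (meson linorder_not_le)

lemma d_nonneg: "0 \<le> d x y"
  by (intro d_greatest conn_nonneg)

lemma d_refl [simp]: "d x x = 0"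
  using d_le[OF conn_refl] d_nonneg by (simp add: order_antisym)

lemma d_triangle: "d x z \<le> d x y + d y z"
proof -
  have "d x z - L \<le> d y z" if "conn x y L" for L
    using d_le[OF conn_join[OF that]] by (intro d_greatest) (simp add: algebra_simps)
  then have "d x z - d y z \<le> d x y" by (intro d_greatest) (simp add: algebra_simps)
  then show ?thesis by simp
qed

lemma conn_sym: "conn x y L \<Longrightarrow> conn y x L"
proof -
  assume "conn x y L"
  then obtain g where g: "pwl 0 1 g L" "g 0 = x" "g 1 = y" by (auto simp: conn_def)
  from pwl_conn[OF pwl_reverse[OF g(1)]] g show ?thesis by simp
qed

lemma d_sym: "d x y = d y x"
proof -
  have "conn x y = conn y x" using conn_sym by blast
  then show ?thesis by (simp add: d_def)
qed

lemma conn_shift: "h \<in> Z2 \<Longrightarrow> conn x y L \<Longrightarrow> conn (x + h) (y + h) L"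
  unfolding conn_def using pwl_translate by blast

lemma d_shift: assumes h: "h \<in> Z2" shows "d (x + h) (y + h) = d x y"
proof -
  have "conn (x + h) (y + h) L \<longleftrightarrow> conn x y L" for L
    using conn_shift[OF h, of x y L] conn_shift[OF Z2_uminus[OF h], of "x + h" "y + h" L] by auto
  then show ?thesis by (simp add: d_def)
qed

lemma d_segment:
  assumes "\<And>t. t \<in> {0..1} \<Longrightarrow> E (x + t *\<^sub>R (y - x)) (y - x) \<le> c"
  shows "d x y \<le> c"
proof -
  have "integral {0..1} (\<lambda>t. E (x + t *\<^sub>R (y - x)) (y - x)) \<le> integral {0..1::real} (\<lambda>t. c)"
  proof (rule integral_le)
    show "(\<lambda>t. E (x + t *\<^sub>R (y - x)) (y - x)) integrable_on {0..1}"
      using E_line_integrable[of x 0 "y - x" 0 1] by simp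
  qed (use assms in auto)
  then show ?thesis using d_le[OF conn_segment[of x y]] by simp
qed

lemma d_lower:
  assumes "\<And>x v. m * norm v \<le> E x v" "m \<ge> 0"
  shows "m * norm (y - x) \<le> d x y"
  using pwl_lower[OF _ assms] by (intro d_greatest) (auto simp: conn_def)

text \<open>The path is cut at \<open>t\<close> and then at \<open>s\<close>; a cut at an end of the
  interval leaves a piece of distance 0.\<close>

lemma d_split:
  assumes p: "pwl 0 1 g L" and st: "0 \<le> s" "s \<le> t" "t \<le> 1"
  shows "d (g 0) (g s) + d (g s) (g t) + d (g t) (g 1) \<le> L"
proof -
  have 1: "d (g a) (g s) + d (g s) (g b) \<le> L" if ab: "pwl a b g L" "a \<le> s" "s \<le> b" for a b s L
  proof (cases "a < s \<and> s < b")
    case True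
    then obtain A B where "pwl a s g A" "pwl s b g B" "L = A + B" using pwl_split[OF ab(1)] by blast
    then show ?thesis using d_le[OF pwl_conn] by (meson add_mono)
  next
    case False
    then have "s = a \<or> s = b" using ab by auto
    then show ?thesis using d_le[OF pwl_conn[OF ab(1)]] by auto
  qed
  show ?thesis
  proof (cases "0 < t \<and> t < 1")
    case True
    then obtain A B where "pwl 0 t g A" "pwl t 1 g B" "L = A + B" using pwl_split[OF p] by blast
    then show ?thesis using 1[of 0 t A s] d_le[OF pwl_conn[of t 1 g B]] st by linarith
  next
    case False
    then have "t = 0 \<or> t = 1" using st by auto
    then show ?thesis using 1[OF p, of s] 1[OF p, of 0] st by auto
  qed
qed

section \<open>Lengths of loops and the stable norm\<close>

definition len :: "real^2 \<Rightarrow> real" where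
  "len h = (INF x. d x (x + h))"

lemma len_le: "len h \<le> d x (x + h)"
  unfolding len_def by (intro cINF_lower bdd_belowI2[of _ 0]) (auto simp: d_nonneg)

text \<open>Cut a path from \<open>x\<close> to \<open>x + 2 *\<^sub>R h\<close> at a chord equal to
  \<open>h\<close>. The middle piece is a loop of class \<open>h\<close>; translating the last piece
  by \<open>- h\<close> joins it to the first one, which gives another loop of class
  \<open>h\<close>.\<close>

lemma len_double:
  assumes h: "h \<in> Z2"
  shows "2 * len h \<le> len (2 *\<^sub>R h)"
  unfolding len_def[of "2 *\<^sub>R h"]
proof (intro cINF_greatest d_greatest)
  fix x L assume "conn x (x + 2 *\<^sub>R h) L"
  then obtain g where g: "pwl 0 1 g L" "g 0 = x" "g 1 = x + 2 *\<^sub>R h" by (auto simp: conn_def)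
  obtain s t where st: "0 \<le> s" "s \<le> t" "t \<le> 1" "g t = g s + h"
    using half_chord[OF pwl_continuous[OF g(1)]] g by metis
  have "d (g t) (g 1) = d (g s) (x + h)"
    using d_shift[OF h, of "g s" "x + h"] st g by (simp add: scaleR_2 add.assoc)
  then have "d x (g s) + d (g s) (g s + h) + d (g s) (x + h) \<le> L"
    using d_split[OF g(1) st(1-3)] st g by simp
  then show "2 * len h \<le> L"
    using len_le[of h "g s"] len_le[of h x] d_triangle[of x "x + h" "g s"] by linarith
qed simp

lemma pow2_Z2: "h \<in> Z2 \<Longrightarrow> (2 ^ k) *\<^sub>R h \<in> Z2"
  by (intro Z2_scale) auto

text \<open>The stable norm, with the limit taken along powers of 2 only: for lattice vectors these
  quotients are decreasing, so the limit exists, and halving by \<open>half_chord\<close> can be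
  iterated. Homogeneity for all integers is recovered in \<open>N_int\<close>.\<close>

definition N :: "real^2 \<Rightarrow> real" where
  "N h = lim (\<lambda>k. d 0 ((2 ^ k) *\<^sub>R h) / 2 ^ k)"

lemma N_decseq:
  assumes h: "h \<in> Z2"
  shows "decseq (\<lambda>k. d 0 ((2 ^ k) *\<^sub>R h) / 2 ^ k)"
proof (rule decseq_SucI)
  fix k
  define u where "u = (2 ^ k :: real) *\<^sub>R h"
  have u: "u \<in> Z2" unfolding u_def by (rule pow2_Z2[OF h])
  have "d 0 (u + u) \<le> d 0 u + d u (u + u)" by (rule d_triangle)
  also have "d u (u + u) = d 0 u" using d_shift[OF u, of 0 u] by simp
  finally have "d 0 ((2 ^ Suc k) *\<^sub>R h) \<le> 2 * d 0 ((2 ^ k) *\<^sub>R h)"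
    by (simp add: u_def flip: scaleR_add_left)
  then show "d 0 ((2 ^ Suc k) *\<^sub>R h) / 2 ^ Suc k \<le> d 0 ((2 ^ k) *\<^sub>R h) / 2 ^ k"
    by (simp add: field_simps)
qed

lemma N_lim:
  assumes h: "h \<in> Z2"
  shows "(\<lambda>k. d 0 ((2 ^ k) *\<^sub>R h) / 2 ^ k) \<longlonglongrightarrow> N h"
proof -
  obtain l where "(\<lambda>k. d 0 ((2 ^ k) *\<^sub>R h) / 2 ^ k) \<longlonglongrightarrow> l"
    using decseq_convergent[OF N_decseq[OF h], of 0] by (auto simp: d_nonneg)
  then show ?thesis unfolding N_def by (simp add: limI)
qed

lemma N_le: assumes h: "h \<in> Z2" shows "N h \<le> d 0 h"
  using decseq_ge[OF N_decseq[OF h] N_lim[OF h], of 0] by simp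

text \<open>Iterating \<open>len_double\<close> bounds \<open>2 ^ k * len h\<close> by the loop
  length of the multiple \<open>2 ^ k\<close> of \<open>h\<close>, hence by the distance from the
  origin to it; dividing by \<open>2 ^ k\<close> leads to the limit.\<close>

lemma len_le_N: assumes h: "h \<in> Z2" shows "len h \<le> N h"
proof (rule LIMSEQ_le_const[OF N_lim[OF h]], intro exI allI impI)
  fix k :: nat
  have "2 ^ k * len h \<le> len ((2 ^ k) *\<^sub>R h)"
  proof (induction k)
    case (Suc k)
    have "2 * (2 ^ k * len h) \<le> 2 * len ((2 ^ k) *\<^sub>R h)" using Suc by simp
    also have "\<dots> \<le> len (2 *\<^sub>R (2 ^ k) *\<^sub>R h)" by (rule len_double[OF pow2_Z2[OF h]])
    finally show ?case by (simp add: mult.assoc)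
  qed simp
  also have "\<dots> \<le> d 0 ((2 ^ k) *\<^sub>R h)" using len_le[of _ 0] by simp
  finally show "len h \<le> d 0 ((2 ^ k) *\<^sub>R h) / 2 ^ k" by (simp add: field_simps)
qed

lemma N_add: assumes h: "h \<in> Z2" "k \<in> Z2" shows "N (h + k) \<le> N h + N k"
proof (rule LIMSEQ_le[OF N_lim[OF Z2_add[OF h]] tendsto_add[OF N_lim[OF h(1)] N_lim[OF h(2)]]],
    intro exI allI impI)
  fix n :: nat
  define u v where "u = (2 ^ n :: real) *\<^sub>R h" and "v = (2 ^ n :: real) *\<^sub>R k"
  have "d 0 (u + v) \<le> d 0 u + d u (u + v)" by (rule d_triangle)
  also have "d u (u + v) = d 0 v" using d_shift[of u 0 v] pow2_Z2[OF h(1)] by (simp add: u_def add.commute)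
  finally show "d 0 ((2 ^ n) *\<^sub>R (h + k)) / 2 ^ n \<le> d 0 ((2 ^ n) *\<^sub>R h) / 2 ^ n + d 0 ((2 ^ n) *\<^sub>R k) / 2 ^ n"
    by (simp add: u_def v_def scaleR_add_right field_simps)
qed

lemma N_minus: assumes h: "h \<in> Z2" shows "N (- h) = N h"
proof -
  have "d 0 (- u) = d 0 u" if "u \<in> Z2" for u
    using d_shift[OF that, of 0 "- u"] d_sym by simp
  then show ?thesis using pow2_Z2[OF h] by (simp add: N_def)
qed

lemma N_lower:
  assumes m: "\<And>x v. m * norm v \<le> E x v" "m \<ge> 0" and h: "h \<in> Z2"
  shows "m * norm h \<le> N h"
proof (rule LIMSEQ_le_const[OF N_lim[OF h]], intro exI allI impI)
  fix k :: nat
  have "m * norm ((2 ^ k) *\<^sub>R h) \<le> d 0 ((2 ^ k) *\<^sub>R h)" using d_lower[OF m, where x = 0 and y = "(2 ^ k) *\<^sub>R h"] by simp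
  then show "m * norm h \<le> d 0 ((2 ^ k) *\<^sub>R h) / 2 ^ k" by (simp add: field_simps)
qed

lemma N_nonneg: "h \<in> Z2 \<Longrightarrow> 0 \<le> N h"
  using N_lower[of 0 h] E_nonneg by simp

lemma N_0: "N 0 = 0"
  by (simp add: N_def)

lemma N_pos: assumes "h \<in> Z2" "h \<noteq> 0" shows "0 < N h"
proof -
  obtain m M where m: "0 < m" "\<And>x v. m * norm v \<le> E x v" using E_bounds by metis
  have "0 < m * norm h" using m assms by simp
  also have "\<dots> \<le> N h" using m assms by (intro N_lower) auto
  finally show ?thesis .
qed

lemma N_double: assumes h: "h \<in> Z2" shows "N (2 *\<^sub>R h) = 2 * N h"
proof -
  have "(\<lambda>k. 2 * (d 0 ((2 ^ Suc k) *\<^sub>R h) / 2 ^ Suc k)) \<longlonglongrightarrow> 2 * N h"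
    by (intro tendsto_mult tendsto_const LIMSEQ_Suc N_lim[OF h])
  then have "(\<lambda>k. d 0 ((2 ^ k) *\<^sub>R 2 *\<^sub>R h) / 2 ^ k) \<longlonglongrightarrow> 2 * N h"
    by (simp add: mult.commute)
  moreover have "2 *\<^sub>R h \<in> Z2" using pow2_Z2[OF h, of 1] by simp
  ultimately show ?thesis using N_lim LIMSEQ_unique by blast
qed

text \<open>One inequality is subadditivity. For the other, \<open>2 ^ n\<close> is split as
  \<open>n + (2 ^ n - n)\<close>: homogeneity is known for powers of 2, and the second summand is
  bounded from above by the first inequality.\<close>

lemma N_nat: assumes h: "h \<in> Z2" shows "N (real n *\<^sub>R h) = real n * N h"
proof -
  have Z: "real n *\<^sub>R h \<in> Z2" for n using h by (intro Z2_scale) auto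
  have le: "N (real n *\<^sub>R h) \<le> real n * N h" for n
  proof (induction n)
    case (Suc n)
    have "N (real (Suc n) *\<^sub>R h) \<le> N (real n *\<^sub>R h) + N h"
      using N_add[OF Z[of n] h] by (simp add: algebra_simps)
    then show ?case using Suc by (simp add: algebra_simps)
  qed (simp add: N_0)
  have pow: "N ((2 ^ k) *\<^sub>R h) = 2 ^ k * N h" for k
  proof (induction k)
    case (Suc k)
    then show ?case using N_double[OF pow2_Z2[OF h, of k]] by simp
  qed simp
  have "n \<le> 2 ^ n" by (simp add: less_imp_le)
  have "2 ^ n * N h = N (real n *\<^sub>R h + real (2 ^ n - n) *\<^sub>R h)"
    using pow[of n] \<open>n \<le> 2 ^ n\<close> by (simp add: of_nat_diff flip: scaleR_add_left)
  also have "\<dots> \<le> N (real n *\<^sub>R h) + N (real (2 ^ n - n) *\<^sub>R h)" by (intro N_add Z)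
  also have "\<dots> \<le> N (real n *\<^sub>R h) + real (2 ^ n - n) * N h" using le[of "2 ^ n - n"] by (intro add_left_mono)
  finally have "real n * N h \<le> N (real n *\<^sub>R h)"
    using \<open>n \<le> 2 ^ n\<close> by (simp add: of_nat_diff algebra_simps)
  then show ?thesis using le[of n] by simp
qed

lemma N_int: assumes h: "h \<in> Z2" shows "N (of_int n *\<^sub>R h) = \<bar>of_int n\<bar> * N h"
proof (cases n rule: int_cases2)
  case (nonneg k)
  then show ?thesis using N_nat[OF h, of k] by simp
next
  case (nonpos k)
  then show ?thesis using N_nat[OF h, of k] N_minus[of "real k *\<^sub>R h"] Z2_scale[OF h, of "real k"] by simp
qed

end

section \<open>Smoothing of calibrating functions\<close>

lemma average_derivative:
  fixes k :: "real \<Rightarrow> real"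
  assumes k: "continuous_on UNIV k" and \<delta>: "\<delta> > 0"
  shows "((\<lambda>a. integral {0..\<delta>} (\<lambda>s. k (a + s))) has_real_derivative k (a + \<delta>) - k a) (at a)"
proof -
  have kS: "continuous_on S k" for S using k continuous_on_subset by blast
  have int: "k integrable_on {x..y}" for x y by (intro integrable_continuous_real kS)
  define c where "c = a - 1"
  define \<Psi> where "\<Psi> x = integral {c..x} k" for x
  have shift: "integral {0..\<delta>} (\<lambda>s. k (x + s)) = \<Psi> (x + \<delta>) - \<Psi> x" if "c < x" for x
  proof -
    have "(k has_integral integral {x..x + \<delta>} k) {x..x + \<delta>}" using int integrable_integral by blast
    from has_integral_affinity'[of k _ x "x + \<delta>" 1 x] this
    have "((\<lambda>s. k (x + s)) has_integral integral {x..x + \<delta>} k) {0..\<delta>}" by (simp add: add.commute)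
    then have "integral {0..\<delta>} (\<lambda>s. k (x + s)) = integral {x..x + \<delta>} k" by (rule integral_unique)
    moreover have "integral {c..x} k + integral {x..x + \<delta>} k = integral {c..x + \<delta>} k"
      using that \<delta> int by (intro Henstock_Kurzweil_Integration.integral_combine) auto
    ultimately show ?thesis by (simp add: \<Psi>_def)
  qed
  have \<Psi>': "(\<Psi> has_real_derivative k x) (at x)" if "c < x" for x
  proof -
    have "((\<lambda>y. integral {c..y} k) has_real_derivative k x) (at x within {c..x + 1})"
      by (rule integral_has_real_derivative[OF kS]) (use that in auto)
    moreover have "at x within {c..x + 1} = at x" using that by (intro at_within_interior) simp
    ultimately show ?thesis unfolding \<Psi>_def[abs_def] by (simp only:)
  qed
  have "((\<lambda>x. \<Psi> (x + \<delta>) - \<Psi> x) has_real_derivative k (a + \<delta>) - k a) (at a)"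
  proof (rule DERIV_diff)
    have "(\<Psi> has_real_derivative k (a + \<delta>)) (at (a + \<delta>))" by (rule \<Psi>') (use \<delta> in \<open>simp add: c_def\<close>)
    then show "((\<lambda>x. \<Psi> (x + \<delta>)) has_real_derivative k (a + \<delta>)) (at a)" by (simp only: DERIV_shift)
  qed (rule \<Psi>', simp add: c_def)
  then show ?thesis
    by (rule has_field_derivative_transform_within_open[of _ _ _ "{c<..}"]) (auto simp: shift c_def)
qed

lemma has_derivative_vector2:
  fixes G Gx Gy :: "real \<Rightarrow> real \<Rightarrow> real"
  assumes Gx: "\<And>a b. ((\<lambda>a. G a b) has_real_derivative Gx a b) (at a)"
    and Gy: "\<And>a b. ((\<lambda>b. G a b) has_real_derivative Gy a b) (at b)"
    and c2: "continuous_on UNIV (\<lambda>(a, b). Gy a b)"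
  shows "((\<lambda>x :: real^2. G (x $ 1) (x $ 2)) has_derivative
           (\<lambda>v. vector [Gx (x $ 1) (x $ 2), Gy (x $ 1) (x $ 2)] \<bullet> v)) (at x)"
proof -
  define a b where "a = x $ 1" and "b = x $ 2"
  have "((\<lambda>(a, b). G a b) has_derivative (\<lambda>(ta, tb). Gx a b * ta + blinfun_apply (blinfun_mult_right (Gy a b)) tb))
      (at (a, b) within UNIV \<times> UNIV)"
  proof (rule has_derivative_partialsI)
    show "((\<lambda>a. G a b) has_derivative (*) (Gx a b)) (at a)"
      using Gx by (simp add: has_field_derivative_def)
    show "((\<lambda>b. G a b) has_derivative blinfun_apply (blinfun_mult_right (Gy a b))) (at b)" for a b
      using Gy by (simp add: has_field_derivative_def blinfun_mult_right.rep_eq)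
    have "isCont (\<lambda>(a, b). Gy a b) (a, b)" using c2 by (simp add: continuous_on_eq_continuous_at)
    from bounded_linear.isCont[OF bounded_linear_blinfun_mult_right this]
    have "isCont (\<lambda>x. blinfun_mult_right (case x of (a, b) \<Rightarrow> Gy a b)) (a, b)" .
    moreover have "(\<lambda>x. blinfun_mult_right (case x of (a, b) \<Rightarrow> Gy a b)) = (\<lambda>(a, b). blinfun_mult_right (Gy a b))"
      by (auto simp: fun_eq_iff)
    ultimately show "continuous (at (a, b) within UNIV \<times> UNIV) (\<lambda>(a, b). blinfun_mult_right (Gy a b))"
      by simp
  qed auto
  then have D: "((\<lambda>p. G (fst p) (snd p)) has_derivative (\<lambda>p. Gx a b * fst p + Gy a b * snd p)) (at (a, b))"
    unfolding case_prod_unfold blinfun_mult_right.rep_eq by simp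
  have P: "((\<lambda>x :: real^2. (x $ 1, x $ 2)) has_derivative (\<lambda>x. (x $ 1, x $ 2))) (at x)"
    by (intro has_derivative_Pair bounded_linear_imp_has_derivative bounded_linear_vec_nth)
  have "((\<lambda>x. G (fst (x $ 1, x $ 2)) (snd (x $ 1, x $ 2))) has_derivative
      (\<lambda>v. Gx a b * fst (v $ 1, v $ 2) + Gy a b * snd (v $ 1, v $ 2))) (at x)"
    by (rule has_derivative_compose[OF P]) (use D in \<open>simp add: a_def b_def\<close>)
  then show ?thesis by (simp add: inner_2 a_def b_def)
qed

text \<open>The average over the square of side \<open>\<delta>\<close> with lower left corner
  \<open>x\<close>. A box instead of a smooth kernel gives explicit derivatives as differences of
  averages, and just enough regularity for the degree formula.\<close>

definition box_avg :: "real \<Rightarrow> (real^2 \<Rightarrow> real) \<Rightarrow> real^2 \<Rightarrow> real" where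
  "box_avg \<delta> f x = (1 / \<delta>\<^sup>2) * integral {0..\<delta>} (\<lambda>s. integral {0..\<delta>} (\<lambda>t. f (x + vector [s, t])))"

lemma continuous_param_integral:
  fixes f :: "'a::metric_space \<Rightarrow> real \<Rightarrow> real"
  assumes "continuous_on UNIV (\<lambda>(x, t). f x t)"
  shows "continuous_on S (\<lambda>x. integral {0..\<delta>} (f x))"
proof -
  have "continuous_on (S \<times> cbox 0 \<delta>) (\<lambda>(x, t). f x t)"
    using assms continuous_on_subset by blast
  from integral_continuous_on_param[OF this] show ?thesis by simp
qed

text \<open>The sign of \<open>c\<close> is free: a shift of \<open>f\<close> by a constant passes
  to the averages as two such inequalities, a Lipschitz bound as one.\<close>

lemma box_avg_le:
  assumes f: "continuous_on UNIV f" and \<delta>: "\<delta> > 0"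
    and le: "\<And>s t. s \<in> {0..\<delta>} \<Longrightarrow> t \<in> {0..\<delta>} \<Longrightarrow> f (x + vector [s, t]) \<le> f (y + vector [s, t]) + c"
  shows "box_avg \<delta> f x \<le> box_avg \<delta> f y + c"
proof -
  have c1: "continuous_on S (\<lambda>t. f (z + vector [s, t]))" for z s S
    by (rule continuous_on_compose2[OF f]) (auto intro!: continuous_intros)
  have c2: "continuous_on S (\<lambda>s. integral {0..\<delta>} (\<lambda>t. f (z + vector [s, t])))" for z S
    by (rule continuous_param_integral, unfold split_beta, rule continuous_on_compose2[OF f])
      (auto intro!: continuous_intros)
  have "integral {0..\<delta>} (\<lambda>s. integral {0..\<delta>} (\<lambda>t. f (x + vector [s, t]))) \<le>
      integral {0..\<delta>} (\<lambda>s. integral {0..\<delta>} (\<lambda>t. f (y + vector [s, t])) + \<delta> * c)"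
  proof (rule integral_le)
    fix s assume s: "s \<in> {0..\<delta>}"
    have "integral {0..\<delta>} (\<lambda>t. f (x + vector [s, t])) \<le> integral {0..\<delta>} (\<lambda>t. f (y + vector [s, t]) + c)"
      by (intro integral_le integrable_continuous_real continuous_intros c1 le s)
    also have "\<dots> = integral {0..\<delta>} (\<lambda>t. f (y + vector [s, t])) + \<delta> * c"
      using \<delta> by (subst integral_add) (auto intro!: integrable_continuous_real c1)
    finally show "integral {0..\<delta>} (\<lambda>t. f (x + vector [s, t])) \<le> integral {0..\<delta>} (\<lambda>t. f (y + vector [s, t])) + \<delta> * c" .
  qed (intro integrable_continuous_real continuous_intros c2)+
  also have "\<dots> = integral {0..\<delta>} (\<lambda>s. integral {0..\<delta>} (\<lambda>t. f (y + vector [s, t]))) + \<delta> * (\<delta> * c)"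
    using \<delta> by (subst integral_add) (auto intro!: integrable_continuous_real c2)
  finally have le': "integral {0..\<delta>} (\<lambda>s. integral {0..\<delta>} (\<lambda>t. f (x + vector [s, t]))) \<le>
    integral {0..\<delta>} (\<lambda>s. integral {0..\<delta>} (\<lambda>t. f (y + vector [s, t]))) + \<delta>\<^sup>2 * c"
    by (simp add: power2_eq_square mult.assoc)
  have "(1 / \<delta>\<^sup>2) * integral {0..\<delta>} (\<lambda>s. integral {0..\<delta>} (\<lambda>t. f (x + vector [s, t]))) \<le>
    (1 / \<delta>\<^sup>2) * (integral {0..\<delta>} (\<lambda>s. integral {0..\<delta>} (\<lambda>t. f (y + vector [s, t]))) + \<delta>\<^sup>2 * c)"
    by (intro mult_left_mono le') simp
  then show ?thesis using \<delta> by (simp add: box_avg_def distrib_left)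
qed

text \<open>Differentiating an average over an interval leaves a difference of end values. Applied
  to each variable, this makes the first derivatives differences of one-dimensional averages and the
  mixed derivative a second difference of \<open>f\<close> at the corners of the square.\<close>

lemma box_avg_C1:
  fixes f :: "real^2 \<Rightarrow> real"
  assumes f: "continuous_on UNIV f" and \<delta>: "\<delta> > 0"
  obtains g' m where "\<And>x. (box_avg \<delta> f has_derivative (\<lambda>v. g' x \<bullet> v)) (at x)"
    "continuous_on UNIV g'" "continuous_on UNIV (m :: real^2 \<Rightarrow> real)"
    "\<And>a b. ((\<lambda>s. g' (vector [s, b]) $ 2) has_real_derivative m (vector [a, b])) (at a)"
proof -
  define \<phi> where "\<phi> s t = f (vector [s, t])" for s t
  have \<phi>c: "continuous_on S (\<lambda>x. \<phi> (u x) (v x))" if "continuous_on S u" "continuous_on S v"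
    for S :: "'a::topological_space set" and u v
    unfolding \<phi>_def by (rule continuous_on_compose2[OF f]) (auto intro!: continuous_intros that)
  define K where "K a b = integral {0..\<delta>} (\<lambda>t. \<phi> a (b + t))" for a b
  define J where "J a b = integral {0..\<delta>} (\<lambda>s. \<phi> (a + s) b)" for a b
  define G where "G a b = integral {0..\<delta>} (\<lambda>s. K (a + s) b)" for a b
  have Kc: "continuous_on S (\<lambda>p. K (fst p) (snd p))" for S
    unfolding K_def by (rule continuous_param_integral) (auto simp: split_beta intro!: \<phi>c continuous_intros)
  have Jc: "continuous_on S (\<lambda>p. J (fst p) (snd p))" for S
    unfolding J_def by (rule continuous_param_integral) (auto simp: split_beta intro!: \<phi>c continuous_intros)
  have Kc': "continuous_on S (\<lambda>x. K (u x) (v x))" and Jc': "continuous_on S (\<lambda>x. J (u x) (v x))"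
    if "continuous_on S u" "continuous_on S v" for S :: "'a::topological_space set" and u v
    using continuous_on_compose2[OF Kc[of UNIV], of S "\<lambda>x. (u x, v x)"]
      continuous_on_compose2[OF Jc[of UNIV], of S "\<lambda>x. (u x, v x)"] that
    by (simp_all add: continuous_on_Pair)
  \<comment> \<open>With the order of integration exchanged, the average in the second variable is
    outermost and can be differentiated.\<close>
  have GJ: "G a b = integral {0..\<delta>} (\<lambda>t. J a (b + t))" for a b
  proof -
    have "continuous_on (cbox (0, 0) (\<delta>, \<delta>)) (\<lambda>(s, t). \<phi> (a + s) (b + t))"
      unfolding case_prod_unfold by (intro \<phi>c continuous_intros)
    from integral_swap_continuous[OF this] show ?thesis
      unfolding G_def K_def J_def by simp
  qed
  have G1: "((\<lambda>a. G a b) has_real_derivative K (a + \<delta>) b - K a b) (at a)" for a b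
    unfolding G_def by (rule average_derivative[OF _ \<delta>]) (intro Kc' continuous_intros)
  have G2: "((\<lambda>b. G a b) has_real_derivative J a (b + \<delta>) - J a b) (at b)" for a b
    unfolding GJ by (rule average_derivative[OF _ \<delta>]) (intro Jc' continuous_intros)
  have J1: "((\<lambda>a. J a b) has_real_derivative \<phi> (a + \<delta>) b - \<phi> a b) (at a)" for a b
    unfolding J_def by (rule average_derivative[OF _ \<delta>]) (intro \<phi>c continuous_intros)
  define g' :: "real^2 \<Rightarrow> real^2" where
    "g' x = vector [(1 / \<delta>\<^sup>2) * (K (x $ 1 + \<delta>) (x $ 2) - K (x $ 1) (x $ 2)),
       (1 / \<delta>\<^sup>2) * (J (x $ 1) (x $ 2 + \<delta>) - J (x $ 1) (x $ 2))]" for x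
  define m :: "real^2 \<Rightarrow> real" where
    "m x = (1 / \<delta>\<^sup>2) * ((\<phi> (x $ 1 + \<delta>) (x $ 2 + \<delta>) - \<phi> (x $ 1) (x $ 2 + \<delta>))
       - (\<phi> (x $ 1 + \<delta>) (x $ 2) - \<phi> (x $ 1) (x $ 2)))" for x
  have avg: "box_avg \<delta> f = (\<lambda>x. (1 / \<delta>\<^sup>2) * G (x $ 1) (x $ 2))"
  proof
    fix x :: "real^2"
    have "x + vector [s, t] = vector [x $ 1 + s, x $ 2 + t]" for s t
      by (simp add: vec_eq_iff forall_2)
    then show "box_avg \<delta> f x = (1 / \<delta>\<^sup>2) * G (x $ 1) (x $ 2)"
      by (simp add: box_avg_def G_def K_def \<phi>_def)
  qed
  show ?thesis
  proof
    show "(box_avg \<delta> f has_derivative (\<lambda>v. g' x \<bullet> v)) (at x)" for x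
      unfolding avg g'_def
      by (rule has_derivative_vector2[where G = "\<lambda>a b. (1 / \<delta>\<^sup>2) * G a b" and
            Gx = "\<lambda>a b. (1 / \<delta>\<^sup>2) * (K (a + \<delta>) b - K a b)" and Gy = "\<lambda>a b. (1 / \<delta>\<^sup>2) * (J a (b + \<delta>) - J a b)"])
        (unfold split_beta, intro DERIV_cmult G1, intro DERIV_cmult G2, intro continuous_intros Jc')
    show "continuous_on UNIV g'" "continuous_on UNIV m"
      unfolding g'_def m_def by (intro continuous_intros Kc' Jc' \<phi>c)+
    show "((\<lambda>s. g' (vector [s, b]) $ 2) has_real_derivative m (vector [a, b])) (at a)" for a b
      unfolding g'_def m_def vector_2 by (intro DERIV_cmult DERIV_diff J1)
  qed
qed

context finsler_torus
begin

text \<open>Averaging commutes with translations, so the periods are kept. Along a short step from a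
  point within \<open>\<rho>\<close> of \<open>x\<close> the metric exceeds the one at
  \<open>x\<close> by a factor of at most \<open>1 + e\<close>, so every translate of
  \<open>f\<close> that enters the average obeys the same Lipschitz bound.\<close>

lemma mollify:
  fixes f :: "real^2 \<Rightarrow> real"
  assumes per: "\<And>x h. h \<in> Z2 \<Longrightarrow> f (x + h) = f x + a \<bullet> h"
    and lip: "\<And>x y. f y \<le> f x + d x y" and e: "e > 0"
  obtains g g' m where "\<And>x. (g has_derivative (\<lambda>v. g' x \<bullet> v)) (at x)"
    "continuous_on UNIV g'" "continuous_on UNIV (m :: real^2 \<Rightarrow> real)"
    "\<And>a b. ((\<lambda>s. g' (vector [s, b]) $ 2) has_real_derivative m (vector [a, b])) (at a)"
    "\<And>x i. g (x + axis i 1) = g x + a $ i"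
    "\<And>x v. g' x \<bullet> v \<le> (1 + e) * E x v"
proof -
  obtain m0 M where M: "0 < M" "\<And>x v. E x v \<le> M * norm v" using E_bounds by metis
  have lipn: "f y \<le> f x + M * norm (y - x)" for x y
    using lip[of y x] d_segment[of x y "M * norm (y - x)"] M(2) by fastforce
  have fc: "continuous_on UNIV f"
    unfolding continuous_on_iff
  proof (intro ballI allI impI)
    fix x :: "real^2" and r :: real assume r: "r > 0"
    show "\<exists>\<delta>>0. \<forall>y\<in>UNIV. dist y x < \<delta> \<longrightarrow> dist (f y) (f x) < r"
    proof (intro exI[of _ "r / M"] conjI ballI impI)
      fix y assume "dist y x < r / M"
      then have "M * norm (y - x) < r" using M(1) by (simp add: dist_norm pos_less_divide_eq mult.commute)
      then show "dist (f y) (f x) < r"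
        using lipn[of y x] lipn[of x y] by (auto simp: dist_real_def norm_minus_commute)
    qed (use r M in simp)
  qed
  obtain \<rho> where \<rho>: "\<rho> > 0" "\<And>x y v. dist x y < \<rho> \<Longrightarrow> E y v \<le> (1 + e) * E x v"
    using E_uniform[OF e] by blast
  \<comment> \<open>Shifts in the square of side \<open>\<rho> / 4\<close> have norm at most
    \<open>\<rho> / 2\<close>; the other half of \<open>\<rho>\<close> is left for the step
    \<open>\<tau> *\<^sub>R v\<close> of the difference quotient.\<close>
  define \<delta> where "\<delta> = \<rho> / 4"
  have \<delta>: "\<delta> > 0" using \<rho> by (simp add: \<delta>_def)
  obtain g' m where g': "\<And>x. (box_avg \<delta> f has_derivative (\<lambda>v. g' x \<bullet> v)) (at x)"
    "continuous_on UNIV g'" "continuous_on UNIV (m :: real^2 \<Rightarrow> real)"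
    "\<And>a b. ((\<lambda>s. g' (vector [s, b]) $ 2) has_real_derivative m (vector [a, b])) (at a)"
    using box_avg_C1[OF fc \<delta>] by blast
  have equi: "box_avg \<delta> f (x + axis i 1) = box_avg \<delta> f x + a $ i" for x i
  proof -
    have 1: "f (x + axis i 1 + w) = f (x + w) + a $ i" for w
      using per[OF Z2_axis, of "x + w" i] by (simp add: inner_axis add_ac)
    have "box_avg \<delta> f (x + axis i 1) \<le> box_avg \<delta> f x + a $ i"
      by (rule box_avg_le[OF fc \<delta>]) (simp add: 1)
    moreover have "box_avg \<delta> f x \<le> box_avg \<delta> f (x + axis i 1) + - (a $ i)"
      by (rule box_avg_le[OF fc \<delta>]) (simp add: 1)
    ultimately show ?thesis by simp
  qed
  have bound: "g' x \<bullet> v \<le> (1 + e) * E x v" for x v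
  proof -
    have L: "((\<lambda>\<tau>. x + \<tau> *\<^sub>R v) has_derivative (\<lambda>h. h *\<^sub>R v)) (at (0::real))"
      by (auto intro!: derivative_eq_intros)
    have "((\<lambda>\<tau>. box_avg \<delta> f (x + \<tau> *\<^sub>R v)) has_derivative (\<lambda>h. g' x \<bullet> (h *\<^sub>R v))) (at 0)"
      by (rule has_derivative_compose[OF L]) (use g'(1)[of x] in simp)
    then have "((\<lambda>\<tau>. box_avg \<delta> f (x + \<tau> *\<^sub>R v)) has_real_derivative g' x \<bullet> v) (at 0)"
      by (simp add: has_field_derivative_def mult_commute_abs)
    then have "((\<lambda>\<tau>. (box_avg \<delta> f (x + \<tau> *\<^sub>R v) - box_avg \<delta> f x) / \<tau>) \<longlongrightarrow> g' x \<bullet> v) (at_right 0)"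
      by (simp add: has_field_derivative_iff filterlim_at_split)
    then show ?thesis
    proof (rule tendsto_upperbound)
      have ev: "\<forall>\<^sub>F \<tau> in at_right 0. \<tau> \<in> {0<..<\<rho> / (2 * (norm v + 1))}"
        using \<rho>(1) by (intro eventually_at_right_real) (auto intro!: divide_pos_pos add_nonneg_pos)
      show "\<forall>\<^sub>F \<tau> in at_right 0. (box_avg \<delta> f (x + \<tau> *\<^sub>R v) - box_avg \<delta> f x) / \<tau> \<le> (1 + e) * E x v"
        using ev
      proof eventually_elim
        case (elim \<tau>)
        then have \<tau>: "\<tau> > 0" "\<tau> * (2 * (norm v + 1)) < \<rho>"
          by (auto simp: pos_less_divide_eq add_nonneg_pos)
        have tv: "2 * (\<tau> * norm v) < \<rho>" using \<tau> by (simp add: algebra_simps)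
        have "box_avg \<delta> f (x + \<tau> *\<^sub>R v) \<le> box_avg \<delta> f x + \<tau> * ((1 + e) * E x v)"
        proof (rule box_avg_le[OF fc \<delta>])
          fix s t assume st: "s \<in> {0..\<delta>}" "t \<in> {0..\<delta>}"
          define w :: "real^2" where "w = vector [s, t]"
          have w: "norm w \<le> \<rho> / 2"
            using norm_le_l1_cart[of w] st by (simp add: sum_2 w_def \<delta>_def)
          have "d (x + w) (x + w + \<tau> *\<^sub>R v) \<le> \<tau> * ((1 + e) * E x v)"
          proof (rule d_segment)
            fix r :: real assume r: "r \<in> {0..1}"
            have "norm (r *\<^sub>R \<tau> *\<^sub>R v) \<le> \<tau> * norm v"
              using r \<tau>(1) by (simp add: mult_left_le_one_le)
            then have "norm (w + r *\<^sub>R \<tau> *\<^sub>R v) < \<rho>"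
              using norm_triangle_ineq[of w "r *\<^sub>R \<tau> *\<^sub>R v"] w tv by linarith
            then have "dist x (x + w + r *\<^sub>R \<tau> *\<^sub>R v) < \<rho>"
            proof -
              have "dist x (x + u) = norm u" for u by (simp add: dist_norm)
              then show ?thesis using \<open>norm (w + r *\<^sub>R \<tau> *\<^sub>R v) < \<rho>\<close> by (metis add.assoc)
            qed
            then have "E (x + w + r *\<^sub>R \<tau> *\<^sub>R v) v \<le> (1 + e) * E x v" by (rule \<rho>(2))
            then show "E (x + w + r *\<^sub>R (x + w + \<tau> *\<^sub>R v - (x + w))) (x + w + \<tau> *\<^sub>R v - (x + w)) \<le> \<tau> * ((1 + e) * E x v)"
              using \<tau>(1) by (simp add: E_scale mult_left_mono)
          qed
          then show "f (x + \<tau> *\<^sub>R v + vector [s, t]) \<le> f (x + vector [s, t]) + \<tau> * ((1 + e) * E x v)"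
            using lip[of "x + w + \<tau> *\<^sub>R v" "x + w"] by (simp add: w_def add_ac)
        qed
        then have "(box_avg \<delta> f (x + \<tau> *\<^sub>R v) - box_avg \<delta> f x) \<le> ((1 + e) * E x v) * \<tau>" by (simp add: mult_ac)
        then show ?case using \<tau>(1) by (simp only: pos_divide_le_eq)
      qed
    qed simp
  qed
  from g' equi bound show ?thesis by (rule that)
qed

end

section \<open>The inequality\<close>

lemma finite_Z2_ball: "finite {h \<in> Z2. norm h \<le> R}"
proof -
  define I where "I = {- \<lceil>R\<rceil>..\<lceil>R\<rceil>}"
  have "{h \<in> Z2. norm h \<le> R} \<subseteq> (\<lambda>(m, n). vector [of_int m, of_int n]) ` (I \<times> I)"
  proof
    fix h assume "h \<in> {h \<in> Z2. norm h \<le> R}"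
    then have h: "h \<in> Z2" "norm h \<le> R" by auto
    then obtain m n :: int where mn: "h $ 1 = of_int m" "h $ 2 = of_int n"
      unfolding Z2_def by (metis (mono_tags, lifting) Ints_cases mem_Collect_eq)
    have "\<bar>h $ 1\<bar> \<le> R" "\<bar>h $ 2\<bar> \<le> R"
      using component_le_norm_cart[of h 1] component_le_norm_cart[of h 2] h by auto
    then have "m \<in> I" "n \<in> I" unfolding mn I_def by (simp_all add: abs_le_iff) linarith+
    moreover have "h = vector [of_int m, of_int n]" using mn by (simp add: vec_eq_iff forall_2)
    ultimately show "h \<in> (\<lambda>(m, n). vector [of_int m, of_int n]) ` (I \<times> I)" by auto
  qed
  then show ?thesis by (rule finite_subset) (simp add: I_def)
qed

definition rot :: "real^2 \<Rightarrow> real^2" where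
  "rot v = vector [v $ 2, - (v $ 1)]"

lemma inner_rot: "rot v \<bullet> u = cr u v"
  by (simp add: rot_def inner_2 cr_def)

lemma solve_inner:
  assumes "cr b1 b2 \<noteq> 0"
  obtains a where "a \<bullet> b1 = p" "a \<bullet> b2 = q"
proof
  define a where "a = (1 / cr b1 b2) *\<^sub>R (p *\<^sub>R rot b2 - q *\<^sub>R rot b1)"
  show "a \<bullet> b1 = p" "a \<bullet> b2 = q"
    using assms cr_swap[of b2 b1] by (simp_all add: a_def inner_diff_left inner_rot)
qed

text \<open>The Cauchy-Binet identity; for a lattice basis \<open>u\<close>, \<open>v\<close> it
  reads \<open>cr a b\<close>, up to sign, from the pairings with the basis.\<close>

lemma cr_inner: "cr a b * cr u v = (a \<bullet> u) * (b \<bullet> v) - (a \<bullet> v) * (b \<bullet> u)"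
  by (simp add: cr_def inner_2 algebra_simps)

lemma zbasis_add: "zbasis b1 b2 \<Longrightarrow> zbasis b1 (b2 + b1)" "zbasis b1 b2 \<Longrightarrow> zbasis b1 (b2 - b1)"
  by (auto simp: zbasis_def cr_add_right cr_diff_right Z2_add Z2_diff)

lemma zbasis_swap: "zbasis b1 b2 \<Longrightarrow> zbasis b2 b1"
  using cr_swap[of b1 b2] by (auto simp: zbasis_def)

lemma zbasis_minus: "zbasis b1 b2 \<Longrightarrow> zbasis b1 (- b2)"
  by (auto simp: zbasis_def Z2_uminus)

text \<open>Here \<open>p\<close> and \<open>q\<close> stand for the stable norms of the basis
  vectors, \<open>s\<close> and \<open>t\<close> for the values of the first two forms on the other
  basis vector, \<open>- e\<close> and \<open>f\<close> for those of the third form. The claim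
  splits into \<open>p * q \<le> q * e + p * f\<close> and \<open>s * t \<le> t * f + s * e\<close>;
  in each, the smaller of the two weights times \<open>e + f\<close> lies between the two
  sides.\<close>

lemma hexagon_inequality:
  fixes s t e f p q :: real
  assumes "0 < p" "p \<le> q" "0 \<le> s" "s \<le> q" "0 \<le> t" "t \<le> p" "e \<le> p" "f \<le> q" "q \<le> e + f"
  shows "2 * (p * q) \<le> (p * q - s * t) + (t * f + q * e) + (p * f + s * e)"
proof -
  have ef: "0 \<le> e" "0 \<le> f" using assms by auto
  have "p * q \<le> p * (e + f)" using assms by (intro mult_left_mono) auto
  also have "p * (e + f) \<le> q * e + p * f" using assms ef by (simp add: distrib_left mult_right_mono)
  finally have 1: "p * q \<le> q * e + p * f" .
  have "s * t \<le> t * f + s * e"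
  proof (cases "s \<le> t")
    case True
    have "s * t \<le> s * (e + f)" using assms by (intro mult_left_mono) auto
    also have "\<dots> \<le> t * f + s * e" using True ef by (simp add: distrib_left mult_right_mono)
    finally show ?thesis .
  next
    case False
    have "s * t = t * s" by simp
    also have "\<dots> \<le> t * (e + f)" using assms by (intro mult_left_mono) auto
    also have "\<dots> \<le> t * f + s * e" using False ef by (simp add: distrib_left mult_right_mono)
    finally show ?thesis .
  qed
  with 1 show ?thesis by linarith
qed

section \<open>Smoothness of polygonal curves and closed forms\<close>

lemma Ck_on_const: "Ck_on k (\<lambda>_. c) S"
  by (induction k arbitrary: c) (auto simp: frechet_derivative_const)

lemma smooth_on_affine: "smooth_on (\<lambda>t :: real. x + (t - a) *\<^sub>R v :: real^2) S"
  unfolding smooth_on_def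
proof
  fix k
  have D: "((\<lambda>t. x + (t - a) *\<^sub>R v) has_derivative (\<lambda>w. w *\<^sub>R v)) (at t)" for t
    by (auto intro!: derivative_eq_intros)
  have fd: "frechet_derivative (\<lambda>t. x + (t - a) *\<^sub>R v) (at t) = (\<lambda>w. w *\<^sub>R v)" for t
    using frechet_derivative_at[OF D] by metis
  show "Ck_on k (\<lambda>t. x + (t - a) *\<^sub>R v) S"
  proof (cases k)
    case 0
    then show ?thesis by (auto intro!: continuous_intros)
  next
    case (Suc j)
    then show ?thesis using D by (auto simp: fd Ck_on_const differentiable_def)
  qed
qed

lemma piecewise_smooth_curve_join:
  assumes "piecewise_smooth_curve a b \<gamma>" "piecewise_smooth_curve b c \<gamma>"
  shows "piecewise_smooth_curve a c \<gamma>"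
proof -
  obtain ts where ts: "length ts \<ge> 2" "sorted_wrt (<) ts" "hd ts = a" "last ts = b"
    "\<And>i. Suc i < length ts \<Longrightarrow> smooth_arc (ts ! i) (ts ! Suc i) \<gamma>"
    using assms(1) by (auto simp: piecewise_smooth_curve_def)
  obtain us where us: "length us \<ge> 2" "sorted_wrt (<) us" "hd us = b" "last us = c"
    "\<And>i. Suc i < length us \<Longrightarrow> smooth_arc (us ! i) (us ! Suc i) \<gamma>"
    using assms(2) by (auto simp: piecewise_smooth_curve_def)
  define vs where "vs = tl us"
  define ws where "ws = butlast ts"
  have ne: "us \<noteq> []" "ts \<noteq> []" using us(1) ts(1) by auto
  have vs: "us = b # vs" using ne(1) us(3) unfolding vs_def by (cases us) auto
  have vs': "vs \<noteq> []" using us(1) unfolding vs by auto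
  have ws: "ts = ws @ [b]" using ne(2) ts(4) unfolding ws_def by (metis append_butlast_last_id)
  have sts: "\<And>x. x \<in> set ws \<Longrightarrow> x < b" using ts(2) unfolding ws by (simp add: sorted_wrt_append)
  have svs: "\<And>x. x \<in> set vs \<Longrightarrow> b < x" using us(2) unfolding vs by simp
  show ?thesis
    unfolding piecewise_smooth_curve_def
  proof (intro exI[of _ "ws @ b # vs"] conjI allI impI)
    show "length (ws @ b # vs) \<ge> 2" using vs' by (cases vs) auto
    show "sorted_wrt (<) (ws @ b # vs)"
    proof -
      have "sorted_wrt (<) ws" "sorted_wrt (<) (b # vs)" using ts(2) us(2) unfolding ws vs by (simp_all add: sorted_wrt_append)
      moreover have "x < y" if "x \<in> set ws" "y \<in> set (b # vs)" for x y
        using sts[OF that(1)] svs[of y] that(2) by auto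
      ultimately show ?thesis by (simp only: sorted_wrt_append) blast
    qed
    show "hd (ws @ b # vs) = a" using ts(3) unfolding ws by (cases ws) auto
    show "last (ws @ b # vs) = c" using us(4) vs vs' by simp
    fix i assume i: "Suc i < length (ws @ b # vs)"
    show "smooth_arc ((ws @ b # vs) ! i) ((ws @ b # vs) ! Suc i) \<gamma>"
    proof (cases "i < length ws")
      case True
      then have "(ws @ b # vs) ! i = ts ! i" "(ws @ b # vs) ! Suc i = ts ! Suc i"
        unfolding ws by (auto simp: nth_append nth_Cons')
      then show ?thesis using ts(5)[of i] True unfolding ws by simp
    next
      case False
      then have "(ws @ b # vs) ! i = us ! (i - length ws)" "(ws @ b # vs) ! Suc i = us ! Suc (i - length ws)"
        unfolding vs by (auto simp: nth_append Suc_diff_le)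
      then show ?thesis using us(5)[of "i - length ws"] False i unfolding vs by simp
    qed
  qed
qed

text \<open>A closed 1-form on the torus with periods \<open>a\<close>. The function \<open>m\<close> is the mixed second derivative of
  a primitive, which is all the second-order regularity that Stokes' formula needs.\<close>

definition closed_form :: "(real^2 \<Rightarrow> real^2) \<Rightarrow> real^2 \<Rightarrow> bool" where
  "closed_form g' a \<longleftrightarrow> continuous_on UNIV g' \<and>
     (\<exists>g. (\<forall>x. (g has_derivative (\<lambda>v. g' x \<bullet> v)) (at x)) \<and> (\<forall>x i. g (x + axis i 1) = g x + a $ i)) \<and>
     (\<exists>m :: real^2 \<Rightarrow> real. continuous_on UNIV m \<and>
        (\<forall>a b. ((\<lambda>s. g' (vector [s, b]) $ 2) has_real_derivative m (vector [a, b])) (at a)))"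

lemma closed_form_wedge:
  assumes "closed_form f' p" "closed_form g' q"
  shows "integral (cbox 0 1) (\<lambda>x. cr (f' x) (g' x)) = cr p q"
proof -
  obtain f where f: "\<forall>x. (f has_derivative (\<lambda>v. f' x \<bullet> v)) (at x)" "\<forall>x i. f (x + axis i 1) = f x + p $ i"
    using assms(1) unfolding closed_form_def by (elim conjE exE)
  obtain g where g: "\<forall>x. (g has_derivative (\<lambda>v. g' x \<bullet> v)) (at x)" "\<forall>x i. g (x + axis i 1) = g x + q $ i"
    using assms(2) unfolding closed_form_def by (elim conjE exE)
  obtain m :: "real^2 \<Rightarrow> real" where m: "continuous_on UNIV m"
    "\<forall>a b. ((\<lambda>s. g' (vector [s, b]) $ 2) has_real_derivative m (vector [a, b])) (at a)"
    using assms(2) unfolding closed_form_def by (elim conjE exE)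
  have c: "continuous_on UNIV f'" "continuous_on UNIV g'"
    using assms by (simp_all add: closed_form_def)
  show ?thesis
    by (rule degree_unit_square[OF f(1)[rule_format] g(1)[rule_format] c m(1) m(2)[rule_format]
          f(2)[rule_format] g(2)[rule_format]])
qed

context finsler_torus
begin

lemma pwl_piecewise_smooth: "pwl a b g L \<Longrightarrow> piecewise_smooth_curve a b (\<lambda>t. proj Z2 (g t))"
proof (induction rule: pwl.induct)
  case (base a b g x v L)
  have "smooth_arc a b (\<lambda>t. proj Z2 (g t))"
    unfolding smooth_arc_def
    using base(2) smooth_on_affine[of x a v UNIV]
    by (intro ballI exI[of _ UNIV] exI[of _ "\<lambda>t. x + (t - a) *\<^sub>R v"]) auto
  then show ?case
    using base(1) unfolding piecewise_smooth_curve_def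
    by (intro exI[of _ "[a, b]"]) auto
qed (rule piecewise_smooth_curve_join)

text \<open>Inside each linear piece the velocity is the constant direction; at the finitely many
  break points, where it is unspecified, the integrand does not affect the integral.\<close>

lemma pwl_length:
  "pwl a b g L \<Longrightarrow> ((\<lambda>t. F (proj Z2 (g t)) (velocity (\<lambda>t. proj Z2 (g t)) t)) has_integral L) {a..b}"
proof (induction rule: pwl.induct)
  case (base a b g x v L)
  have vel: "velocity (\<lambda>t. proj Z2 (g t)) t = v" if "t \<in> {a<..<b}" for t
  proof (rule velocity_eq)
    have "((\<lambda>t. x + (t - a) *\<^sub>R v) has_vector_derivative v) (at t)"
      by (auto intro!: derivative_eq_intros)
    moreover have "\<forall>\<^sub>F s in nhds t. proj Z2 (g s) = proj Z2 (x + (s - a) *\<^sub>R v)"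
      using that base(2) by (intro eventually_nhds_in_open[of "{a<..<b}" t, THEN eventually_mono]) auto
    ultimately show "has_velocity (\<lambda>t. proj Z2 (g t)) t v"
      unfolding has_velocity_def by blast
  qed
  have "((\<lambda>t. F (proj Z2 (g t)) (velocity (\<lambda>t. proj Z2 (g t)) t)) has_integral L) (cbox a b)"
  proof (rule has_integral_spike_interior)
    show "((\<lambda>t. E (x + (t - a) *\<^sub>R v) v) has_integral L) (cbox a b)" using base(3) by simp
    show "F (proj Z2 (g t)) (velocity (\<lambda>t. proj Z2 (g t)) t) = E (x + (t - a) *\<^sub>R v) v" if "t \<in> box a b" for t
      using that vel[of t] base(2)[of t] by (simp add: E_def)
  qed
  then show ?case by simp
next
  case (join a b g L1 c L2)
  then show ?case
    using pwl_less[OF join(1)] pwl_less[OF join(2)] by (intro has_integral_combine[of a b c]) auto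
qed

lemma short_loop:
  assumes h: "h \<in> Z2" and c: "N h < c"
  obtains g where "continuous_on {0..1} g" "g 1 - g 0 = h" "closed_curve 0 1 (\<lambda>t. proj Z2 (g t))"
    "curve_length F 0 1 (\<lambda>t. proj Z2 (g t)) < c"
proof -
  have "len h < c" using len_le_N[OF h] c by simp
  then obtain x where "d x (x + h) < c"
    unfolding len_def by (subst (asm) cINF_less_iff) (auto intro!: bdd_belowI2[of _ 0] simp: d_nonneg)
  then obtain L where "L < c" "conn x (x + h) L" using d_approx by blast
  then obtain g where g: "pwl 0 1 g L" "g 0 = x" "g 1 = x + h" "L < c" by (auto simp: conn_def)
  show ?thesis
  proof
    show "continuous_on {0..1} g" by (rule pwl_continuous[OF g(1)])
    show "closed_curve 0 1 (\<lambda>t. proj Z2 (g t))"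
      using pwl_piecewise_smooth[OF g(1)] g h by (simp add: closed_curve_def proj_Z2_add)
    show "curve_length F 0 1 (\<lambda>t. proj Z2 (g t)) < c"
      using integral_unique[OF pwl_length[OF g(1)]] g by (simp add: curve_length_def)
  qed (use g in simp)
qed

section \<open>Reduced bases, norming functionals and calibrating functions\<close>

lemma N_argmin:
  assumes S: "S \<subseteq> Z2" "S \<noteq> {}"
  obtains b where "b \<in> S" "\<And>b'. b' \<in> S \<Longrightarrow> N b \<le> N b'"
proof -
  obtain m M where m: "0 < m" "\<And>x v. m * norm v \<le> E x v" using E_bounds by metis
  obtain s where s: "s \<in> S" using S by blast
  define T where "T = {h \<in> S. N h \<le> N s}"
  \<comment> \<open>The stable norm dominates \<open>m\<close> times the Euclidean norm, so only
    finitely many lattice vectors compete with \<open>s\<close>.\<close>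
  have "T \<subseteq> {h \<in> Z2. norm h \<le> N s / m}"
  proof
    fix h assume "h \<in> T"
    then have "h \<in> Z2" "N h \<le> N s" using S by (auto simp: T_def)
    moreover have "m * norm h \<le> N h" using m \<open>h \<in> Z2\<close> by (intro N_lower) auto
    ultimately show "h \<in> {h \<in> Z2. norm h \<le> N s / m}" using m(1) by (simp add: pos_le_divide_eq mult.commute)
  qed
  then have fin: "finite T" using finite_Z2_ball finite_subset by blast
  have "T \<noteq> {}" using s by (auto simp: T_def)
  then obtain b where b: "b \<in> T" "\<And>b'. b' \<in> T \<Longrightarrow> N b \<le> N b'"
    using ex_min_if_finite[OF finite_imageI[OF fin, of N]] by (metis (no_types, lifting) image_iff image_is_empty linorder_not_le)
  show ?thesis
  proof
    show "b \<in> S" using b by (simp add: T_def)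
    show "N b \<le> N b'" if "b' \<in> S" for b'
      using b that by (cases "N b' \<le> N s") (auto simp: T_def)
  qed
qed

text \<open>Lagrange-Gauss reduction: \<open>b1\<close> is shortest among the vectors that belong to
  a basis, \<open>b2\<close> shortest among those completing \<open>b1\<close>; since
  \<open>b2 + b1\<close> and \<open>b2 - b1\<close> also complete \<open>b1\<close>, they are not
  shorter.\<close>

lemma reduced_basis:
  obtains b1 b2 where "zbasis b1 b2" "0 < N b1" "N b1 \<le> N b2" "N b2 \<le> N (b2 + b1)" "N b2 \<le> N (b2 - b1)"
proof -
  define S1 where "S1 = {b1. \<exists>b2. zbasis b1 b2}"
  have "zbasis (axis 1 1) (axis 2 1)"
    unfolding zbasis_def using Z2_axis by (simp add: cr_def) (simp add: axis_def)
  then have "S1 \<subseteq> Z2" "S1 \<noteq> {}" by (auto simp: S1_def zbasis_def)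
  then obtain b1 where b1: "b1 \<in> S1" "\<And>b. b \<in> S1 \<Longrightarrow> N b1 \<le> N b" using N_argmin by blast
  have S2: "{b2. zbasis b1 b2} \<subseteq> Z2" "{b2. zbasis b1 b2} \<noteq> {}"
    using b1 by (auto simp: S1_def zbasis_def)
  obtain b2 where "b2 \<in> {b2. zbasis b1 b2}" "\<And>b. b \<in> {b2. zbasis b1 b2} \<Longrightarrow> N b2 \<le> N b"
    using N_argmin[OF S2] by metis
  then have b2: "zbasis b1 b2" "\<And>b. zbasis b1 b \<Longrightarrow> N b2 \<le> N b" by simp_all
  show ?thesis
  proof
    show "zbasis b1 b2" by fact
    have "b1 \<in> Z2" "b1 \<noteq> 0" using b2(1) by (auto simp: zbasis_def)
    then show "0 < N b1" by (rule N_pos)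
    show "N b1 \<le> N b2" using b1(2) zbasis_swap[OF b2(1)] by (auto simp: S1_def)
    show "N b2 \<le> N (b2 + b1)" "N b2 \<le> N (b2 - b1)"
      using b2(2)[OF zbasis_add(1)[OF b2(1)]] b2(2)[OF zbasis_add(2)[OF b2(1)]] .
  qed
qed

text \<open>Hahn-Banach on the lattice: the functional is prescribed on \<open>b1\<close>, and its
  value \<open>s\<close> on \<open>b2\<close> has to lie between the lower bounds imposed by vectors
  with negative \<open>b2\<close>-coefficient and the upper bounds imposed by those with positive
  one.\<close>

lemma norming_functional:
  assumes b: "zbasis b1 b2"
  obtains a where "a \<bullet> b1 = N b1" "\<And>h. h \<in> Z2 \<Longrightarrow> \<bar>a \<bullet> h\<bar> \<le> N h"
proof -
  define l where "l = N b1"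
  have bZ: "b1 \<in> Z2" "b2 \<in> Z2" "cr b1 b2 \<noteq> 0" using b by (auto simp: zbasis_def)
  define V where "V m n = of_int m *\<^sub>R b1 + of_int n *\<^sub>R b2" for m n :: int
  have V: "V m n \<in> Z2" for m n unfolding V_def using bZ by (intro Z2_add Z2_scale) auto
  have VN: "N (V m 0) = \<bar>of_int m\<bar> * l" for m
    using N_int[OF bZ(1), of m] by (simp add: V_def l_def)
  define Q :: "(int \<times> int) set" where "Q = {(m, n). n \<ge> 1}"
  \<comment> \<open>The value at \<open>(m, n)\<close> is the upper bound that the vector
    \<open>V m n\<close> imposes on the value at \<open>b2\<close>.\<close>
  define \<phi> :: "int \<times> int \<Rightarrow> real" where "\<phi> = (\<lambda>(m, n). (N (V m n) - of_int m * l) / of_int n)"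
  define s where "s = Inf (\<phi> ` Q)"
  have key: "(of_int m' * l - N (V m' (- n'))) / of_int n' \<le> \<phi> (m, n)" if "n \<ge> 1" "n' \<ge> 1" for m n m' n'
  proof -
    have nn: "real_of_int n > 0" "real_of_int n' > 0" using that by auto
    \<comment> \<open>The weights \<open>n'\<close> and \<open>n\<close> cancel the
      \<open>b2\<close>-coefficients, so the norm of the sum is known from that of
      \<open>b1\<close>; subadditivity then compares the two bounds.\<close>
    have "V (m * n' + m' * n) 0 = of_int n' *\<^sub>R V m n + of_int n *\<^sub>R V m' (- n')"
      by (simp add: V_def algebra_simps)
    then have "N (V (m * n' + m' * n) 0) \<le> N (of_int n' *\<^sub>R V m n) + N (of_int n *\<^sub>R V m' (- n'))"
      using N_add[of "of_int n' *\<^sub>R V m n" "of_int n *\<^sub>R V m' (- n')"] V Z2_scale by simp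
    then have "\<bar>real_of_int (m * n' + m' * n)\<bar> * l \<le> of_int n' * N (V m n) + of_int n * N (V m' (- n'))"
      using nn unfolding VN N_int[OF V] by simp
    moreover have "real_of_int (m * n' + m' * n) * l \<le> \<bar>real_of_int (m * n' + m' * n)\<bar> * l"
      using N_nonneg[OF bZ(1)] by (intro mult_right_mono) (auto simp: l_def)
    ultimately have "(of_int m' * l - N (V m' (- n'))) * of_int n \<le> (N (V m n) - of_int m * l) * of_int n'"
      by (simp add: algebra_simps)
    then show ?thesis using nn by (simp add: \<phi>_def divide_le_eq le_divide_eq mult.commute)
  qed
  have bdd: "bdd_below (\<phi> ` Q)"
    using key[where m' = 0 and n' = 1] by (intro bdd_belowI2[of _ "(of_int 0 * l - N (V 0 (- 1))) / of_int 1"]) (auto simp: Q_def)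
  have s_le: "s \<le> \<phi> (m, n)" if "n \<ge> 1" for m n
    unfolding s_def using that by (intro cINF_lower bdd) (simp add: Q_def)
  have s_ge: "(of_int m * l - N (V m (- n))) / of_int n \<le> s" if "n \<ge> 1" for m n
  proof -
    have "(0, 1) \<in> Q" by (simp add: Q_def)
    then have "Q \<noteq> {}" by blast
    then show ?thesis unfolding s_def using key that by (intro cINF_greatest) (auto simp: Q_def)
  qed
  obtain a where a: "a \<bullet> b1 = l" "a \<bullet> b2 = s" using solve_inner[OF bZ(3)] by blast
  have le: "a \<bullet> h \<le> N h" if h: "h \<in> Z2" for h
  proof -
    obtain m n where mn: "h = V m n" using zbasis_expand[OF b h] unfolding V_def by metis
    have ah: "a \<bullet> h = of_int m * l + of_int n * s" by (simp add: mn V_def inner_add_right a)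
    consider "n \<ge> 1" | "n = 0" | "- n \<ge> 1" by linarith
    then show ?thesis
    proof cases
      case 1
      then have "real_of_int n > 0" by simp
      then show ?thesis using s_le[OF 1, of m] unfolding ah by (simp add: \<phi>_def mn le_divide_eq algebra_simps)
    next
      case 2
      have "of_int m * l \<le> \<bar>of_int m\<bar> * l" using N_nonneg[OF bZ(1)] by (intro mult_right_mono) (auto simp: l_def)
      then show ?thesis using VN[of m] 2 unfolding ah by (simp add: mn)
    next
      case 3
      then have r: "real_of_int (- n) > 0" by linarith
      have "of_int m * l - N (V m n) \<le> s * of_int (- n)"
        using s_ge[OF 3, of m] unfolding pos_divide_le_eq[OF r] minus_minus .
      then show ?thesis unfolding ah by (simp add: mn algebra_simps)
    qed
  qed
  show ?thesis
  proof
    show "a \<bullet> b1 = N b1" using a by (simp add: l_def)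
    show "\<bar>a \<bullet> h\<bar> \<le> N h" if "h \<in> Z2" for h
      using le[OF that] le[OF Z2_uminus[OF that]] N_minus[OF that] by (simp add: abs_le_iff)
  qed
qed

text \<open>The McShane extension of \<open>a\<close> from the lattice to the plane: on lattice
  vectors \<open>a\<close> is 1-Lipschitz for \<open>d\<close>, because
  \<open>N h \<le> d 0 h\<close>.\<close>

lemma calibrating_function:
  assumes a: "\<And>h. h \<in> Z2 \<Longrightarrow> \<bar>a \<bullet> h\<bar> \<le> N h"
  obtains f where "\<And>x h. h \<in> Z2 \<Longrightarrow> f (x + h) = f x + a \<bullet> h" "\<And>x y. f y \<le> f x + d x y"
proof -
  define f where "f x = (INF h\<in>Z2. d x h + a \<bullet> h)" for x
  \<comment> \<open>The triangle inequality gives \<open>d x h \<ge> d 0 h - d 0 x\<close>, and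
    \<open>d 0 h\<close> is at least \<open>N h\<close>, hence at least
    \<open>- (a \<bullet> h)\<close>.\<close>
  have "- d 0 x \<le> d x h + a \<bullet> h" if "h \<in> Z2" for x h
    using d_triangle[of 0 h x] N_le[OF that] a[OF that] by linarith
  then have bdd: "bdd_below ((\<lambda>h. d x h + a \<bullet> h) ` Z2)" for x by (intro bdd_belowI2[of _ "- d 0 x"])
  have ne: "Z2 \<noteq> {}" using Z2_0 by blast
  have shift_le: "f (x + k) \<le> f x + a \<bullet> k" if k: "k \<in> Z2" for x k
  proof -
    have "f (x + k) - a \<bullet> k \<le> d x h + a \<bullet> h" if h: "h \<in> Z2" for h
    proof -
      have "f (x + k) \<le> d (x + k) (h + k) + a \<bullet> (h + k)"
        unfolding f_def by (intro cINF_lower bdd Z2_add h k)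
      then show ?thesis by (simp add: d_shift[OF k] inner_add_right)
    qed
    then have "f (x + k) - a \<bullet> k \<le> f x" unfolding f_def[of x] by (intro cINF_greatest ne)
    then show ?thesis by simp
  qed
  show ?thesis
  proof
    show "f (x + k) = f x + a \<bullet> k" if k: "k \<in> Z2" for x k
      using shift_le[OF k, of x] shift_le[OF Z2_uminus[OF k], of "x + k"] by simp
    show "f y \<le> f x + d x y" for x y
    proof -
      have "f y - d x y \<le> d x h + a \<bullet> h" if "h \<in> Z2" for h
      proof -
        have "f y \<le> d y h + a \<bullet> h" unfolding f_def by (intro cINF_lower bdd that)
        then show ?thesis using d_triangle[of y h x] d_sym[of y x] by simp
      qed
      then have "f y - d x y \<le> f x" unfolding f_def[of x] by (intro cINF_greatest ne)
      then show ?thesis by simp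
    qed
  qed
qed

text \<open>The pairings of \<open>a1\<close>, \<open>a2\<close> with the basis have diagonal
  entries \<open>N b1\<close>, \<open>N b2\<close> and off-diagonal entries \<open>s\<close>,
  \<open>t\<close>. The three terms of \<open>hex\<close> are 2 by 2 determinants, read from such
  pairings by \<open>cr_inner\<close>.\<close>

lemma periods_hexagon:
  obtains b1 b2 a1 a2 a3 where "zbasis b1 b2" "0 < N b1" "0 < N b2" "2 * (N b1 * N b2) \<le> hex a1 a2 a3"
    "\<And>h. h \<in> Z2 \<Longrightarrow> \<bar>a1 \<bullet> h\<bar> \<le> N h" "\<And>h. h \<in> Z2 \<Longrightarrow> \<bar>a2 \<bullet> h\<bar> \<le> N h" "\<And>h. h \<in> Z2 \<Longrightarrow> \<bar>a3 \<bullet> h\<bar> \<le> N h"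
proof -
  obtain b1 b2' where b': "zbasis b1 b2'" "0 < N b1" "N b1 \<le> N b2'" "N b2' \<le> N (b2' + b1)" "N b2' \<le> N (b2' - b1)"
    by (rule reduced_basis)
  obtain a1 where a1: "a1 \<bullet> b1 = N b1" "\<And>h. h \<in> Z2 \<Longrightarrow> \<bar>a1 \<bullet> h\<bar> \<le> N h"
    using norming_functional[OF b'(1)] by blast
  \<comment> \<open>The sign of the second basis vector is chosen so that \<open>s\<close> below is
    nonnegative; reducedness is kept because \<open>N\<close> is even.\<close>
  define b2 where "b2 = (if a1 \<bullet> b2' \<ge> 0 then b2' else - b2')"
  have Z': "b1 \<in> Z2" "b2' \<in> Z2" using b'(1) by (auto simp: zbasis_def)
  have bs: "zbasis b1 b2" "N b2 = N b2'" "N b2' \<le> N (b2 - b1)" "a1 \<bullet> b2 \<ge> 0"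
  proof -
    show "zbasis b1 b2" "N b2 = N b2'" "a1 \<bullet> b2 \<ge> 0"
      using b' zbasis_minus N_minus Z' by (auto simp: b2_def)
    have "- b2' - b1 = - (b2' + b1)" by simp
    then have "N (- b2' - b1) = N (b2' + b1)" using N_minus[OF Z2_add[OF Z'(2,1)]] by (simp only:)
    then show "N b2' \<le> N (b2 - b1)" using b' by (simp add: b2_def)
  qed
  have Z: "b1 \<in> Z2" "b2 \<in> Z2" "b2 - b1 \<in> Z2" and det: "\<bar>cr b1 b2\<bar> = 1"
    using bs(1) by (auto simp: zbasis_def Z2_diff)
  obtain a2 where a2: "a2 \<bullet> b2 = N b2" "\<And>h. h \<in> Z2 \<Longrightarrow> \<bar>a2 \<bullet> h\<bar> \<le> N h"
    using norming_functional[OF zbasis_swap[OF bs(1)]] by blast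
  have abs_cr: "\<bar>cr a c\<bar> = \<bar>(a \<bullet> b1) * (c \<bullet> b2) - (a \<bullet> b2) * (c \<bullet> b1)\<bar>" for a c
    using arg_cong[OF cr_inner[of a c b1 b2], of abs] det by (simp add: abs_mult)
  have pos: "0 < N b2" using b' bs by simp
  define s t where "s = a1 \<bullet> b2" and "t = a2 \<bullet> b1"
  have st: "0 \<le> s" "s \<le> N b2" "\<bar>t\<bar> \<le> N b1" using bs(4) a1(2)[OF Z(2)] a2(2)[OF Z(1)] by (auto simp: s_def t_def)
  have c12: "\<bar>cr a1 a2\<bar> = \<bar>N b1 * N b2 - s * t\<bar>"
    unfolding abs_cr by (simp add: a1 a2 s_def t_def)
  show ?thesis
  proof (cases "t \<le> 0")
    \<comment> \<open>With \<open>s * t \<le> 0\<close> the determinant is at least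
      \<open>N b1 * N b2\<close>, and the degenerate hexagon that repeats \<open>a1\<close> counts
      it twice.\<close>
    case True
    then have "s * t \<le> 0" using st by (simp add: mult_nonneg_nonpos)
    then have "N b1 * N b2 \<le> \<bar>cr a1 a2\<bar>" unfolding c12 by linarith
    moreover have "\<bar>cr a2 a1\<bar> = \<bar>cr a1 a2\<bar>" using cr_swap[of a2 a1] by simp
    ultimately have "2 * (N b1 * N b2) \<le> hex a1 a2 a1" by (simp add: hex_def)
    then show ?thesis using that bs(1) b'(2) pos a1(2) a2(2) by blast
  next
    case False
    have "zbasis (b2 - b1) b1"
      using zbasis_swap[OF zbasis_add(2)[OF bs(1)]] .
    then obtain a3 where a3: "a3 \<bullet> (b2 - b1) = N (b2 - b1)" "\<And>h. h \<in> Z2 \<Longrightarrow> \<bar>a3 \<bullet> h\<bar> \<le> N h"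
      using norming_functional by blast
    \<comment> \<open>Norming \<open>b2 - b1\<close> forces the third form to be nonpositive on
      \<open>b1\<close> and nonnegative on \<open>b2\<close>, which is why \<open>e\<close> carries
      a minus sign.\<close>
    define e f where "e = - (a3 \<bullet> b1)" and "f = a3 \<bullet> b2"
    have ef: "e \<le> N b1" "f \<le> N b2" "N b2 \<le> e + f"
      using a3(2)[OF Z(1)] a3(2)[OF Z(2)] a3(1) bs(2,3) by (auto simp: e_def f_def inner_diff_right)
    have "\<bar>cr a2 a3\<bar> = \<bar>t * f + N b2 * e\<bar>" "\<bar>cr a1 a3\<bar> = \<bar>N b1 * f + s * e\<bar>"
      unfolding abs_cr by (simp_all add: a1 a2 s_def t_def e_def f_def)
    moreover have "2 * (N b1 * N b2) \<le> (N b1 * N b2 - s * t) + (t * f + N b2 * e) + (N b1 * f + s * e)"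
      using False st ef b' bs by (intro hexagon_inequality) auto
    ultimately have "2 * (N b1 * N b2) \<le> hex a1 a2 a3"
      unfolding hex_def c12 by linarith
    then show ?thesis using that bs(1) b'(2) pos a1(2) a2(2) a3(2) by blast
  qed
qed

lemma calibrating_form:
  assumes a: "\<And>h. h \<in> Z2 \<Longrightarrow> \<bar>a \<bullet> h\<bar> \<le> N h" and e: "e > 0"
  shows "\<exists>g'. closed_form g' a \<and> (\<forall>x. (1 / (1 + e)) *\<^sub>R g' x \<in> B x)"
proof -
  obtain f where f: "\<And>x h. h \<in> Z2 \<Longrightarrow> f (x + h) = f x + a \<bullet> h" "\<And>x y. f y \<le> f x + d x y"
    using calibrating_function[OF a] by blast
  show ?thesis
  proof (rule mollify[of f a e])
    fix g g' and m :: "real^2 \<Rightarrow> real"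
    assume g: "\<And>x. (g has_derivative (\<lambda>v. g' x \<bullet> v)) (at x)"
      "continuous_on UNIV g'" "continuous_on UNIV m"
      "\<And>a b. ((\<lambda>s. g' (vector [s, b]) $ 2) has_real_derivative m (vector [a, b])) (at a)"
      "\<And>x i. g (x + axis i 1) = g x + a $ i"
      "\<And>x v. g' x \<bullet> v \<le> (1 + e) * E x v"
    have "closed_form g' a"
      unfolding closed_form_def
      by (intro conjI g(2) exI[of _ g] exI[of _ m] allI g(1) g(3) g(4) g(5))
    moreover have "(1 / (1 + e)) *\<^sub>R g' x \<in> B x" for x
      using g(6)[of x] e by (simp add: B_def pos_divide_le_eq mult.commute)
    ultimately show ?thesis by blast
  qed (use f e in auto)
qed

lemma vol_lower_bound:
  obtains b1 b2 where "zbasis b1 b2" "0 < N b1" "0 < N b2" "2 / pi * (N b1 * N b2) < vol_HT F"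
proof -
  obtain b1 b2 a1 a2 a3 where b: "zbasis b1 b2" "0 < N b1" "0 < N b2" and hx: "2 * (N b1 * N b2) \<le> hex a1 a2 a3"
    and a: "\<And>h. h \<in> Z2 \<Longrightarrow> \<bar>a1 \<bullet> h\<bar> \<le> N h" "\<And>h. h \<in> Z2 \<Longrightarrow> \<bar>a2 \<bullet> h\<bar> \<le> N h" "\<And>h. h \<in> Z2 \<Longrightarrow> \<bar>a3 \<bullet> h\<bar> \<le> N h"
    by (rule periods_hexagon) blast
  obtain c where c: "c > 0" "\<And>x a b d. x \<in> cbox 0 1 \<Longrightarrow> a \<in> B x \<Longrightarrow> b \<in> B x \<Longrightarrow> d \<in> B x \<Longrightarrow>
      hex a b d + c \<le> measure lebesgue (B x)"
    by (rule hex_slack) blast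
  define V where "V = integral (cbox 0 1) (\<lambda>x. measure lebesgue (B x))"
  have int: "\<phi> integrable_on cbox 0 1" if "continuous_on UNIV \<phi>" for \<phi> :: "real^2 \<Rightarrow> real"
    using that continuous_on_subset by (intro integrable_continuous) blast
  have I1: "integral (cbox (0 :: real^2) 1) (\<lambda>x. c) = c"
    by (simp add: content_cbox_2 content_Pair)
  \<comment> \<open>\<open>c\<close> is the pointwise gap integrated over a square of area 1; the
    square of \<open>1 / (1 + e)\<close> comes from rescaling both covectors in each
    determinant.\<close>
  have main: "c + (1 / (1 + e))\<^sup>2 * hex a1 a2 a3 \<le> V" if e: "e > 0" for e
  proof -
    obtain g1 where g1: "closed_form g1 a1" "\<And>x. (1 / (1 + e)) *\<^sub>R g1 x \<in> B x"
      using calibrating_form[OF a(1) e] by blast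
    obtain g2 where g2: "closed_form g2 a2" "\<And>x. (1 / (1 + e)) *\<^sub>R g2 x \<in> B x"
      using calibrating_form[OF a(2) e] by blast
    obtain g3 where g3: "closed_form g3 a3" "\<And>x. (1 / (1 + e)) *\<^sub>R g3 x \<in> B x"
      using calibrating_form[OF a(3) e] by blast
    have cg: "continuous_on UNIV g1" "continuous_on UNIV g2" "continuous_on UNIV g3"
      using g1(1) g2(1) g3(1) by (simp_all add: closed_form_def)
    define k where "k = (1 / (1 + e))\<^sup>2"
    have k0: "k \<ge> 0" by (simp add: k_def)
    define H where "H x = hex (g1 x) (g2 x) (g3 x)" for x
    have ccr: "continuous_on UNIV (\<lambda>x. \<bar>cr (u x) (v x)\<bar>)" "continuous_on UNIV (\<lambda>x. cr (u x) (v x))"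
      if "continuous_on UNIV u" "continuous_on UNIV v" for u v :: "real^2 \<Rightarrow> real^2"
      unfolding cr_def by (intro continuous_intros that)+
    have Hc: "continuous_on UNIV H"
      unfolding H_def hex_def by (intro continuous_on_add ccr cg)
    have pw: "k * H x + c \<le> measure lebesgue (B x)" if "x \<in> cbox 0 1" for x
    proof -
      have "hex ((1 / (1 + e)) *\<^sub>R g1 x) ((1 / (1 + e)) *\<^sub>R g2 x) ((1 / (1 + e)) *\<^sub>R g3 x) = k * H x"
      proof -
        have "\<bar>r * (r * z)\<bar> = r\<^sup>2 * \<bar>z\<bar>" for r z :: real
          by (simp add: abs_mult power2_eq_square flip: mult.assoc)
        then show ?thesis
          unfolding H_def hex_def k_def cr_scaleR_left cr_scaleR_right by (simp only: distrib_left)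
      qed
      then show ?thesis using c(2)[OF that g1(2) g2(2) g3(2)] by simp
    qed
    have absint: "\<bar>cr p q\<bar> \<le> integral (cbox 0 1) (\<lambda>x. \<bar>cr (u x) (v x)\<bar>)"
      if "integral (cbox 0 1) (\<lambda>x. cr (u x) (v x)) = cr p q" "continuous_on UNIV u" "continuous_on UNIV v"
      for p q and u v :: "real^2 \<Rightarrow> real^2"
      using integral_norm_bound_integral[OF int[OF ccr(2)[OF that(2,3)]] int[OF ccr(1)[OF that(2,3)]]] that(1)
      by simp
    have "hex a1 a2 a3 \<le> integral (cbox 0 1) (\<lambda>x. \<bar>cr (g1 x) (g2 x)\<bar>) +
        integral (cbox 0 1) (\<lambda>x. \<bar>cr (g2 x) (g3 x)\<bar>) + integral (cbox 0 1) (\<lambda>x. \<bar>cr (g1 x) (g3 x)\<bar>)"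
      unfolding hex_def
      by (intro add_mono absint closed_form_wedge g1(1) g2(1) g3(1) cg)
    also have "\<dots> = integral (cbox 0 1) H"
    proof -
      have "integral (cbox 0 1) H = integral (cbox 0 1) (\<lambda>x. \<bar>cr (g1 x) (g2 x)\<bar> + \<bar>cr (g2 x) (g3 x)\<bar>) +
          integral (cbox 0 1) (\<lambda>x. \<bar>cr (g1 x) (g3 x)\<bar>)"
        unfolding H_def hex_def by (intro integral_add integrable_add int ccr cg)
      moreover have "integral (cbox 0 1) (\<lambda>x. \<bar>cr (g1 x) (g2 x)\<bar> + \<bar>cr (g2 x) (g3 x)\<bar>) =
          integral (cbox 0 1) (\<lambda>x. \<bar>cr (g1 x) (g2 x)\<bar>) + integral (cbox 0 1) (\<lambda>x. \<bar>cr (g2 x) (g3 x)\<bar>)"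
        by (intro integral_add int ccr cg)
      ultimately show ?thesis by simp
    qed
    finally have "k * hex a1 a2 a3 \<le> k * integral (cbox 0 1) H" using k0 by (rule mult_left_mono)
    moreover have "k * integral (cbox 0 1) H + c = integral (cbox 0 1) (\<lambda>x. k * H x + c)"
      using int[OF Hc] I1 by (subst integral_add) (auto intro!: integrable_on_mult_right)
    moreover have "\<dots> \<le> V"
      unfolding V_def using pw Hc B_measure_continuous by (intro integral_le int) (auto intro!: continuous_intros)
    ultimately show ?thesis by (simp add: k_def)
  qed
  have "((\<lambda>e. c + (1 / (1 + e))\<^sup>2 * hex a1 a2 a3) \<longlongrightarrow> c + (1 / (1 + 0))\<^sup>2 * hex a1 a2 a3) (at_right (0 :: real))"
    by (intro tendsto_intros) auto
  then have "c + (1 / (1 + 0))\<^sup>2 * hex a1 a2 a3 \<le> V"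
    by (rule tendsto_upperbound) (auto intro!: eventually_at_right_less[THEN eventually_mono] main)
  then have "2 * (N b1 * N b2) < V" using hx c(1) by simp
  then have "2 * (N b1 * N b2) / pi < V / pi" by (simp add: divide_strict_right_mono)
  moreover have "vol_HT F = V / pi"
    unfolding vol_HT_def V_def dual_ball_eq by simp
  ultimately show ?thesis using that b by simp
qed

lemma short_basis:
  "\<exists>\<gamma>\<^sub>1 \<gamma>\<^sub>2. closed_curve 0 1 \<gamma>\<^sub>1 \<and> closed_curve 0 1 \<gamma>\<^sub>2 \<and> generate_H1 \<gamma>\<^sub>1 \<gamma>\<^sub>2 \<and>
     2 / pi * (curve_length F 0 1 \<gamma>\<^sub>1 * curve_length F 0 1 \<gamma>\<^sub>2) \<le> vol_HT F"
proof -
  obtain b1 b2 where b: "zbasis b1 b2" "0 < N b1" "0 < N b2" "2 / pi * (N b1 * N b2) < vol_HT F"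
    by (rule vol_lower_bound)
  \<comment> \<open>The strict volume bound leaves room for lengths that exceed the stable norms by
    some \<open>e > 0\<close>.\<close>
  have "((\<lambda>e. 2 / pi * ((N b1 + e) * (N b2 + e))) \<longlongrightarrow> 2 / pi * ((N b1 + 0) * (N b2 + 0))) (at_right (0 :: real))"
    by (intro tendsto_intros)
  then have "\<forall>\<^sub>F e in at_right 0. 2 / pi * ((N b1 + e) * (N b2 + e)) < vol_HT F"
    by (rule order_tendstoD(2)) (use b in simp)
  then have "\<forall>\<^sub>F e in at_right 0. 2 / pi * ((N b1 + e) * (N b2 + e)) < vol_HT F \<and> e > 0"
    using eventually_at_right_less by (rule eventually_conj)
  then obtain e where e: "2 / pi * ((N b1 + e) * (N b2 + e)) < vol_HT F" "e > 0"
    using eventually_happens' trivial_limit_at_right_real by blast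
  have Z: "b1 \<in> Z2" "b2 \<in> Z2" using b(1) by (auto simp: zbasis_def)
  obtain g1 where g1: "continuous_on {0..1} g1" "g1 1 - g1 0 = b1" "closed_curve 0 1 (\<lambda>t. proj Z2 (g1 t))"
    "curve_length F 0 1 (\<lambda>t. proj Z2 (g1 t)) < N b1 + e"
    using short_loop[OF Z(1), of "N b1 + e"] e(2) by auto
  obtain g2 where g2: "continuous_on {0..1} g2" "g2 1 - g2 0 = b2" "closed_curve 0 1 (\<lambda>t. proj Z2 (g2 t))"
    "curve_length F 0 1 (\<lambda>t. proj Z2 (g2 t)) < N b2 + e"
    using short_loop[OF Z(2), of "N b2 + e"] e(2) by auto
  \<comment> \<open>Valid for every \<open>g\<close>: the integral of a non-integrable function is 0
    by convention.\<close>
  have nn: "0 \<le> curve_length F 0 1 (\<lambda>t. proj Z2 (g t))" for g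
    unfolding curve_length_def
  proof (cases "(\<lambda>t. F (proj Z2 (g t)) (velocity (\<lambda>t. proj Z2 (g t)) t)) integrable_on {0..1}")
    case True
    then show "0 \<le> integral {0..1} (\<lambda>t. F (proj Z2 (g t)) (velocity (\<lambda>t. proj Z2 (g t)) t))"
      using E_nonneg by (intro integral_nonneg) (auto simp: E_def)
  qed (simp add: not_integrable_integral)
  have "curve_length F 0 1 (\<lambda>t. proj Z2 (g1 t)) * curve_length F 0 1 (\<lambda>t. proj Z2 (g2 t)) \<le> (N b1 + e) * (N b2 + e)"
    using g1(4) g2(4) nn b e by (intro mult_mono) (auto intro: less_imp_le)
  then have "2 / pi * (curve_length F 0 1 (\<lambda>t. proj Z2 (g1 t)) * curve_length F 0 1 (\<lambda>t. proj Z2 (g2 t))) \<le>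
      2 / pi * ((N b1 + e) * (N b2 + e))"
    by (intro mult_left_mono) auto
  moreover have "generate_H1 (\<lambda>t. proj Z2 (g1 t)) (\<lambda>t. proj Z2 (g2 t))"
    by (rule generate_H1_if_zbasis[OF g1(1) g2(1)]) (use g1 g2 b in auto)
  ultimately show ?thesis using g1(3) g2(3) e by fastforce
qed

end

section \<open>Lifts of smooth maps and parallelogram norms\<close>

lemma Z2_valued_constant:
  fixes f :: "'a::real_normed_vector \<Rightarrow> real^2"
  assumes S: "connected S" and f: "continuous_on S f" and Z: "\<And>x. x \<in> S \<Longrightarrow> f x \<in> Z2"
    and xy: "x \<in> S" "y \<in> S"
  shows "f x = f y"
proof -
  have "f x $ i = f y $ i" for i
  proof -
    have "(\<lambda>x. f x $ i) constant_on S"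
    proof (rule continuous_discrete_range_constant[OF S])
      show "continuous_on S (\<lambda>x. f x $ i)" using f by (intro continuous_intros)
      show "\<exists>e>0. \<forall>y. y \<in> S \<and> f y $ i \<noteq> f x $ i \<longrightarrow> e \<le> norm (f y $ i - f x $ i)" if x: "x \<in> S" for x
      proof (intro exI[of _ 1] conjI allI impI)
        fix y assume y: "y \<in> S \<and> f y $ i \<noteq> f x $ i"
        have "f y $ i - f x $ i \<in> \<int>" using Z[OF x] Z[of y] y by (simp add: Z2_def)
        then show "1 \<le> norm (f y $ i - f x $ i)" using y Ints_nonzero_abs_ge1 by fastforce
      qed simp
    qed
    then show ?thesis using xy by (auto simp: constant_on_def)
  qed
  then show ?thesis by (simp add: vec_eq_iff)
qed

section \<open>Calculus with iterated derivatives\<close>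

lemma Ck_on_continuous: "Ck_on k f S \<Longrightarrow> continuous_on S f"
  by (cases k) (auto simp: continuous_at_imp_continuous_on differentiable_imp_continuous_within)

lemma Ck_on_cong:
  "open U \<Longrightarrow> (\<And>y. y \<in> U \<Longrightarrow> f y = g y) \<Longrightarrow> Ck_on k f U \<Longrightarrow> Ck_on k g U"
proof (induction k arbitrary: f g)
  case 0
  then show ?case using continuous_on_cong[of U U f g] by auto
next
  case (Suc k)
  have d: "(g has_derivative frechet_derivative f (at y)) (at y)" if y: "y \<in> U" for y
  proof -
    have "(f has_derivative frechet_derivative f (at y)) (at y)"
      using Suc.prems(3) y by (simp flip: frechet_derivative_works)
    then show ?thesis
      by (rule has_derivative_transform_within_open[OF _ Suc.prems(1) y Suc.prems(2)])
  qed
  have fd: "frechet_derivative f (at y) = frechet_derivative g (at y)" if "y \<in> U" for y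
    using frechet_derivative_at[OF d[OF that]] .
  show ?case
    unfolding Ck_on.simps
  proof (intro conjI ballI allI)
    show "g differentiable at y" if "y \<in> U" for y using d[OF that] by (rule differentiableI)
    fix w
    have "Ck_on k (\<lambda>x. frechet_derivative f (at x) w) U" using Suc.prems(3) by simp
    then show "Ck_on k (\<lambda>x. frechet_derivative g (at x) w) U"
      by (rule Suc.IH[OF Suc.prems(1), rotated]) (simp add: fd)
  qed
qed

text \<open>The additive constant serves to translate a lift by a lattice vector; it drops out after
  one derivative.\<close>

lemma Ck_on_linear_post:
  assumes A: "bounded_linear A"
  shows "open U \<Longrightarrow> Ck_on k h U \<Longrightarrow> Ck_on k (\<lambda>y. A (h y) + c) U"
proof (induction k arbitrary: h c)
  case 0
  then show ?case by (auto intro!: continuous_intros bounded_linear.continuous_on[OF A])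
next
  case (Suc k)
  have d: "((\<lambda>y. A (h y) + c) has_derivative (\<lambda>w. A (frechet_derivative h (at y) w))) (at y)" if y: "y \<in> U" for y
  proof -
    have "(h has_derivative frechet_derivative h (at y)) (at y)"
      using Suc.prems(2) y by (simp flip: frechet_derivative_works)
    from bounded_linear.has_derivative[OF A this]
    show ?thesis by (auto intro!: derivative_eq_intros)
  qed
  have fd: "frechet_derivative (\<lambda>y. A (h y) + c) (at y) = (\<lambda>w. A (frechet_derivative h (at y) w))" if "y \<in> U" for y
    using frechet_derivative_at[OF d[OF that]] by metis
  show ?case
    unfolding Ck_on.simps
  proof (intro conjI ballI allI)
    show "(\<lambda>y. A (h y) + c) differentiable at y" if "y \<in> U" for y using d[OF that] by (rule differentiableI)
    fix w
    have "Ck_on k (\<lambda>x. frechet_derivative h (at x) w) U" using Suc.prems(2) by simp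
    from Suc.IH[OF Suc.prems(1) this, of 0]
    show "Ck_on k (\<lambda>x. frechet_derivative (\<lambda>y. A (h y) + c) (at x) w) U"
      by (rule Ck_on_cong[OF Suc.prems(1), rotated]) (simp add: fd)
  qed
qed

lemma Ck_on_linear_pre:
  assumes A: "bounded_linear A"
  shows "open U \<Longrightarrow> Ck_on k h U \<Longrightarrow> Ck_on k (\<lambda>t. h (A t)) (A -` U)"
proof (induction k arbitrary: h)
  case 0
  have "continuous_on (A -` U) A" using A by (rule linear_continuous_on)
  then show ?case using 0(2) continuous_on_compose2[of U h "A -` U" A] by auto
next
  case (Suc k)
  have oA: "open (A -` U)"
    using Suc.prems(1) A by (intro open_vimage linear_continuous_on)
  have d: "((\<lambda>t. h (A t)) has_derivative (\<lambda>w. frechet_derivative h (at (A t)) (A w))) (at t)" if t: "t \<in> A -` U" for t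
  proof -
    have "(h has_derivative frechet_derivative h (at (A t))) (at (A t))"
      using Suc.prems(2) t by (simp flip: frechet_derivative_works)
    then show ?thesis
      by (rule has_derivative_compose[OF bounded_linear_imp_has_derivative[OF A]])
  qed
  have fd: "frechet_derivative (\<lambda>t. h (A t)) (at t) = (\<lambda>w. frechet_derivative h (at (A t)) (A w))" if "t \<in> A -` U" for t
    using frechet_derivative_at[OF d[OF that]] by metis
  show ?case
    unfolding Ck_on.simps
  proof (intro conjI ballI allI)
    show "(\<lambda>t. h (A t)) differentiable at t" if "t \<in> A -` U" for t using d[OF that] by (rule differentiableI)
    fix w
    have "Ck_on k (\<lambda>x. frechet_derivative h (at x) (A w)) U" using Suc.prems(2) by simp
    from Suc.IH[OF Suc.prems(1) this]
    show "Ck_on k (\<lambda>x. frechet_derivative (\<lambda>t. h (A t)) (at x) w) (A -` U)"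
      by (rule Ck_on_cong[OF oA, rotated]) (simp add: fd)
  qed
qed

lemma smooth_on_linear_post:
  assumes "bounded_linear A" "open U" "smooth_on h U"
  shows "smooth_on (\<lambda>y. A (h y)) U"
  using Ck_on_linear_post[OF assms(1,2), of _ h 0] assms(3) by (simp add: smooth_on_def)

lemma smooth_on_linear_pre:
  assumes "bounded_linear A" "open U" "smooth_on h U"
  shows "smooth_on (\<lambda>t. h (A t)) (A -` U)"
  using Ck_on_linear_pre[OF assms(1,2)] assms(3) unfolding smooth_on_def by blast

lemma Ck_on_local:
  "(\<And>x. x \<in> S \<Longrightarrow> \<exists>U. open U \<and> x \<in> U \<and> Ck_on k f U) \<Longrightarrow> Ck_on k f S"
proof (induction k arbitrary: f)
  case 0
  have "isCont f x" if "x \<in> S" for x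
    using 0[OF that] by (auto simp: continuous_on_eq_continuous_at)
  then show ?case by (simp add: continuous_at_imp_continuous_on)
next
  case (Suc k)
  show ?case
    unfolding Ck_on.simps
  proof (intro conjI ballI allI)
    fix x assume "x \<in> S"
    from Suc.prems[OF this] obtain U where "x \<in> U" "Ck_on (Suc k) f U"
      by (elim exE conjE)
    then show "f differentiable at x" by simp
  next
    fix w
    show "Ck_on k (\<lambda>x. frechet_derivative f (at x) w) S"
    proof (rule Suc.IH)
      fix x assume "x \<in> S"
      from Suc.prems[OF this] obtain U where U: "open U" "x \<in> U" "Ck_on (Suc k) f U"
        by (elim exE conjE)
      from U(3) have "Ck_on k (\<lambda>x. frechet_derivative f (at x) w) U" by simp
      with U(1,2) show "\<exists>U. open U \<and> x \<in> U \<and> Ck_on k (\<lambda>x. frechet_derivative f (at x) w) U"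
        by (intro exI conjI)
    qed
  qed
qed

lemma Ck_on_subset: "Ck_on k f S \<Longrightarrow> T \<subseteq> S \<Longrightarrow> Ck_on k f T"
  by (induction k arbitrary: f) (auto intro: continuous_on_subset)

text \<open>The plane is contractible, so a continuous global lift exists; near each point it
  differs from a smooth local lift by a continuous lattice-valued, hence constant, function.\<close>

lemma global_lift:
  fixes f :: "(real^2) set \<Rightarrow> (real^2) set"
  assumes f: "\<And>x. \<exists>U h. open U \<and> x \<in> U \<and> smooth_on h U \<and> (\<forall>y\<in>U. f (proj Z2 y) = proj Z2 (h y))"
  shows "\<exists>H. smooth_on H UNIV \<and> (\<forall>y. f (proj Z2 y) = proj Z2 (H y))"
proof -
  have c: "continuous_on UNIV (\<lambda>x. circle_coord j (f (proj Z2 x)))" for j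
  proof (rule continuous_at_imp_continuous_on, rule ballI)
    fix x :: "real^2"
    from f[of x] obtain U h where U: "open U" "x \<in> U" "smooth_on h U" "\<forall>y\<in>U. f (proj Z2 y) = proj Z2 (h y)"
      by (elim exE conjE)
    have "continuous_on U (\<lambda>y. exp (of_real (2 * pi * (h y $ j)) * \<i>))"
      using Ck_on_continuous[OF U(3)[unfolded smooth_on_def, rule_format]] by (intro continuous_intros)
    then have "continuous_on U (\<lambda>y. circle_coord j (f (proj Z2 y)))"
      by (rule continuous_on_eq) (simp add: U(4)[rule_format] circle_coord_proj)
    then show "isCont (\<lambda>y. circle_coord j (f (proj Z2 y))) x"
      unfolding continuous_on_eq_continuous_at[OF U(1)] using U(2) by (rule bspec)
  qed
  have "f (proj Z2 x) \<in> plane_mod Z2" for x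
  proof -
    from f[of x] obtain U h where "x \<in> U" "\<forall>y\<in>U. f (proj Z2 y) = proj Z2 (h y)"
      by (elim exE conjE)
    then show ?thesis by (simp add: plane_mod_def)
  qed
  then have im: "(\<lambda>x. f (proj Z2 x)) ` UNIV \<subseteq> plane_mod Z2" by blast
  obtain H where H: "continuous_on UNIV H" "\<And>x. proj Z2 (H x) = f (proj Z2 x)"
    using lift_exists[OF convex_imp_contractible[OF convex_UNIV] im c] by auto
  have "Ck_on k H UNIV" for k
  proof (rule Ck_on_local)
    fix x :: "real^2"
    from f[of x] obtain U h where U: "open U" "x \<in> U" "smooth_on h U" "\<forall>y\<in>U. f (proj Z2 y) = proj Z2 (h y)"
      by (elim exE conjE)
    obtain e where e: "e > 0" "ball x e \<subseteq> U" using U openE by blast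
    have hB: "Ck_on k h (ball x e)"
      by (rule Ck_on_subset[OF U(3)[unfolded smooth_on_def, rule_format] e(2)])
    have "H y - h y = H x - h x" if y: "y \<in> ball x e" for y
    proof (rule Z2_valued_constant[of "ball x e" "\<lambda>y. H y - h y"])
      show "continuous_on (ball x e) (\<lambda>y. H y - h y)"
        using H(1) Ck_on_continuous[OF hB] by (intro continuous_intros) (auto intro: continuous_on_subset)
      show "H z - h z \<in> Z2" if "z \<in> ball x e" for z
        using H(2)[of z] bspec[OF U(4), of z] e that by (auto simp flip: proj_Z2_eq_iff)
    qed (use y e in auto)
    then have "h y + (H x - h x) = H y" if "y \<in> ball x e" for y using that by (simp add: algebra_simps)
    moreover have "Ck_on k (\<lambda>y. h y + (H x - h x)) (ball x e)"
      using Ck_on_linear_post[OF bounded_linear_ident open_ball hB] .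
    ultimately have "Ck_on k H (ball x e)" by (rule Ck_on_cong[OF open_ball])
    then show "\<exists>U. open U \<and> x \<in> U \<and> Ck_on k H U" using e by (intro exI[of _ "ball x e"]) auto
  qed
  then have "smooth_on H UNIV" by (simp add: smooth_on_def)
  then show ?thesis by (intro exI[of _ H]) (simp add: H(2))
qed

text \<open>\<open>H (x + k) - H x\<close> is continuous in \<open>x\<close> and lattice-valued,
  hence constant. The vectors \<open>H k - H 0\<close> describe the action on the fundamental
  group.\<close>

lemma lift_equivariant:
  assumes H: "continuous_on UNIV H" "\<And>y :: real^2. f (proj Z2 y) = proj Z2 (H y)" and k: "k \<in> Z2"
  shows "H (x + k) = H x + (H k - H 0)" and "H k - H 0 \<in> Z2"
proof -
  have Z: "H (y + k) - H y \<in> Z2" for y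
    using H(2)[of "y + k"] H(2)[of y] proj_Z2_add[OF k, of y] by (simp flip: proj_Z2_eq_iff)
  have "continuous_on UNIV (\<lambda>y. H (y + k))"
    by (rule continuous_on_compose2[OF H(1)]) (auto intro!: continuous_intros)
  then have "continuous_on UNIV (\<lambda>y. H (y + k) - H y)"
    using H(1) by (intro continuous_intros)
  from Z2_valued_constant[OF connected_UNIV this Z, of x 0]
  show "H (x + k) = H x + (H k - H 0)" by (simp add: algebra_simps)
  show "H k - H 0 \<in> Z2" using Z[of 0] by simp
qed

lemma additive_on_Z2_int:
  assumes add: "\<And>k l. k \<in> Z2 \<Longrightarrow> l \<in> Z2 \<Longrightarrow> A (k + l) = A k + A l" and k: "k \<in> Z2"
  shows "A (of_int n *\<^sub>R k) = of_int n *\<^sub>R (A k :: real^2)"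
proof -
  have A0: "A 0 = 0" using add[OF Z2_0 Z2_0] by simp
  show ?thesis
  proof (induction n rule: int_induct[where k = 0])
    case (step1 i)
    have "of_int (i + 1) *\<^sub>R k = of_int i *\<^sub>R k + k" by (simp add: algebra_simps)
    then show ?case using step1 add[of "of_int i *\<^sub>R k" k] k by (simp add: Z2_scale algebra_simps)
  next
    case (step2 i)
    have "of_int i *\<^sub>R k = of_int (i - 1) *\<^sub>R k + k" by (simp add: algebra_simps)
    then have "A (of_int i *\<^sub>R k) = A (of_int (i - 1) *\<^sub>R k) + A k"
      using add[of "of_int (i - 1) *\<^sub>R k" k] k by (simp add: Z2_scale)
    then show ?case using step2 by (simp add: algebra_simps)
  qed (simp add: A0)
qed

lemma additive_on_Z2_cr:
  assumes add: "\<And>k l. k \<in> Z2 \<Longrightarrow> l \<in> Z2 \<Longrightarrow> A (k + l) = A k + A l" and xy: "x \<in> Z2" "y \<in> Z2"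
  shows "cr (A x) (A y) = cr x y * cr (A (axis 1 1)) (A (axis 2 1))"
proof -
  have ex: "A z = z $ 1 *\<^sub>R A (axis 1 1) + z $ 2 *\<^sub>R A (axis 2 1)" if z: "z \<in> Z2" for z
  proof -
    obtain m n :: int where mn: "z $ 1 = of_int m" "z $ 2 = of_int n"
      using z unfolding Z2_def by (metis (mono_tags, lifting) Ints_cases mem_Collect_eq)
    have "z = of_int m *\<^sub>R axis 1 1 + of_int n *\<^sub>R axis 2 1"
      using mn by (simp add: vec_eq_iff forall_2 axis_def)
    then have "A z = A (of_int m *\<^sub>R axis 1 1) + A (of_int n *\<^sub>R axis 2 1)"
      using add Z2_scale[OF Z2_axis] by simp
    then show ?thesis using mn by (simp add: additive_on_Z2_int[OF add Z2_axis])
  qed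
  show ?thesis
    unfolding ex[OF xy(1)] ex[OF xy(2)]
    using cr_swap[of "A (axis 2 1)" "A (axis 1 1)"]
    by (simp add: cr_add_left cr_add_right) (simp add: cr_def algebra_simps)
qed

lemma cr_axis: "cr (axis 1 1) (axis 2 1) = 1"
  by (simp add: cr_def axis_def)

section \<open>Parallelogram norms and their dual balls\<close>

lemma is_basis_cr:
  assumes "is_basis p q"
  shows "cr p q \<noteq> 0"
proof
  assume c: "cr p q = 0"
  have pq: "p \<noteq> q" "independent {p, q}" using assms by (auto simp: is_basis_def)
  then have "p \<noteq> 0" using dependent_zero by auto
  have "q \<in> span {p}"
  proof (cases "p $ 1 = 0")
    case True
    then have "p $ 2 \<noteq> 0" using \<open>p \<noteq> 0\<close> by (auto simp: vec_eq_iff forall_2)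
    then have "q = (q $ 2 / p $ 2) *\<^sub>R p" using c True by (simp add: vec_eq_iff forall_2 cr_def)
    then show ?thesis by (metis span_base span_scale singletonI)
  next
    case False
    then have "q = (q $ 1 / p $ 1) *\<^sub>R p" using c by (simp add: vec_eq_iff forall_2 cr_def field_simps)
    then show ?thesis by (metis span_base span_scale singletonI)
  qed
  moreover have "{p, q} - {q} = {p}" using pq by auto
  ultimately have "dependent {p, q}" unfolding dependent_def by (intro bexI[of _ q]) auto
  then show False using pq by simp
qed

text \<open>A norm is even, so the parallelogram is centred at the origin: in the coordinates of
  \<open>p\<close>, \<open>q\<close> its corner \<open>z\<close> is
  \<open>(- 1 / 2, - 1 / 2)\<close>. Half a side is then a unit vector.\<close>

lemma parallelogram_norm:
  assumes N: "is_norm N" and pq: "cr p q \<noteq> 0" and P: "{x. N x \<le> 1} = parallelogram z p q"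
  shows "N x \<le> 1 \<longleftrightarrow> (\<exists>s t. \<bar>s\<bar> \<le> 1 / 2 \<and> \<bar>t\<bar> \<le> 1 / 2 \<and> x = s *\<^sub>R p + t *\<^sub>R q)"
    and "N p = 2" and "N q = 2"
proof -
  have scale: "N (c *\<^sub>R x) = \<bar>c\<bar> * N x" for c x using N by (simp add: is_norm_def)
  have nneg: "N x \<ge> 0" for x using N by (simp add: is_norm_def)
  have minus: "N (- x) = N x" for x using scale[of "-1" x] by simp
  have coord: "s = s' \<and> t = t'" if "s *\<^sub>R p + t *\<^sub>R q = s' *\<^sub>R p + t' *\<^sub>R q" for s t s' t'
  proof -
    have "cr (s *\<^sub>R p + t *\<^sub>R q) q = cr (s' *\<^sub>R p + t' *\<^sub>R q) q"
      "cr p (s *\<^sub>R p + t *\<^sub>R q) = cr p (s' *\<^sub>R p + t' *\<^sub>R q)" using that by simp_all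
    then show ?thesis using pq by (simp add: cr_add_left cr_add_right)
  qed
  define \<sigma> \<tau> where "\<sigma> = cr z q / cr p q" and "\<tau> = cr p z / cr p q"
  have z: "z = \<sigma> *\<^sub>R p + \<tau> *\<^sub>R q"
  proof -
    have "(1 / cr p q) *\<^sub>R (cr p q *\<^sub>R z) = (1 / cr p q) *\<^sub>R (cr z q *\<^sub>R p + cr p z *\<^sub>R q)"
      by (rule arg_cong[OF cr_expand])
    then show ?thesis using pq by (simp add: \<sigma>_def \<tau>_def scaleR_add_right)
  qed
  have mem: "N (s *\<^sub>R p + t *\<^sub>R q) \<le> 1 \<longleftrightarrow> \<sigma> \<le> s \<and> s \<le> \<sigma> + 1 \<and> \<tau> \<le> t \<and> t \<le> \<tau> + 1" for s t
  proof -
    have "N (s *\<^sub>R p + t *\<^sub>R q) \<le> 1 \<longleftrightarrow> s *\<^sub>R p + t *\<^sub>R q \<in> parallelogram z p q" using P by blast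
    also have "\<dots> \<longleftrightarrow> (\<exists>a b. 0 \<le> a \<and> a \<le> 1 \<and> 0 \<le> b \<and> b \<le> 1 \<and> s = \<sigma> + a \<and> t = \<tau> + b)"
    proof -
      have "s *\<^sub>R p + t *\<^sub>R q = z + a *\<^sub>R p + b *\<^sub>R q \<longleftrightarrow> s = \<sigma> + a \<and> t = \<tau> + b" for a b
        using coord[of s t "\<sigma> + a" "\<tau> + b"] unfolding z by (auto simp: algebra_simps)
      then show ?thesis unfolding parallelogram_def by auto
    qed
    also have "\<dots> \<longleftrightarrow> \<sigma> \<le> s \<and> s \<le> \<sigma> + 1 \<and> \<tau> \<le> t \<and> t \<le> \<tau> + 1"
    proof
      assume "\<sigma> \<le> s \<and> s \<le> \<sigma> + 1 \<and> \<tau> \<le> t \<and> t \<le> \<tau> + 1"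
      then show "\<exists>a b. 0 \<le> a \<and> a \<le> 1 \<and> 0 \<le> b \<and> b \<le> 1 \<and> s = \<sigma> + a \<and> t = \<tau> + b"
        by (intro exI[of _ "s - \<sigma>"] exI[of _ "t - \<tau>"]) auto
    qed auto
    finally show ?thesis .
  qed
  have sym: "N ((- s) *\<^sub>R p + (- t) *\<^sub>R q) = N (s *\<^sub>R p + t *\<^sub>R q)" for s t
    using minus[of "s *\<^sub>R p + t *\<^sub>R q"] by (simp add: algebra_simps)
  have half: "\<sigma> = - 1 / 2" "\<tau> = - 1 / 2"
  proof -
    \<comment> \<open>Two opposite corners lie in the ball, so their negatives do too; the resulting
      bounds leave one value for each coordinate.\<close>
    have "N (\<sigma> *\<^sub>R p + \<tau> *\<^sub>R q) \<le> 1" "N ((\<sigma> + 1) *\<^sub>R p + (\<tau> + 1) *\<^sub>R q) \<le> 1" by (simp_all only: mem) simp_all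
    then have "N ((- \<sigma>) *\<^sub>R p + (- \<tau>) *\<^sub>R q) \<le> 1" "N ((- (\<sigma> + 1)) *\<^sub>R p + (- (\<tau> + 1)) *\<^sub>R q) \<le> 1"
      by (simp_all only: sym)
    then show "\<sigma> = - 1 / 2" "\<tau> = - 1 / 2" unfolding mem by linarith+
  qed
  have mem': "N (s *\<^sub>R p + t *\<^sub>R q) \<le> 1 \<longleftrightarrow> \<bar>s\<bar> \<le> 1 / 2 \<and> \<bar>t\<bar> \<le> 1 / 2" for s t
    unfolding mem half by auto
  have "\<exists>s t. x = s *\<^sub>R p + t *\<^sub>R q"
  proof -
    have "(1 / cr p q) *\<^sub>R (cr p q *\<^sub>R x) = (1 / cr p q) *\<^sub>R (cr x q *\<^sub>R p + cr p x *\<^sub>R q)"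
      by (rule arg_cong[OF cr_expand])
    then show ?thesis using pq by (auto simp: scaleR_add_right)
  qed
  then show "N x \<le> 1 \<longleftrightarrow> (\<exists>s t. \<bar>s\<bar> \<le> 1 / 2 \<and> \<bar>t\<bar> \<le> 1 / 2 \<and> x = s *\<^sub>R p + t *\<^sub>R q)"
    using mem' by metis
  have two: "N w = 2" if w: "\<And>c. N (c *\<^sub>R w) \<le> 1 \<longleftrightarrow> \<bar>c\<bar> \<le> 1 / 2" for w
  proof -
    have "N ((1 / 2) *\<^sub>R w) \<le> 1" using w[of "1 / 2"] by simp
    then have le: "N w \<le> 2" by (simp add: scale)
    have "N w \<noteq> 0"
    proof
      assume "N w = 0"
      then have "N (1 *\<^sub>R w) \<le> 1" by (simp add: scale)
      then show False using w[of 1] by simp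
    qed
    then have pos: "N w > 0" using nneg[of w] by simp
    then have "N ((1 / N w) *\<^sub>R w) \<le> 1" by (simp add: scale)
    then have "1 / N w \<le> 1 / 2" using w[of "1 / N w"] pos by simp
    then show ?thesis using le pos by (simp add: field_simps)
  qed
  show "N p = 2" by (rule two) (use mem'[of _ 0] in simp)
  show "N q = 2" by (rule two) (use mem'[of 0] in simp)
qed

text \<open>A linear functional attains its maximum over the parallelogram at the corner whose
  coordinate signs match its values on \<open>p\<close> and \<open>q\<close>.\<close>

lemma dual_ball_parallelogram:
  assumes unit: "\<And>v. G x v \<le> 1 \<longleftrightarrow> (\<exists>s t. \<bar>s\<bar> \<le> 1 / 2 \<and> \<bar>t\<bar> \<le> 1 / 2 \<and> v = s *\<^sub>R p + t *\<^sub>R q)"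
  shows "dual_ball G x = {\<xi>. \<bar>\<xi> \<bullet> p\<bar> + \<bar>\<xi> \<bullet> q\<bar> \<le> 2}"
proof -
  have *: "dual_norm G x \<xi> = (\<bar>\<xi> \<bullet> p\<bar> + \<bar>\<xi> \<bullet> q\<bar>) / 2" for \<xi>
    unfolding dual_norm_def
  proof (rule cSup_eq_maximum)
    define s t where "s = (if \<xi> \<bullet> p \<ge> 0 then 1 / 2 else - 1 / 2 :: real)" and "t = (if \<xi> \<bullet> q \<ge> 0 then 1 / 2 else - 1 / 2 :: real)"
    have "\<bar>s\<bar> \<le> 1 / 2" "\<bar>t\<bar> \<le> 1 / 2" by (auto simp: s_def t_def)
    then have "G x (s *\<^sub>R p + t *\<^sub>R q) \<le> 1" unfolding unit by blast
    moreover have "\<xi> \<bullet> (s *\<^sub>R p + t *\<^sub>R q) = (\<bar>\<xi> \<bullet> p\<bar> + \<bar>\<xi> \<bullet> q\<bar>) / 2"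
      by (auto simp: inner_add_right s_def t_def)
    ultimately show "(\<bar>\<xi> \<bullet> p\<bar> + \<bar>\<xi> \<bullet> q\<bar>) / 2 \<in> (\<lambda>v. \<xi> \<bullet> v) ` {v. G x v \<le> 1}"
      by (metis (mono_tags, lifting) image_eqI mem_Collect_eq)
  next
    fix y assume "y \<in> (\<lambda>v. \<xi> \<bullet> v) ` {v. G x v \<le> 1}"
    then obtain s t where st: "\<bar>s\<bar> \<le> 1 / 2" "\<bar>t\<bar> \<le> 1 / 2" "y = \<xi> \<bullet> (s *\<^sub>R p + t *\<^sub>R q)"
      by (auto simp: unit)
    have "s * (\<xi> \<bullet> p) \<le> \<bar>s\<bar> * \<bar>\<xi> \<bullet> p\<bar>" "t * (\<xi> \<bullet> q) \<le> \<bar>t\<bar> * \<bar>\<xi> \<bullet> q\<bar>"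
      by (simp_all flip: abs_mult)
    moreover have "\<bar>s\<bar> * \<bar>\<xi> \<bullet> p\<bar> \<le> 1 / 2 * \<bar>\<xi> \<bullet> p\<bar>" "\<bar>t\<bar> * \<bar>\<xi> \<bullet> q\<bar> \<le> 1 / 2 * \<bar>\<xi> \<bullet> q\<bar>"
      using st by (intro mult_right_mono; simp)+
    ultimately show "y \<le> (\<bar>\<xi> \<bullet> p\<bar> + \<bar>\<xi> \<bullet> q\<bar>) / 2"
      unfolding st(3) by (simp add: inner_add_right)
  qed
  show ?thesis unfolding dual_ball_def * by simp
qed

section \<open>The equality case\<close>

lemma linear_axis_expand:
  fixes f :: "real^2 \<Rightarrow> real^2"
  assumes "linear f"
  shows "f w = w $ 1 *\<^sub>R f (axis 1 1) + w $ 2 *\<^sub>R f (axis 2 1)"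
proof -
  have "w = w $ 1 *\<^sub>R axis 1 1 + w $ 2 *\<^sub>R axis 2 1"
    by (simp add: vec_eq_iff forall_2 axis_def)
  then have "f w = f (w $ 1 *\<^sub>R axis 1 1 + w $ 2 *\<^sub>R axis 2 1)" by simp
  then show ?thesis by (simp add: linear_add[OF assms] linear_scale[OF assms])
qed

lemma cr_linear:
  assumes "linear f"
  shows "cr (f a) (f b) = cr (f (axis 1 1)) (f (axis 2 1)) * cr a b"
  unfolding linear_axis_expand[OF assms, of a] linear_axis_expand[OF assms, of b]
  by (simp add: cr_def algebra_simps)

lemma Ints_mult_eq_1:
  fixes a b :: real
  assumes "a \<in> \<int>" "b \<in> \<int>" "a * b = 1"
  shows "\<bar>a\<bar> = 1"
proof -
  obtain m n :: int where mn: "a = of_int m" "b = of_int n" using assms by (auto elim!: Ints_cases)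
  then have "real_of_int (m * n) = 1" using assms(3) by simp
  then have "m * n = 1" by linarith
  then have "\<bar>m\<bar> = 1" by (metis abs_zmult_eq_1 abs_one)
  then show ?thesis unfolding mn by (metis of_int_1 of_int_abs)
qed

text \<open>A continuous function without zeros has constant sign, since the plane is
  connected.\<close>

lemma integral_abs_nonzero:
  fixes J :: "real^2 \<Rightarrow> real"
  assumes c: "continuous_on UNIV J" and nz: "\<And>x. J x \<noteq> 0"
  shows "integral (cbox 0 1) (\<lambda>x. \<bar>J x\<bar>) = \<bar>integral (cbox 0 1) J\<bar>"
proof -
  have conn: "connected (range J)" by (rule connected_continuous_image[OF c connected_UNIV])
  have int: "J integrable_on cbox 0 1" by (rule integrable_continuous[OF continuous_on_subset[OF c]]) simp
  have sgn: "(\<forall>x. J x > 0) \<or> (\<forall>x. J x < 0)"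
  proof (rule ccontr)
    assume "\<not> ?thesis"
    then obtain x y where "J x \<le> 0" "0 \<le> J y" by (auto simp: not_less)
    then have "0 \<in> range J" using connectedD_interval[OF conn, of "J x" "J y" 0] by blast
    then show False using nz by auto
  qed
  then show ?thesis
  proof
    assume pos: "\<forall>x. J x > 0"
    then have "0 \<le> integral (cbox 0 1) J" by (intro integral_nonneg int) (simp add: less_imp_le)
    moreover have "(\<lambda>x. \<bar>J x\<bar>) = J" using pos by (simp add: fun_eq_iff abs_of_pos)
    ultimately show ?thesis by simp
  next
    assume neg: "\<forall>x. J x < 0"
    have eq: "(\<lambda>x. \<bar>J x\<bar>) = (\<lambda>x. - J x)" using neg by (simp add: fun_eq_iff abs_of_neg)
    have "0 \<le> integral (cbox 0 1) (\<lambda>x. - J x)"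
      using neg by (intro integral_nonneg integrable_neg int) (simp add: less_imp_le)
    then show ?thesis unfolding eq by simp
  qed
qed

text \<open>The Jacobian determinant is the wedge of the differentials of the two components of
  \<open>H\<close>, so \<open>degree_unit_square\<close> applies.\<close>

lemma integral_jacobian:
  fixes H :: "real^2 \<Rightarrow> real^2"
  assumes H: "smooth_on H UNIV" and per: "\<And>x i. H (x + axis i 1) = H x + a i"
  defines "J \<equiv> (\<lambda>x. cr (frechet_derivative H (at x) (axis 1 1)) (frechet_derivative H (at x) (axis 2 1)))"
  shows "continuous_on UNIV J" and "integral (cbox 0 1) J = cr (a 1) (a 2)"
proof -
  define D where "D x = frechet_derivative H (at x)" for x
  have H2: "Ck_on (Suc (Suc 0)) H UNIV" using H unfolding smooth_on_def by blast
  have dH: "(H has_derivative D x) (at x)" for x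
    using H2 unfolding D_def by (simp flip: frechet_derivative_works)
  have "Ck_on (Suc 0) (\<lambda>x. D x w) UNIV" for w using H2 unfolding D_def by simp
  then have d2: "((\<lambda>x. D x w) has_derivative frechet_derivative (\<lambda>x. D x w) (at x)) (at x)"
    and c2: "continuous_on UNIV (\<lambda>x. frechet_derivative (\<lambda>x. D x w) (at x) z)" for w x z
    by (simp_all flip: frechet_derivative_works)
  have Dc: "continuous_on UNIV (\<lambda>x. D x w)" for w
    using d2 has_derivative_continuous by (blast intro: continuous_at_imp_continuous_on)
  show "continuous_on UNIV J"
    unfolding J_def D_def[symmetric] cr_def by (intro continuous_intros Dc)
  define f' where "f' i x = (vector [D x (axis 1 1) $ i, D x (axis 2 1) $ i] :: real^2)" for i x
  define m where "m x = frechet_derivative (\<lambda>x. D x (axis 2 1)) (at x) (axis 1 1) $ 2" for x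
  have df: "((\<lambda>x. H x $ i) has_derivative (\<lambda>w. f' i x \<bullet> w)) (at x)" for i x
  proof -
    have lin: "linear (D x)" using dH by (rule has_derivative_linear)
    have "D x w $ i = f' i x \<bullet> w" for w
      by (subst linear_axis_expand[OF lin]) (simp add: f'_def inner_2 mult.commute)
    then show ?thesis
      using bounded_linear.has_derivative[OF bounded_linear_vec_nth dH, of i x] by simp
  qed
  \<comment> \<open>The differential of component \<open>i\<close> collects the \<open>i\<close>-th
    entries of the images of the axes, so rows and columns are interchanged; the determinant is the
    same.\<close>
  have "integral (cbox 0 1) (\<lambda>x. cr (f' 1 x) (f' 2 x)) = cr (\<chi> i. a i $ 1) (\<chi> i. a i $ 2)"
  proof (rule degree_unit_square[OF df df])
    show "continuous_on UNIV (f' 1)" "continuous_on UNIV (f' 2)"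
      unfolding f'_def[abs_def] by (intro continuous_intros Dc)+
    show "continuous_on UNIV m" unfolding m_def[abs_def] by (intro continuous_intros c2)
    show "((\<lambda>s. f' 2 (vector [s, b]) $ 2) has_real_derivative m (vector [t, b])) (at t)" for t b
    proof -
      have L: "((\<lambda>s. vector [s, b] :: real^2) has_derivative (\<lambda>h. h *\<^sub>R axis 1 1)) (at t)"
        unfolding vector2_eq by (auto intro!: derivative_eq_intros)
      define D2 where "D2 = frechet_derivative (\<lambda>x. D x (axis 2 1)) (at (vector [t, b]))"
      have D2: "((\<lambda>x. D x (axis 2 1)) has_derivative D2) (at (vector [t, b]))"
        unfolding D2_def by (rule d2)
      have "((\<lambda>x. D x (axis 2 1) $ 2) has_derivative (\<lambda>h. D2 h $ 2)) (at (vector [t, b]))"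
        by (rule bounded_linear.has_derivative[OF bounded_linear_vec_nth D2])
      from has_derivative_compose[OF L this]
      have "((\<lambda>s. D (vector [s, b]) (axis 2 1) $ 2) has_derivative (\<lambda>h. D2 (h *\<^sub>R axis 1 1) $ 2)) (at t)" .
      moreover have "(\<lambda>h. D2 (h *\<^sub>R axis 1 1) $ 2) = (*) (D2 (axis 1 1) $ 2)"
        using has_derivative_linear[OF D2] by (auto simp: linear_scale fun_eq_iff)
      ultimately show ?thesis
        by (simp add: has_field_derivative_def f'_def m_def D2_def)
    qed
  qed (simp_all add: per)
  then show "integral (cbox 0 1) J = cr (a 1) (a 2)"
    unfolding J_def D_def[symmetric] by (simp add: f'_def cr_def mult.commute)
qed

lemma smooth_closed_curve:
  assumes "smooth_on c UNIV" "proj Z2 (c 0) = proj Z2 (c (1 :: real))"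
  shows "closed_curve 0 1 (\<lambda>t. proj Z2 (c t))"
proof -
  have "smooth_arc 0 1 (\<lambda>t. proj Z2 (c t))"
    unfolding smooth_arc_def using assms(1) by (intro ballI exI[of _ UNIV] exI[of _ c]) auto
  then have "piecewise_smooth_curve 0 1 (\<lambda>t. proj Z2 (c t))"
    unfolding piecewise_smooth_curve_def by (intro exI[of _ "[0, 1]"]) auto
  then show ?thesis using assms(2) by (simp add: closed_curve_def)
qed

text \<open>\<open>H\<close> and \<open>K\<close> lift \<open>\<Phi>\<close> and its inverse, read in the coordinates of the basis \<open>u\<close>, \<open>v\<close>.\<close>

lemma homothety_lifts:
  assumes uv: "is_basis u v" and hom: "homothety Z2 G (lattice_gen u v) (\<lambda>_. N) r \<Phi>"
  obtains H K where "smooth_on H UNIV" "smooth_on K UNIV"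
    "\<And>x k. k \<in> Z2 \<Longrightarrow> H (x + k) = H x + (H k - H 0)" "\<And>k. k \<in> Z2 \<Longrightarrow> H k - H 0 \<in> Z2"
    "\<And>x k. k \<in> Z2 \<Longrightarrow> K (x + k) = K x + (K k - K 0)" "\<And>k. k \<in> Z2 \<Longrightarrow> K k - K 0 \<in> Z2"
    "\<And>x. H (K x) = x + H (K 0)" "\<And>x. K (H x) = x + K (H 0)"
    "\<And>x w. G (proj Z2 x) w = r * N (frechet_derivative H (at x) w $ 1 *\<^sub>R u + frechet_derivative H (at x) w $ 2 *\<^sub>R v)"
proof -
  define L where "L = lattice_gen u v"
  define lam where "lam x = x $ 1 *\<^sub>R u + x $ 2 *\<^sub>R v" for x :: "real^2"
  \<comment> \<open>The inverse of \<open>lam\<close> by Cramer's rule; taking images under it turns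
    cosets of \<open>L\<close> into cosets of \<open>Z2\<close>.\<close>
  define coo :: "real^2 \<Rightarrow> real^2" where "coo y = (1 / cr u v) *\<^sub>R vector [cr y v, cr u y]" for y
  have c0: "cr u v \<noteq> 0" using uv by (rule is_basis_cr)
  have lc: "lam (coo y) = y" for y
  proof -
    have "lam (coo y) = (1 / cr u v) *\<^sub>R (cr y v *\<^sub>R u + cr u y *\<^sub>R v)"
      by (simp add: lam_def coo_def scaleR_add_right)
    also have "\<dots> = (1 / cr u v) *\<^sub>R (cr u v *\<^sub>R y)" by (rule arg_cong[OF cr_expand[symmetric]])
    finally show ?thesis using c0 by simp
  qed
  have cl: "coo (lam x) = x" for x
    using c0 by (simp add: coo_def lam_def vec_eq_iff forall_2 cr_add_left cr_add_right)
  have lin: "linear lam" "linear coo"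
    unfolding lam_def coo_def
    by (intro linearI; simp add: vec_eq_iff forall_2 cr_add_left cr_add_right algebra_simps add_divide_distrib)+
  then have bl: "bounded_linear lam" "bounded_linear coo" by (simp_all add: linear_conv_bounded_linear)
  have L: "L = lam ` Z2"
  proof
    show "L \<subseteq> lam ` Z2"
    proof
      fix l assume "l \<in> L"
      then obtain m n :: int where "l = of_int m *\<^sub>R u + of_int n *\<^sub>R v" by (auto simp: L_def lattice_gen_def)
      then have "l = lam (vector [of_int m, of_int n])" by (simp add: lam_def)
      moreover have "vector [of_int m, of_int n] \<in> Z2" by (simp add: Z2_def forall_2)
      ultimately show "l \<in> lam ` Z2" by blast
    qed
    show "lam ` Z2 \<subseteq> L"
    proof
      fix l assume "l \<in> lam ` Z2"
      then obtain x where x: "x \<in> Z2" "l = lam x" by blast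
      then obtain m n :: int where "x $ 1 = of_int m" "x $ 2 = of_int n"
        unfolding Z2_def by (metis (mono_tags, lifting) Ints_cases mem_Collect_eq)
      then show "l \<in> L" unfolding L_def lattice_gen_def x lam_def by auto
    qed
  qed
  have pL: "lam ` proj Z2 x = proj L (lam x)" for x
    unfolding proj_def L image_image by (simp add: linear_add[OF lin(1)])
  have pZ: "coo ` proj L y = proj Z2 (coo y)" for y
    unfolding proj_def L image_image by (simp add: linear_add[OF lin(2)] cl)
  have lci: "lam ` coo ` S = S" for S by (simp add: image_image lc)
  have r: "r > 0" and bij: "bij_betw \<Phi> (plane_mod Z2) (plane_mod L)"
    and sm: "smooth_map Z2 L \<Phi>" and sm': "smooth_map L Z2 (inv_into (plane_mod Z2) \<Phi>)"
    and G: "\<And>p D w. p \<in> plane_mod Z2 \<Longrightarrow> has_differential Z2 L \<Phi> p D \<Longrightarrow> G p w = r * N (D w)"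
    using hom by (auto simp: homothety_def diffeomorphism_def L_def)
  define \<Psi> where "\<Psi> = inv_into (plane_mod Z2) \<Phi>"
  have pm: "proj Z2 x \<in> plane_mod Z2" "proj L x \<in> plane_mod L" for x by (simp_all add: plane_mod_def)
  have \<Phi>\<Psi>: "\<Phi> (\<Psi> (proj L y)) = proj L y" for y
    unfolding \<Psi>_def by (rule bij_betw_inv_into_right[OF bij pm(2)])
  have \<Psi>\<Phi>: "\<Psi> (\<Phi> (proj Z2 y)) = proj Z2 y" for y
    unfolding \<Psi>_def by (rule bij_betw_inv_into_left[OF bij pm(1)])
  have "\<exists>H. smooth_on H UNIV \<and> (\<forall>y. coo ` \<Phi> (proj Z2 y) = proj Z2 (H y))"
  proof (rule global_lift[of "\<lambda>p. coo ` \<Phi> p"])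
    fix x
    obtain U h where U: "open U" "x \<in> U" "smooth_on h U" "\<forall>y\<in>U. \<Phi> (proj Z2 y) = proj L (h y)"
      using sm[unfolded smooth_map_def, rule_format, of x] by (elim exE conjE)
    show "\<exists>U h. open U \<and> x \<in> U \<and> smooth_on h U \<and> (\<forall>y\<in>U. coo ` \<Phi> (proj Z2 y) = proj Z2 (h y))"
    proof (intro exI conjI)
      show "smooth_on (\<lambda>y. coo (h y)) U" by (rule smooth_on_linear_post[OF bl(2) U(1,3)])
      show "\<forall>y\<in>U. coo ` \<Phi> (proj Z2 y) = proj Z2 (coo (h y))" using U(4) by (simp add: pZ)
    qed (rule U)+
  qed
  then obtain H where H: "smooth_on H UNIV" "\<And>y. coo ` \<Phi> (proj Z2 y) = proj Z2 (H y)" by blast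
  have "\<exists>K. smooth_on K UNIV \<and> (\<forall>y. \<Psi> (lam ` proj Z2 y) = proj Z2 (K y))"
  proof (rule global_lift[of "\<lambda>p. \<Psi> (lam ` p)"])
    fix x
    obtain U h where U: "open U" "lam x \<in> U" "smooth_on h U" "\<forall>y\<in>U. \<Psi> (proj L y) = proj Z2 (h y)"
      using sm'[unfolded smooth_map_def, rule_format, of "lam x"] unfolding \<Psi>_def by (elim exE conjE)
    show "\<exists>U h. open U \<and> x \<in> U \<and> smooth_on h U \<and> (\<forall>y\<in>U. \<Psi> (lam ` proj Z2 y) = proj Z2 (h y))"
    proof (intro exI conjI)
      show "open (lam -` U)" using U(1) bl(1) by (intro open_vimage linear_continuous_on)
      show "x \<in> lam -` U" using U(2) by simp
      show "smooth_on (\<lambda>y. h (lam y)) (lam -` U)" by (rule smooth_on_linear_pre[OF bl(1) U(1,3)])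
      show "\<forall>y\<in>lam -` U. \<Psi> (lam ` proj Z2 y) = proj Z2 (h (lam y))" using U(4) by (simp add: pL)
    qed
  qed
  then obtain K where K: "smooth_on K UNIV" "\<And>y. \<Psi> (lam ` proj Z2 y) = proj Z2 (K y)" by blast
  have \<Phi>H: "\<Phi> (proj Z2 y) = proj L (lam (H y))" for y
    using arg_cong[OF H(2)[of y], of "\<lambda>S. lam ` S"] by (simp add: lci pL)
  have \<Psi>K: "\<Psi> (proj L (lam y)) = proj Z2 (K y)" for y
    using K(2)[of y] by (simp add: pL)
  have cont: "continuous_on UNIV H" "continuous_on UNIV K"
    using H(1) K(1) Ck_on_continuous unfolding smooth_on_def by blast+
  have "proj Z2 (H (K x)) = proj Z2 x" for x
    using H(2)[of "K x"] by (simp add: \<Psi>K[symmetric] \<Phi>\<Psi> pZ cl)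
  then have Z1: "H (K x) - x \<in> Z2" for x by (simp add: proj_Z2_eq_iff)
  have "proj Z2 (K (H x)) = proj Z2 x" for x
    by (simp add: \<Psi>K[symmetric] \<Phi>H[symmetric] \<Psi>\<Phi>)
  then have Z2': "K (H x) - x \<in> Z2" for x by (simp add: proj_Z2_eq_iff)
  \<comment> \<open>Both composites lift the identity, so they differ from it by lattice vectors,
    which are constant by continuity.\<close>
  have cHK: "continuous_on UNIV (\<lambda>x. H (K x) - x)" "continuous_on UNIV (\<lambda>x. K (H x) - x)"
    using continuous_on_compose2[OF cont(1) cont(2)] continuous_on_compose2[OF cont(2) cont(1)]
    by (auto intro!: continuous_on_diff continuous_on_id)
  show ?thesis
  proof (rule that[of H K])
    show "smooth_on H UNIV" "smooth_on K UNIV" by (rule H(1), rule K(1))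
    show "H (x + k) = H x + (H k - H 0)" "H k - H 0 \<in> Z2" "K (x + k) = K x + (K k - K 0)" "K k - K 0 \<in> Z2"
      if "k \<in> Z2" for x k
      using lift_equivariant[of H "\<lambda>p. coo ` \<Phi> p", OF cont(1) H(2) that]
        lift_equivariant[of K "\<lambda>p. \<Psi> (lam ` p)", OF cont(2) K(2) that] by blast+
    show "H (K x) = x + H (K 0)" "K (H x) = x + K (H 0)" for x
      using Z2_valued_constant[OF connected_UNIV cHK(1) Z1, of x 0] Z2_valued_constant[OF connected_UNIV cHK(2) Z2', of x 0]
      by (simp_all add: algebra_simps)
    fix x w
    have "H differentiable at x" using H(1)[unfolded smooth_on_def, rule_format, of "Suc 0"] by simp
    then have "(H has_derivative frechet_derivative H (at x)) (at x)" by (simp flip: frechet_derivative_works)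
    from bounded_linear.has_derivative[OF bl(1) this]
    have "has_differential Z2 L \<Phi> (proj Z2 x) (\<lambda>w. lam (frechet_derivative H (at x) w))"
      unfolding has_differential_def
      by (intro exI[of _ x] exI[of _ "\<lambda>y. lam (H y)"]) (simp add: \<Phi>H)
    from G[OF pm(1) this] show "G (proj Z2 x) w =
        r * N (frechet_derivative H (at x) w $ 1 *\<^sub>R u + frechet_derivative H (at x) w $ 2 *\<^sub>R v)"
      by (simp add: lam_def)
  qed
qed

text \<open>The curves are the inverse images under the homothety of the straight loops in the
  directions \<open>u\<close> and \<open>v\<close>, so their speed is constantly
  \<open>r * N u\<close> and \<open>r * N v\<close>.\<close>

lemma homothety_equality:
  assumes N: "is_norm N" and pq: "is_basis p q" and P: "{x. N x \<le> 1} = parallelogram z p q"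
    and uv: "is_basis u v" "u \<in> span {p}" "v \<in> span {q}"
    and hom: "homothety Z2 G (lattice_gen u v) (\<lambda>_. N) r \<Phi>"
  shows "\<exists>\<gamma>\<^sub>1 \<gamma>\<^sub>2. closed_curve 0 1 \<gamma>\<^sub>1 \<and> closed_curve 0 1 \<gamma>\<^sub>2 \<and>
     curve_length G 0 1 \<gamma>\<^sub>1 = r * N u \<and> curve_length G 0 1 \<gamma>\<^sub>2 = r * N v \<and>
     generate_H1 \<gamma>\<^sub>1 \<gamma>\<^sub>2 \<and> vol_HT G = 2 / pi * ((r * N u) * (r * N v))"
proof -
  define lam where "lam x = x $ 1 *\<^sub>R u + x $ 2 *\<^sub>R v" for x :: "real^2"
  have r: "r > 0" using hom by (simp add: homothety_def)
  have cuv: "cr u v \<noteq> 0" and cpq: "cr p q \<noteq> 0" by (rule is_basis_cr[OF uv(1)], rule is_basis_cr[OF pq])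
  have lin_lam: "linear lam"
    unfolding lam_def by (intro linearI) (simp_all add: algebra_simps)
  have lam_inj: "lam x = 0 \<Longrightarrow> x = 0" for x
  proof -
    assume "lam x = 0"
    then have "cr (lam x) v = 0" "cr u (lam x) = 0" by simp_all
    then show "x = 0" using cuv by (simp add: lam_def cr_add_left cr_add_right vec_eq_iff forall_2)
  qed
  obtain H K where sm: "smooth_on H UNIV" "smooth_on K UNIV"
    and Hk: "\<And>x k. k \<in> Z2 \<Longrightarrow> H (x + k) = H x + (H k - H 0)" "\<And>k. k \<in> Z2 \<Longrightarrow> H k - H 0 \<in> Z2"
    and Kk: "\<And>x k. k \<in> Z2 \<Longrightarrow> K (x + k) = K x + (K k - K 0)" "\<And>k. k \<in> Z2 \<Longrightarrow> K k - K 0 \<in> Z2"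
    and HK: "\<And>x. H (K x) = x + H (K 0)" "\<And>x. K (H x) = x + K (H 0)"
    and G0: "\<And>x w. G (proj Z2 x) w = r * N (frechet_derivative H (at x) w $ 1 *\<^sub>R u + frechet_derivative H (at x) w $ 2 *\<^sub>R v)"
    by (rule homothety_lifts[OF uv(1) hom]) blast
  define DH DK where "DH x = frechet_derivative H (at x)" and "DK x = frechet_derivative K (at x)" for x
  have G: "G (proj Z2 x) w = r * N (lam (DH x w))" for x w unfolding G0 lam_def DH_def ..
  have dH: "(H has_derivative DH x) (at x)" and dK: "(K has_derivative DK x) (at x)" for x
    using sm[unfolded smooth_on_def, rule_format, of "Suc 0"] unfolding DH_def DK_def
    by (simp_all flip: frechet_derivative_works)
  \<comment> \<open>The composites of \<open>H\<close> and \<open>K\<close> are translations, whose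
    derivative is the identity.\<close>
  have DHK: "DH (K x) (DK x w) = w" and DKH: "DK (H x) (DH x w) = w" for x w
  proof -
    have "((\<lambda>x. x + c) has_derivative (\<lambda>w. w)) (at x)" for c x :: "real^2"
      by (auto intro!: derivative_eq_intros)
    note id = this
    have eq: "(\<lambda>x. H (K x)) = (\<lambda>x. x + H (K 0))" "(\<lambda>x. K (H x)) = (\<lambda>x. x + K (H 0))"
      by (rule ext, rule HK)+
    have "((\<lambda>x. x + H (K 0)) has_derivative (\<lambda>w. DH (K x) (DK x w))) (at x)"
      using has_derivative_compose[OF dK dH, of x] unfolding eq .
    from has_derivative_unique[OF this id] show "DH (K x) (DK x w) = w" by (rule fun_cong)
    have "((\<lambda>x. x + K (H 0)) has_derivative (\<lambda>w. DK (H x) (DH x w))) (at x)"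
      using has_derivative_compose[OF dH dK, of x] unfolding eq .
    from has_derivative_unique[OF this id] show "DK (H x) (DH x w) = w" by (rule fun_cong)
  qed
  define A A' where "A k = H k - H 0" and "A' k = K k - K 0" for k
  have A'_add: "A' (k + l) = A' k + A' l" if "k \<in> Z2" "l \<in> Z2" for k l
    using Kk(1)[OF that(2), of k] by (simp add: A'_def)
  have A'A: "A' (A k) = k" if k: "k \<in> Z2" for k
  proof -
    have "K (H (0 + k)) = K (H 0) + A' (A k)"
      unfolding Hk(1)[OF k, of 0] using Kk(1)[OF Hk(2)[OF k], of "H 0"] by (simp add: A_def A'_def)
    then show ?thesis using HK(2)[of k] by simp
  qed
  define e1 e2 :: "real^2" where "e1 = axis 1 1" and "e2 = axis 2 1"
  have eZ: "e1 \<in> Z2" "e2 \<in> Z2" by (simp_all add: e1_def e2_def Z2_axis)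
  have AZ: "A k \<in> Z2" "A' k \<in> Z2" if "k \<in> Z2" for k using Hk(2) Kk(2) that by (auto simp: A_def A'_def)
  \<comment> \<open>\<open>A'\<close> inverts \<open>A\<close> on the lattice, so these two integer
    determinants have product 1.\<close>
  have prod: "cr (A e1) (A e2) * cr (A' e1) (A' e2) = 1"
    using additive_on_Z2_cr[of A', OF A'_add AZ(1)[OF eZ(1)] AZ(1)[OF eZ(2)]] A'A eZ
    by (simp add: e1_def e2_def cr_axis)
  have detA: "\<bar>cr (A e1) (A e2)\<bar> = 1"
    by (rule Ints_mult_eq_1[OF _ _ prod]) (intro cr_Ints AZ eZ)+
  have detA': "\<bar>cr (A' e1) (A' e2)\<bar> = 1"
    by (rule Ints_mult_eq_1[OF _ _ trans[OF mult.commute prod]]) (intro cr_Ints AZ eZ)+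
  \<comment> \<open>\<open>H\<close> sends this curve to a translate of the straight segment in the
    direction \<open>e\<close>.\<close>
  define c where "c e t = K (t *\<^sub>R e)" for e and t :: real
  have sc: "smooth_on (c e) UNIV" for e
  proof -
    have "bounded_linear (\<lambda>t :: real. t *\<^sub>R e)" by (rule bounded_linear_scaleR_left)
    from smooth_on_linear_pre[OF this open_UNIV sm(2)] show ?thesis by (simp add: c_def[abs_def])
  qed
  have len: "curve_length G 0 1 (\<lambda>t. proj Z2 (c e t)) = r * N (lam e)" for e
  proof -
    have "G (proj Z2 (c e t)) (velocity (\<lambda>t. proj Z2 (c e t)) t) = r * N (lam e)" for t
    proof -
      have "((\<lambda>t. t *\<^sub>R e) has_derivative (\<lambda>h. h *\<^sub>R e)) (at t)"
        by (auto intro!: derivative_eq_intros)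
      from has_derivative_compose[OF this dK]
      have "(c e has_derivative (\<lambda>h. DK (t *\<^sub>R e) (h *\<^sub>R e))) (at t)" by (simp add: c_def[abs_def])
      moreover have "(\<lambda>h. DK (t *\<^sub>R e) (h *\<^sub>R e)) = (\<lambda>h. h *\<^sub>R DK (t *\<^sub>R e) e)"
        using has_derivative_linear[OF dK] by (auto simp: linear_scale)
      ultimately have "(c e has_vector_derivative DK (t *\<^sub>R e) e) (at t)"
        by (simp add: has_vector_derivative_def)
      then have "has_velocity (\<lambda>t. proj Z2 (c e t)) t (DK (t *\<^sub>R e) e)"
        unfolding has_velocity_def by (intro exI[of _ "c e"]) simp
      from velocity_eq[OF this] show ?thesis by (simp add: c_def G DHK)
    qed
    then show ?thesis by (simp add: curve_length_def)
  qed
  have closed: "closed_curve 0 1 (\<lambda>t. proj Z2 (c e t))" if "e \<in> Z2" for e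
  proof (rule smooth_closed_curve[OF sc])
    have "c e 1 = c e 0 + A' e" by (simp add: c_def A'_def)
    then show "proj Z2 (c e 0) = proj Z2 (c e 1)"
      using proj_Z2_add[OF AZ(2)[OF that], of "c e 0"] by simp
  qed
  have gen: "generate_H1 (\<lambda>t. proj Z2 (c e1 t)) (\<lambda>t. proj Z2 (c e2 t))"
  proof (rule generate_H1_if_zbasis)
    show "continuous_on {0..1} (c e1)" "continuous_on {0..1} (c e2)"
      by (rule continuous_on_subset[OF Ck_on_continuous[OF sc[unfolded smooth_on_def, rule_format]]], simp)+
    show "zbasis (c e1 1 - c e1 0) (c e2 1 - c e2 0)"
      using detA' AZ(2) eZ unfolding zbasis_def by (simp add: c_def A'_def)
  qed auto
  obtain \<alpha> \<beta> where ab: "u = \<alpha> *\<^sub>R p" "v = \<beta> *\<^sub>R q" using uv(2,3) by (auto simp: span_singleton)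
  have scale: "N (t *\<^sub>R x) = \<bar>t\<bar> * N x" for t x using N by (simp add: is_norm_def)
  have Nuv: "N u = 2 * \<bar>\<alpha>\<bar>" "N v = 2 * \<bar>\<beta>\<bar>"
    unfolding ab scale parallelogram_norm(2,3)[OF N cpq P] by simp_all
  define J where "J = (\<lambda>x. cr (frechet_derivative H (at x) (axis 1 1)) (frechet_derivative H (at x) (axis 2 1)))"
  have per: "H (x + axis i 1) = H x + A (axis i 1)" for x i
    using Hk(1)[OF Z2_axis] by (simp add: A_def)
  have J: "continuous_on UNIV J" "integral (cbox 0 1) J = cr (A e1) (A e2)"
    using integral_jacobian[OF sm(1) per] by (simp_all add: J_def e1_def e2_def)
  have linDH: "linear (DH x)" for x using dH by (rule has_derivative_linear)
  have J0: "J x \<noteq> 0" for x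
  proof -
    have lin: "linear (DK (H x))" using dK by (rule has_derivative_linear)
    have "1 = cr (DK (H x) (DH x e1)) (DK (H x) (DH x e2))" by (simp add: DKH e1_def e2_def cr_axis)
    also have "\<dots> = cr (DK (H x) (axis 1 1)) (DK (H x) (axis 2 1)) * cr (DH x e1) (DH x e2)" by (rule cr_linear[OF lin])
    finally show ?thesis by (auto simp: J_def DH_def e1_def e2_def)
  qed
  \<comment> \<open>The area of the dual ball is 8 over the determinant of the preimages of
    \<open>p\<close>, \<open>q\<close> under the map \<open>M\<close> below, and \<open>M\<close>
    has determinant \<open>r\<^sup>2 * cr u v * J x\<close>.\<close>
  define C where "C = 8 * r\<^sup>2 * \<bar>cr u v\<bar> / \<bar>cr p q\<bar>"
  have ball: "measure lebesgue (dual_ball G (proj Z2 x)) = C * \<bar>J x\<bar>" for x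
  proof -
    define M where "M w = r *\<^sub>R lam (DH x w)" for w
    have linM: "linear M"
      unfolding M_def by (intro linearI) (simp_all add: linear_add[OF linDH] linear_scale[OF linDH] linear_add[OF lin_lam] linear_scale[OF lin_lam] scaleR_add_right)
    have injM: "inj M"
      unfolding linear_injective_0[OF linM]
    proof (intro allI impI)
      fix w assume "M w = 0"
      then have "DH x w = 0" using r lam_inj by (simp add: M_def)
      then have "DK (H x) 0 = w" using DKH[of x w] by simp
      then show "w = 0" using linear_0[OF has_derivative_linear[OF dK]] by simp
    qed
    then have "surj M" using linear_injective_imp_surjective[OF linM] by blast
    then obtain p' q' where p': "M p' = p" "M q' = q" by (metis surjD)
    have "G (proj Z2 x) w \<le> 1 \<longleftrightarrow> (\<exists>s t. \<bar>s\<bar> \<le> 1 / 2 \<and> \<bar>t\<bar> \<le> 1 / 2 \<and> w = s *\<^sub>R p' + t *\<^sub>R q')" for w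
    proof -
      have "G (proj Z2 x) w = N (M w)" using r by (simp add: G M_def scale)
      then have "G (proj Z2 x) w \<le> 1 \<longleftrightarrow> (\<exists>s t. \<bar>s\<bar> \<le> 1 / 2 \<and> \<bar>t\<bar> \<le> 1 / 2 \<and> M w = s *\<^sub>R p + t *\<^sub>R q)"
        using parallelogram_norm(1)[OF N cpq P, of "M w"] by simp
      moreover have "M w = s *\<^sub>R p + t *\<^sub>R q \<longleftrightarrow> w = s *\<^sub>R p' + t *\<^sub>R q'" for s t
      proof -
        have "s *\<^sub>R p + t *\<^sub>R q = M (s *\<^sub>R p' + t *\<^sub>R q')"
          by (simp add: linear_add[OF linM] linear_scale[OF linM] p')
        then show ?thesis using injM by (simp add: inj_eq)
      qed
      ultimately show ?thesis by simp
    qed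
    then have db: "dual_ball G (proj Z2 x) = {\<xi>. \<bar>\<xi> \<bullet> p'\<bar> + \<bar>\<xi> \<bullet> q'\<bar> \<le> 2}"
      by (rule dual_ball_parallelogram)
    have "cr (lam a) (lam b) = cr u v * cr a b" for a b
      using cr_linear[OF lin_lam, of a b] by (simp add: lam_def axis_def)
    then have "cr p q = r\<^sup>2 * (cr u v * (J x * cr p' q'))"
      unfolding p'[symmetric] M_def using cr_linear[OF linDH, of x p' q']
      by (simp add: power2_eq_square J_def DH_def)
    then have crp: "\<bar>cr p q\<bar> = r\<^sup>2 * \<bar>cr u v\<bar> * \<bar>J x\<bar> * \<bar>cr p' q'\<bar>" by (simp add: abs_mult)
    then have nz: "cr p' q' \<noteq> 0" using cpq by auto
    show ?thesis
      unfolding db measure_dual_parallelogram[OF nz] C_def crp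
      using r cuv J0[of x] nz by (simp add: field_simps)
  qed
  have "vol_HT G = integral (cbox 0 1) (\<lambda>x. (C / pi) * \<bar>J x\<bar>)"
    unfolding vol_HT_def ball by simp
  also have "\<dots> = C / pi" using integral_abs_nonzero[OF J(1) J0] J(2) detA by simp
  \<comment> \<open>\<open>u\<close> and \<open>v\<close> are multiples of \<open>p\<close> and
    \<open>q\<close>, so \<open>cr p q\<close> cancels; a factor 2 in each of \<open>N u\<close> and
    \<open>N v\<close> turns 8 into 2.\<close>
  also have "C = 8 * r\<^sup>2 * (\<bar>\<alpha>\<bar> * \<bar>\<beta>\<bar>)"
    using cpq by (simp add: C_def ab abs_mult)
  finally have "vol_HT G = 2 / pi * ((r * N u) * (r * N v))"
    by (simp add: Nuv power2_eq_square)
  moreover have "lam e1 = u" "lam e2 = v" by (simp_all add: lam_def e1_def e2_def axis_def)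
  ultimately show ?thesis
    using closed[OF eZ(1)] closed[OF eZ(2)] len[of e1] len[of e2] gen by metis
qed

theorem proposition3p2:
  shows "(\<forall>F. finsler_metric F \<longrightarrow>
            (\<exists>\<gamma>\<^sub>1 \<gamma>\<^sub>2 a b. closed_curve 0 1 \<gamma>\<^sub>1 \<and> closed_curve 0 1 \<gamma>\<^sub>2 \<and>
               curve_length F 0 1 \<gamma>\<^sub>1 = a \<and> curve_length F 0 1 \<gamma>\<^sub>2 = b \<and>
               generate_H1 \<gamma>\<^sub>1 \<gamma>\<^sub>2 \<and> vol_HT F \<ge> 2 / pi * (a * b)))
       \<and> (\<forall>G N z p q u v r \<Phi>.
            is_norm N \<and> is_basis p q \<and> {x. N x \<le> 1} = parallelogram z p q \<and>
            is_basis u v \<and> u \<in> span {p} \<and> v \<in> span {q} \<and>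
            homothety Z2 G (lattice_gen u v) (\<lambda>_. N) r \<Phi> \<longrightarrow>
            (\<exists>\<gamma>\<^sub>1 \<gamma>\<^sub>2 a b. closed_curve 0 1 \<gamma>\<^sub>1 \<and> closed_curve 0 1 \<gamma>\<^sub>2 \<and>
               curve_length G 0 1 \<gamma>\<^sub>1 = a \<and> curve_length G 0 1 \<gamma>\<^sub>2 = b \<and>
               a = r * N u \<and> b = r * N v \<and>
               generate_H1 \<gamma>\<^sub>1 \<gamma>\<^sub>2 \<and> vol_HT G = 2 / pi * (a * b)))"
proof (intro conjI allI impI)
  fix F assume "finsler_metric F"
  then interpret finsler_torus F by unfold_locales
  show "\<exists>\<gamma>\<^sub>1 \<gamma>\<^sub>2 a b. closed_curve 0 1 \<gamma>\<^sub>1 \<and> closed_curve 0 1 \<gamma>\<^sub>2 \<and>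
      curve_length F 0 1 \<gamma>\<^sub>1 = a \<and> curve_length F 0 1 \<gamma>\<^sub>2 = b \<and>
      generate_H1 \<gamma>\<^sub>1 \<gamma>\<^sub>2 \<and> vol_HT F \<ge> 2 / pi * (a * b)"
  proof -
    obtain \<gamma>\<^sub>1 \<gamma>\<^sub>2 where "closed_curve 0 1 \<gamma>\<^sub>1" "closed_curve 0 1 \<gamma>\<^sub>2" "generate_H1 \<gamma>\<^sub>1 \<gamma>\<^sub>2"
      "2 / pi * (curve_length F 0 1 \<gamma>\<^sub>1 * curve_length F 0 1 \<gamma>\<^sub>2) \<le> vol_HT F"
      using short_basis by (elim exE conjE)
    then show ?thesis
      by (intro exI[of _ \<gamma>\<^sub>1] exI[of _ \<gamma>\<^sub>2] exI[of _ "curve_length F 0 1 \<gamma>\<^sub>1"]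
          exI[of _ "curve_length F 0 1 \<gamma>\<^sub>2"] conjI refl)
  qed
next
  fix G N z p q u v r \<Phi>
  assume "is_norm N \<and> is_basis p q \<and> {x. N x \<le> 1} = parallelogram z p q \<and>
      is_basis u v \<and> u \<in> span {p} \<and> v \<in> span {q} \<and>
      homothety Z2 G (lattice_gen u v) (\<lambda>_. N) r \<Phi>"
  then show "\<exists>\<gamma>\<^sub>1 \<gamma>\<^sub>2 a b. closed_curve 0 1 \<gamma>\<^sub>1 \<and> closed_curve 0 1 \<gamma>\<^sub>2 \<and>
      curve_length G 0 1 \<gamma>\<^sub>1 = a \<and> curve_length G 0 1 \<gamma>\<^sub>2 = b \<and>
      a = r * N u \<and> b = r * N v \<and>
      generate_H1 \<gamma>\<^sub>1 \<gamma>\<^sub>2 \<and> vol_HT G = 2 / pi * (a * b)"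
  proof (elim conjE)
    assume "is_norm N" "is_basis p q" "{x. N x \<le> 1} = parallelogram z p q" "is_basis u v"
      "u \<in> span {p}" "v \<in> span {q}" "homothety Z2 G (lattice_gen u v) (\<lambda>_. N) r \<Phi>"
    from homothety_equality[OF this] obtain \<gamma>\<^sub>1 \<gamma>\<^sub>2 where
      "closed_curve 0 1 \<gamma>\<^sub>1" "closed_curve 0 1 \<gamma>\<^sub>2" "curve_length G 0 1 \<gamma>\<^sub>1 = r * N u"
      "curve_length G 0 1 \<gamma>\<^sub>2 = r * N v" "generate_H1 \<gamma>\<^sub>1 \<gamma>\<^sub>2"
      "vol_HT G = 2 / pi * ((r * N u) * (r * N v))"
      by (elim exE conjE)
    then show ?thesis
      by (intro exI[of _ \<gamma>\<^sub>1] exI[of _ \<gamma>\<^sub>2] exI[of _ "r * N u"] exI[of _ "r * N v"] conjI refl)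
  qed
qed

end
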